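(* Let $\Omega\subset\mathbb{R}^n$ be a nonempty open set. If $u$ is a function on $\mathbb{R}^n$ which is quasicontinuous in $\mathbb{R}^n$, whose restriction to $\Omega$ belongs to $W^{1,p(\cdot)}(\Omega)$, and which satisfies $u=0$ q.e. on $\partial\Omega$, then $u\in W^{1,p(\cdot)}_0(\Omega)$.
   Context: Standing assumptions: $p:\mathbb{R}^n\to[1,\infty]$ is measurable, $1<p^-:=\operatorname{ess\,inf}_{\mathbb{R}^n}p\le p^+:=\operatorname{ess\,sup}_{\mathbb{R}^n}p<\infty$, and $p$ is log-H\"older continuous: there is $L>0$ with $|p(x)-p(y)|\le L/\log(e+1/|x-y|)$ for all $x,y\in\mathbb{R}^n$. For an open set $\Omega$, $L^{p(\cdot)}(\Omega)$ is the space of measurable $u:\Omega\to\mathbb{R}$ with finite norm $\|u\|_{L^{p(\cdot)}(\Omega)}=\inf\{\lambda>0:\int_\Omega|u(x)/\lambda|^{p(x)}\,dx\le1\}$; $W^{1,p(\cdot)}(\Omega)$ consists of $u\in L^{p(\cdot)}(\Omega)$ with distributional gradient $\nabla u\in L^{p(\cdot)}(\Omega)$, with norm $\|u\|_{L^{p(\cdot)}(\Omega)}+\|\nabla u\|_{L^{p(\cdot)}(\Omega)}$. $W^{1,p(\cdot)}_0(\Omega)$ is the closure in $W^{1,p(\cdot)}(\Omega)$ of the $W^{1,p(\cdot)}(\mathbb{R}^n)$-functions with compact support in $\Omega$. The $p(\cdot)$-capacity of $E\subset\mathbb{R}^n$ is $C_{p(\cdot)}(E)=\inf_u\int_{\mathbb{R}^n}(|u|^{p(x)}+|\nabla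 u|^{p(x)})\,dx$, the infimum being over all $u\in W^{1,p(\cdot)}(\mathbb{R}^n)$ with $u\ge1$ in a neighbourhood of $E$. A property holds quasieverywhere (q.e.) if it holds except on a set of zero $p(\cdot)$-capacity. A function $u:\Omega\to[-\infty,\infty]$ is quasicontinuous in $\Omega$ if for every $\varepsilon>0$ there is an open set $U\subset\mathbb{R}^n$ with $C_{p(\cdot)}(U)<\varepsilon$ such that $u|_{\Omega\setminus U}$ is real-valued and continuous. *)

theory Defs
  imports "HOL-Analysis.Analysis" "HOL-Probability.Essential_Supremum"
begin

section \<open>Variable exponents\<close>

definition essinf :: "'a measure \<Rightarrow> ('a \<Rightarrow> ereal) \<Rightarrow> ereal" where
  "essinf M f = Liminf (ae_filter M) f"

text \<open>
  For \<open>x = y\<close> the right-hand side of the log-Hoelder condition reads \<open>L\<close>, because division by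
  zero yields zero; the left-hand side is then zero as soon as \<open>p x\<close> is finite. In \<open>ereal\<close> one has
  \<open>\<infinity> - \<infinity> = \<infinity>\<close>, so the condition also makes \<open>p\<close> finite everywhere.
\<close>

definition log_holder :: "('a::metric_space \<Rightarrow> ereal) \<Rightarrow> bool" where
  "log_holder p \<longleftrightarrow>
     (\<exists>L>0. \<forall>x y. \<bar>p x - p y\<bar> \<le> ereal (L / ln (exp 1 + 1 / dist x y)))"

definition admissible_exponent :: "('a::euclidean_space \<Rightarrow> ereal) \<Rightarrow> bool" where
  "admissible_exponent p \<longleftrightarrow>
     p \<in> borel_measurable lebesgue \<and> (\<forall>x. 1 \<le> p x) \<and>
     1 < essinf lebesgue p \<and> esssup lebesgue p < \<infinity> \<and> log_holder p"

lemma admissible_exponent_finite: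
  assumes "admissible_exponent p"
  shows "\<bar>p x\<bar> \<noteq> \<infinity>"
proof -
  obtain L where "\<bar>p x - p x\<bar> \<le> ereal (L / ln (exp 1 + 1 / dist x x))"
    using assms unfolding admissible_exponent_def log_holder_def by blast
  then show ?thesis by (cases "p x") auto
qed


section \<open>Variable exponent Lebesgue spaces\<close>

text \<open>
  Functions on \<open>\<Omega>\<close> are represented by total functions of which only the values on \<open>\<Omega>\<close> matter, and
  elements of the function spaces by their representatives. The real value of \<open>p x\<close> is
  meaningful by \<open>admissible_exponent_finite\<close>.
\<close>

definition modular ::
  "('a::euclidean_space \<Rightarrow> ereal) \<Rightarrow> 'a set \<Rightarrow> ('a \<Rightarrow> 'b::real_normed_vector) \<Rightarrow> ennreal" where
  "modular p \<Omega> u = (\<integral>\<^sup>+x. ennreal (norm (u x) powr real_of_ereal (p x)) \<partial>lebesgue_on \<Omega>)"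

definition luxemburg_norm ::
  "('a::euclidean_space \<Rightarrow> ereal) \<Rightarrow> 'a set \<Rightarrow> ('a \<Rightarrow> 'b::real_normed_vector) \<Rightarrow> ennreal" where
  "luxemburg_norm p \<Omega> u = Inf {ennreal l |l. 0 < l \<and> modular p \<Omega> (\<lambda>x. u x /\<^sub>R l) \<le> 1}"

definition Lp_var ::
  "('a::euclidean_space \<Rightarrow> ereal) \<Rightarrow> 'a set \<Rightarrow> ('a \<Rightarrow> 'b::real_normed_vector) set" where
  "Lp_var p \<Omega> = {u \<in> borel_measurable (lebesgue_on \<Omega>). luxemburg_norm p \<Omega> u < \<infinity>}"


section \<open>Distributional gradients\<close>

definition partial_deriv :: "'n \<Rightarrow> (real^'n \<Rightarrow> real) \<Rightarrow> real^'n \<Rightarrow> real" where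
  "partial_deriv i f x = frechet_derivative f (at x) (axis i 1)"

primrec C_k :: "nat \<Rightarrow> (real^'n \<Rightarrow> real) \<Rightarrow> bool" where
  "C_k 0 f \<longleftrightarrow> continuous_on UNIV f"
| "C_k (Suc k) f \<longleftrightarrow> (\<forall>x. f differentiable (at x)) \<and> (\<forall>i. C_k k (partial_deriv i f))"

definition test_functions :: "(real^'n) set \<Rightarrow> (real^'n \<Rightarrow> real) set" where
  "test_functions \<Omega> =
     {\<phi>. (\<forall>k. C_k k \<phi>) \<and> compact (closure {x. \<phi> x \<noteq> 0}) \<and> closure {x. \<phi> x \<noteq> 0} \<subseteq> \<Omega>}"

definition locally_integrable ::
  "'a::euclidean_space set \<Rightarrow> ('a \<Rightarrow> 'b::{banach, second_countable_topology}) \<Rightarrow> bool" where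
  "locally_integrable \<Omega> u \<longleftrightarrow> (\<forall>K. compact K \<and> K \<subseteq> \<Omega> \<longrightarrow> integrable (lebesgue_on K) u)"

definition weak_gradient ::
  "(real^'n) set \<Rightarrow> (real^'n \<Rightarrow> real) \<Rightarrow> (real^'n \<Rightarrow> real^'n) \<Rightarrow> bool" where
  "weak_gradient \<Omega> u g \<longleftrightarrow>
     locally_integrable \<Omega> u \<and> locally_integrable \<Omega> g \<and>
     (\<forall>\<phi>\<in>test_functions \<Omega>. \<forall>i.
        (LINT x|lebesgue_on \<Omega>. u x * partial_deriv i \<phi> x) =
        - (LINT x|lebesgue_on \<Omega>. g x $ i * \<phi> x))"


section \<open>Variable exponent Sobolev spaces\<close>

definition W1p :: "(real^'n \<Rightarrow> ereal) \<Rightarrow> (real^'n) set \<Rightarrow> (real^'n \<Rightarrow> real) set" where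
  "W1p p \<Omega> = {u \<in> Lp_var p \<Omega>. \<exists>g\<in>Lp_var p \<Omega>. weak_gradient \<Omega> u g}"

text \<open>
  Any two weak gradients of \<open>u\<close> on an open set agree almost everywhere, so the infimum is taken
  over a single value; it only avoids choosing a representative of the gradient.
\<close>

definition W1p_norm ::
  "(real^'n \<Rightarrow> ereal) \<Rightarrow> (real^'n) set \<Rightarrow> (real^'n \<Rightarrow> real) \<Rightarrow> ennreal" where
  "W1p_norm p \<Omega> u = Inf {luxemburg_norm p \<Omega> u + luxemburg_norm p \<Omega> g |g. weak_gradient \<Omega> u g}"

definition compact_support_in :: "'a::euclidean_space set \<Rightarrow> ('a \<Rightarrow> real) \<Rightarrow> bool" where
  "compact_support_in \<Omega> v \<longleftrightarrow>
     (\<exists>K. compact K \<and> K \<subseteq> \<Omega> \<and> (AE x in lebesgue. x \<notin> K \<longrightarrow> v x = 0))"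

definition W1p0 :: "(real^'n \<Rightarrow> ereal) \<Rightarrow> (real^'n) set \<Rightarrow> (real^'n \<Rightarrow> real) set" where
  "W1p0 p \<Omega> = {u \<in> W1p p \<Omega>. \<forall>\<epsilon>>0.
     \<exists>v\<in>W1p p UNIV. compact_support_in \<Omega> v \<and> W1p_norm p \<Omega> (\<lambda>x. u x - v x) < \<epsilon>}"

text \<open>
  Membership of the restriction to \<open>\<Omega>\<close> of an extended-real-valued function, which has to be
  finite only almost everywhere.
\<close>

definition restriction_in ::
  "'a::euclidean_space set \<Rightarrow> ('a \<Rightarrow> ereal) \<Rightarrow> ('a \<Rightarrow> real) set \<Rightarrow> bool" where
  "restriction_in \<Omega> u X \<longleftrightarrow> (\<exists>v\<in>X. AE x in lebesgue_on \<Omega>. u x = ereal (v x))"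


section \<open>Capacity and quasicontinuity\<close>

text \<open>
  Admissible functions are Sobolev functions, i.e. determined up to null sets; accordingly
  \<open>u \<ge> 1\<close> in a neighbourhood is required almost everywhere.
\<close>

definition capacity :: "(real^'n \<Rightarrow> ereal) \<Rightarrow> (real^'n) set \<Rightarrow> ennreal" where
  "capacity p E = Inf
     {\<integral>\<^sup>+x. ennreal (\<bar>u x\<bar> powr real_of_ereal (p x) + norm (g x) powr real_of_ereal (p x)) \<partial>lebesgue
      |u g. u \<in> W1p p UNIV \<and> g \<in> Lp_var p UNIV \<and> weak_gradient UNIV u g \<and>
            (\<exists>V. open V \<and> E \<subseteq> V \<and> (AE x in lebesgue. x \<in> V \<longrightarrow> 1 \<le> u x))}"

definition quasieverywhere_on ::
  "(real^'n \<Rightarrow> ereal) \<Rightarrow> (real^'n) set \<Rightarrow> (real^'n \<Rightarrow> bool) \<Rightarrow> bool" where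
  "quasieverywhere_on p A P \<longleftrightarrow> (\<exists>N. capacity p N = 0 \<and> (\<forall>x\<in>A - N. P x))"

definition quasicontinuous_on ::
  "(real^'n \<Rightarrow> ereal) \<Rightarrow> (real^'n) set \<Rightarrow> (real^'n \<Rightarrow> ereal) \<Rightarrow> bool" where
  "quasicontinuous_on p \<Omega> u \<longleftrightarrow>
     (\<forall>\<epsilon>>0. \<exists>U. open U \<and> capacity p U < \<epsilon> \<and>
        (\<forall>x\<in>\<Omega> - U. \<bar>u x\<bar> \<noteq> \<infinity>) \<and> continuous_on (\<Omega> - U) u)"

end

theory Submission
  imports Defs "HOL-Computational_Algebra.Polynomial"
begin

text \<open>
  A quasicontinuous \<open>u\<close> is approximated by \<open>\<zeta>\<^sub>k \<psi>\<^sub>k(u) \<chi>(w\<^sub>k)\<close>. Here \<open>\<psi>\<^sub>k\<close> is a bounded \<open>C\<^sup>1\<close> truncation that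
  vanishes near 0 and tends to the identity, \<open>\<chi>\<close> is a tent with \<open>\<chi>(0) = 1\<close> and \<open>\<chi> = 0\<close> on
  \<open>[1, \<infinity>)\<close>, \<open>w\<^sub>k\<close> is a capacity test function of small modular that is at least 1 near the
  exceptional sets, and \<open>\<zeta>\<^sub>k\<close> is a spatial cutoff. Near a boundary point either \<open>w\<^sub>k \<ge> 1\<close> or \<open>u\<close> is
  so small, by continuity off the exceptional set, that \<open>\<psi>\<^sub>k(u) = 0\<close>; so the product has compact
  support in \<open>\<Omega>\<close>. The modular of \<open>\<psi>\<^sub>k(u) \<chi>'(w\<^sub>k) \<nabla>w\<^sub>k\<close> is small because \<open>w\<^sub>k\<close> is chosen after the bound of
  \<open>\<psi>\<^sub>k\<close>, and all other error terms are dominated. The product and chain rules for weak gradients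
  follow by mollification.
\<close>

section \<open>Smooth functions and bumps\<close>

text \<open>The obstacle is that \<open>u\<close> is continuous only off open sets of small
  capacity, and these sets may reach the boundary. The factor \<chi>(w) removes them at the price of
  a gradient term whose coefficient is as large as the truncation level. This is why the truncation
  must be bounded and why the test function is chosen only after its level. All profiles are C^1, so
  that chain rules survive a passage to the limit from smooth functions; max and min would bring in
  the gradient on level sets. Mollification takes place in L^1 over compact sets: there translations
  are isometries and continuous in the mean, whereas on spaces of variable exponent they are in
  general unbounded. From the exponent the argument takes measurability and bounds 1 \<le> p \<le>
  \<open>M\<close>, which turn convergence of modulars into convergence of norms and allow dominated
  convergence inside the modular. Prescribed rates 2^-k give almost everywhere convergence of whole
  sequences. The quasicontinuous \<open>u\<close> and the Sobolev function \<open>v\<close> agree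
  only almost everywhere, so all statements about supports are made up to null sets.\<close>

lemma partial_deriv_eq:
  "(f has_derivative D) (at x) \<Longrightarrow> partial_deriv i f x = D (axis i 1)"
  using frechet_derivative_at partial_deriv_def by metis

lemma partial_deriv_const [simp]: "partial_deriv i (\<lambda>x. c) = (\<lambda>x. 0)"
  by (intro ext partial_deriv_eq has_derivative_const)

lemma partial_deriv_add:
  assumes "f differentiable (at x)" "g differentiable (at x)"
  shows "partial_deriv i (\<lambda>x. f x + g x) x = partial_deriv i f x + partial_deriv i g x"
  using partial_deriv_eq[OF has_derivative_add[OF assms[unfolded frechet_derivative_works]]]
  by (simp add: partial_deriv_def)

lemma partial_deriv_mult:
  assumes "f differentiable (at x)" "g differentiable (at x)"
  shows "partial_deriv i (\<lambda>x. f x * g x) x = f x * partial_deriv i g x + partial_deriv i f x * g x"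
  using partial_deriv_eq[OF has_derivative_mult[OF assms[unfolded frechet_derivative_works]]]
  by (simp add: partial_deriv_def)

lemma has_derivative_comp_real:
  fixes f :: "'a::real_normed_vector \<Rightarrow> real"
  assumes "f differentiable (at x)" "(h has_field_derivative d) (at (f x))"
  shows "((\<lambda>x. h (f x)) has_derivative (\<lambda>y. d * frechet_derivative f (at x) y)) (at x)"
  using has_derivative_compose[OF assms(1)[unfolded frechet_derivative_works]
      assms(2)[unfolded has_field_derivative_def]]
  by simp

lemma partial_deriv_comp:
  assumes "f differentiable (at x)" "(h has_field_derivative d) (at (f x))"
  shows "partial_deriv i (\<lambda>x. h (f x)) x = d * partial_deriv i f x"
  using partial_deriv_eq[OF has_derivative_comp_real[OF assms]] by (simp add: partial_deriv_def)

lemma has_derivative_comp_affine: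
  fixes f :: "real^'n \<Rightarrow> real"
  assumes "f differentiable (at (a + c *\<^sub>R x))"
  shows "((\<lambda>x. f (a + c *\<^sub>R x)) has_derivative (\<lambda>y. c * frechet_derivative f (at (a + c *\<^sub>R x)) y)) (at x)"
proof -
  have "((\<lambda>x. a + c *\<^sub>R x) has_derivative (\<lambda>y. c *\<^sub>R y)) (at x)"
    by (auto intro!: derivative_eq_intros)
  from has_derivative_compose[OF this assms[unfolded frechet_derivative_works]]
  show ?thesis
    using linear_frechet_derivative[OF assms] by (simp add: linear_cmul)
qed

lemma partial_deriv_comp_affine:
  fixes f :: "real^'n \<Rightarrow> real"
  assumes "f differentiable (at (a + c *\<^sub>R x))"
  shows "partial_deriv i (\<lambda>x. f (a + c *\<^sub>R x)) x = c * partial_deriv i f (a + c *\<^sub>R x)"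
  using partial_deriv_eq[OF has_derivative_comp_affine[OF assms]] by (simp add: partial_deriv_def)

section \<open>Closure properties of the classes C^k\<close>

lemma C_k_const [simp]: "C_k k (\<lambda>x. c)"
  by (induction k arbitrary: c) auto

text \<open>The recursion for \<open>Suc k\<close> asks for differentiability and never for
  continuity of \<open>f\<close> itself, so the base case is that differentiable functions are
  continuous.\<close>

lemma C_k_Suc_D: "C_k (Suc k) f \<Longrightarrow> C_k k f"
proof (induction k arbitrary: f)
  case 0
  then show ?case
    by (auto intro!: continuous_at_imp_continuous_on differentiable_imp_continuous_within)
next
  case (Suc k)
  then show ?case
    by simp
qed

lemma C_k_add: "C_k k f \<Longrightarrow> C_k k g \<Longrightarrow> C_k k (\<lambda>x. f x + g x)"
proof (induction k arbitrary: f g)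
  case (Suc k)
  then have "partial_deriv i (\<lambda>x. f x + g x) = (\<lambda>x. partial_deriv i f x + partial_deriv i g x)" for i
    by (intro ext partial_deriv_add) auto
  with Suc show ?case
    by (auto intro: differentiable_add)
qed (auto intro: continuous_intros)

lemma C_k_mult: "C_k k f \<Longrightarrow> C_k k g \<Longrightarrow> C_k k (\<lambda>x. f x * g x)"
proof (induction k arbitrary: f g)
  case (Suc k)
  then have "partial_deriv i (\<lambda>x. f x * g x)
      = (\<lambda>x. f x * partial_deriv i g x + partial_deriv i f x * g x)" for i
    by (intro ext partial_deriv_mult) auto
  \<comment> \<open>Leibniz's rule leaves one factor undifferentiated, so the factors are also
    needed in the class one order lower.\<close>
  moreover have "C_k k f" "C_k k g"
    using Suc.prems C_k_Suc_D by blast+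
  ultimately show ?case
    using Suc by (auto intro!: differentiable_mult C_k_add)
qed (auto intro: continuous_intros)

lemma C_k_comp_affine: "C_k k f \<Longrightarrow> C_k k (\<lambda>x. f (a + c *\<^sub>R x))"
proof (induction k arbitrary: f)
  case 0
  then show ?case
    by (auto intro!: continuous_on_compose2[of UNIV f] continuous_intros)
next
  case (Suc k)
  then have "partial_deriv i (\<lambda>x. f (a + c *\<^sub>R x)) = (\<lambda>x. c * partial_deriv i f (a + c *\<^sub>R x))" for i
    by (intro ext partial_deriv_comp_affine) auto
  moreover have "(\<lambda>x. f (a + c *\<^sub>R x)) differentiable at x" for x
    using Suc.prems by (intro differentiableI[OF has_derivative_comp_affine]) auto
  ultimately show ?case
    using Suc by (auto intro!: C_k_mult)
qed

text \<open>\<open>\<gamma>\<close> is a whole tower of derivatives and \<open>m\<close> is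
  generalised in the induction, because the chain rule turns \<open>\<gamma> m\<close> into
  \<open>\<gamma> (Suc m)\<close> times a partial derivative of \<open>q\<close>.\<close>

lemma C_k_comp_derivs:
  assumes "\<And>m t. (\<gamma> m has_field_derivative \<gamma> (Suc m) t) (at t)" "\<And>k. C_k k q"
  shows "C_k k (\<lambda>x. \<gamma> m (q x))"
proof (induction k arbitrary: m)
  case 0
  have "continuous_on UNIV (\<gamma> m)" for m
    using assms(1) by (intro continuous_at_imp_continuous_on) (blast intro: DERIV_isCont)
  moreover have "continuous_on UNIV q"
    using assms(2)[of 0] by simp
  ultimately show ?case
    by (auto intro: continuous_on_compose2)
next
  case (Suc k)
  have dq: "q differentiable at x" "C_k k (partial_deriv i q)" for x i
    using assms(2)[of "Suc k"] by auto
  have "partial_deriv i (\<lambda>x. \<gamma> m (q x)) = (\<lambda>x. \<gamma> (Suc m) (q x) * partial_deriv i q x)" for i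
    by (intro ext partial_deriv_comp[OF dq(1) assms(1)])
  moreover have "(\<lambda>x. \<gamma> m (q x)) differentiable at x" for x
    using has_derivative_comp_real[OF dq(1) assms(1)] by (rule differentiableI)
  ultimately show ?case
    using C_k_mult[OF Suc dq(2)] by simp
qed

lemma C_k_component: "C_k k (\<lambda>x::real^'n. x $ i)"
proof (cases k)
  case (Suc m)
  have "((\<lambda>x::real^'n. x $ i) has_derivative (\<lambda>y. y $ i)) (at x)" for x
    by (simp add: bounded_linear_imp_has_derivative bounded_linear_vec_nth)
  moreover from this have "partial_deriv j (\<lambda>x::real^'n. x $ i) = (\<lambda>x. axis j 1 $ i)" for j :: 'n
    by (intro ext partial_deriv_eq)
  ultimately show ?thesis
    using Suc by (auto intro: differentiableI)
qed (auto intro: continuous_intros)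

lemma C_k_norm_square: "C_k k (\<lambda>x::real^'n. c - x \<bullet> x)"
proof (cases k)
  case (Suc m)
  have D: "((\<lambda>x::real^'n. c - x \<bullet> x) has_derivative (\<lambda>y. - 2 * (x \<bullet> y))) (at x)" for x
    by (auto intro!: derivative_eq_intros simp: inner_commute)
  then have "partial_deriv j (\<lambda>x::real^'n. c - x \<bullet> x) = (\<lambda>x. (- 2) * (x $ j))" for j
    by (intro ext, subst partial_deriv_eq[OF D]) (simp add: inner_axis)
  then show ?thesis
    unfolding Suc C_k.simps using D C_k_mult[OF C_k_const C_k_component]
    by (metis differentiableI)
qed (auto intro!: continuous_intros)

section \<open>Flat functions and the smooth bump\<close>

lemma tendsto_poly_div_exp_0: "((\<lambda>x. poly q x / exp x) \<longlongrightarrow> (0::real)) at_top"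
proof -
  have "((\<lambda>x. \<Sum>i\<le>degree q. coeff q i * (x ^ i / exp x)) \<longlongrightarrow> (\<Sum>i\<le>degree q. coeff q i * 0)) at_top"
    by (intro tendsto_sum tendsto_mult tendsto_const tendsto_power_div_exp_0)
  then show ?thesis
    by (simp add: poly_altdef sum_divide_distrib)
qed

text \<open>The functions q(1/t) exp(-1/t), extended by zero. Admitting every polynomial q makes the
  family closed under differentiation, so one differentiability proof gives derivatives of all
  orders.\<close>

definition flat_exp :: "real poly \<Rightarrow> real \<Rightarrow> real" where
  "flat_exp q t = (if t > 0 then poly q (inverse t) * exp (- inverse t) else 0)"

text \<open>This is the difference quotient at 0. With s = 1/t it reads s q(s) / exp s on the right,
  where the exponential wins; the factor \<open>[:0, 1:]\<close> absorbs the division by t.\<close>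

lemma flat_exp_div_tendsto_0: "((\<lambda>t. flat_exp q t / t) \<longlongrightarrow> 0) (at 0)"
proof -
  have "((\<lambda>t. poly ([:0, 1:] * q) (inverse t) / exp (inverse t)) \<longlongrightarrow> (0::real)) (at_right 0)"
    by (rule filterlim_compose[OF tendsto_poly_div_exp_0 filterlim_inverse_at_top_right])
  then have "((\<lambda>t. flat_exp q t / t) \<longlongrightarrow> 0) (at_right 0)"
    by (rule Lim_transform_eventually)
      (auto simp: flat_exp_def eventually_at_filter exp_minus field_simps)
  moreover have "((\<lambda>t. flat_exp q t / t) \<longlongrightarrow> 0) (at_left 0)"
    by (rule Lim_transform_eventually[OF tendsto_const])
      (auto simp: flat_exp_def eventually_at_filter)
  ultimately show ?thesis
    by (simp add: filterlim_split_at)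
qed

text \<open>For t > 0 the derivative of q(1/t) exp(-1/t) is t^-2 (q - q')(1/t) exp(-1/t), and
  \<open>[:0, 0, 1:]\<close> is the polynomial s^2. At 0 the preceding limit glues the two
  halves.\<close>

lemma flat_exp_has_derivative:
  "(flat_exp q has_field_derivative flat_exp ([:0, 0, 1:] * (q - pderiv q)) t) (at t)"
proof -
  consider "t > 0" | "t < 0" | "t = 0"
    by linarith
  then show ?thesis
  proof cases
    case 1
    then have "((\<lambda>t. poly q (inverse t) * exp (- inverse t)) has_field_derivative
        flat_exp ([:0, 0, 1:] * (q - pderiv q)) t) (at t)"
      by (auto intro!: derivative_eq_intros DERIV_chain2[OF poly_DERIV]
          simp: flat_exp_def field_simps power2_eq_square)
    moreover have "eventually (\<lambda>t. t \<in> {0<..}) (nhds t)"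
      using 1 by (intro eventually_nhds_in_open) auto
    then have "eventually (\<lambda>t. flat_exp q t = poly q (inverse t) * exp (- inverse t)) (nhds t)"
      by eventually_elim (auto simp: flat_exp_def)
    ultimately show ?thesis
      by (subst DERIV_cong_ev[OF refl _ refl])
  next
    case 2
    have "eventually (\<lambda>t. t \<in> {..<0}) (nhds t)"
      using 2 by (intro eventually_nhds_in_open) auto
    then have "eventually (\<lambda>t. flat_exp q t = 0) (nhds t)"
      by eventually_elim (auto simp: flat_exp_def)
    then show ?thesis
      using 2 by (subst DERIV_cong_ev[OF refl _ refl]) (auto simp: flat_exp_def)
  next
    case 3
    then show ?thesis
      using flat_exp_div_tendsto_0[of q] by (simp add: has_field_derivative_iff flat_exp_def)
  qed
qed

text \<open>Inside the unit ball this is exp(1 - 1/(1 - |x|^2)); the constant \<open>exp 1\<close>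
  normalises the value at the origin to 1.\<close>

definition bump :: "real^'n \<Rightarrow> real" where
  "bump x = flat_exp [:exp 1:] (1 - x \<bullet> x)"

lemma C_k_bump: "C_k k bump"
proof -
  \<comment> \<open>\<open>\<gamma> m\<close> is the m-th derivative of the flat function, obtained
    by iterating the polynomial map of \<open>flat_exp_has_derivative\<close>.\<close>
  define \<gamma> where "\<gamma> m = flat_exp (((\<lambda>q. [:0, 0, 1:] * (q - pderiv q)) ^^ m) [:exp 1:])" for m :: nat
  have "C_k k (\<lambda>x. \<gamma> 0 (1 - x \<bullet> x))" for k
    by (intro C_k_comp_derivs[of \<gamma>] C_k_norm_square) (simp add: \<gamma>_def flat_exp_has_derivative del: mult_pCons_left)
  then show ?thesis
    by (simp add: bump_def[abs_def] \<gamma>_def)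
qed

lemma bump_zero: "bump 0 = 1"
  by (simp add: bump_def flat_exp_def flip: exp_add)

lemma bump_eq_0: "norm x \<ge> 1 \<Longrightarrow> bump x = 0"
  using power_mono[of 1 "norm x" 2] by (simp add: bump_def flat_exp_def power2_norm_eq_inner)

lemma bump_nonneg: "bump x \<ge> 0"
  by (simp add: bump_def flat_exp_def)

lemma bump_le_1: "bump x \<le> 1"
proof -
  have "exp 1 * exp (- inverse t) \<le> (1::real)" if "0 < t" "t \<le> 1" for t :: real
    using that by (simp add: one_le_inverse flip: exp_add)
  then show ?thesis
    by (simp add: bump_def flat_exp_def)
qed

section \<open>Continuity of translations in the mean\<close>

lemma nn_integral_lborel_diff:
  fixes z :: "'a::euclidean_space"
  assumes [measurable]: "f \<in> borel_measurable borel"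
  shows "(\<integral>\<^sup>+x. f (x - z) \<partial>lborel) = (\<integral>\<^sup>+x. f x \<partial>lborel)"
proof -
  have "(\<integral>\<^sup>+x. f x \<partial>lborel) = (\<integral>\<^sup>+x. f x \<partial>distr lborel borel ((+) (- z)))"
    by (simp only: lborel_distr_plus)
  then show ?thesis
    by (simp add: nn_integral_distr)
qed

lemma integral_lborel_diff:
  fixes z :: "'a::euclidean_space" and f :: "'a \<Rightarrow> real"
  assumes [measurable]: "f \<in> borel_measurable borel"
  shows "(LINT x|lborel. f (x - z)) = (LINT x|lborel. f x)"
    and "integrable lborel (\<lambda>x. f (x - z)) \<longleftrightarrow> integrable lborel f"
proof -
  have "(LINT x|lborel. f x) = (LINT x|distr lborel borel ((+) (- z)). f x)"
    by (simp only: lborel_distr_plus)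
  then show "(LINT x|lborel. f (x - z)) = (LINT x|lborel. f x)"
    by (simp add: integral_distr)
  have "integrable lborel f \<longleftrightarrow> integrable (distr lborel borel ((+) (- z))) f"
    by (simp only: lborel_distr_plus)
  then show "integrable lborel (\<lambda>x. f (x - z)) \<longleftrightarrow> integrable lborel f"
    by (simp add: integrable_distr_eq)
qed

text \<open>The map x -> a - x has a linear part of determinant \<plusminus>1 and so preserves
  Lebesgue measure. It turns a convolution evaluated at \<open>a\<close> into an average of
  translates.\<close>

lemma integral_lborel_reflect:
  fixes a :: "'a::euclidean_space" and f :: "'a \<Rightarrow> real"
  assumes [measurable]: "f \<in> borel_measurable borel"
  shows "(LINT x|lborel. f (a - x)) = (LINT x|lborel. f x)"
    and "integrable lborel (\<lambda>x. f (a - x)) \<longleftrightarrow> integrable lborel f"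
proof -
  have D: "lborel = distr lborel borel (\<lambda>x::'a. a - x)"
    using lborel_affine[of "-1" a] by (simp add: density_1)
  have "(LINT x|lborel. f x) = (LINT x|distr lborel borel (\<lambda>x::'a. a - x). f x)"
    using D by simp
  then show "(LINT x|lborel. f (a - x)) = (LINT x|lborel. f x)"
    by (simp add: integral_distr)
  have "integrable lborel f \<longleftrightarrow> integrable (distr lborel borel (\<lambda>x::'a. a - x)) f"
    using D by simp
  then show "integrable lborel (\<lambda>x. f (a - x)) \<longleftrightarrow> integrable lborel f"
    by (simp add: integrable_distr_eq)
qed

text \<open>The L^1 distance between \<open>f\<close> and its translate, with values in
  \<open>ennreal\<close> so that estimates carry no integrability conditions.\<close>

definition translation_error :: "('a::euclidean_space \<Rightarrow> real) \<Rightarrow> 'a \<Rightarrow> ennreal" where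
  "translation_error f z = (\<integral>\<^sup>+x. ennreal \<bar>f (x - z) - f x\<bar> \<partial>lborel)"

text \<open>For an open set \<open>G\<close>, adding \<open>1\<^sub>G\<close> turns the absolute difference into
  \<open>1\<^sub>G(x - z) + 2 1\<^sub>G(x) (1 - 1\<^sub>G(x - z))\<close>; the first term has constant integral and the second tends
  to zero pointwise because \<open>G\<close> is open.\<close>

lemma translation_error_open:
  fixes G :: "'a::euclidean_space set"
  assumes "open G" "emeasure lborel G < \<infinity>" "z \<longlonglongrightarrow> 0"
  shows "(\<lambda>k. translation_error (indicator G) (z k)) \<longlonglongrightarrow> 0"
proof -
  have [measurable]: "G \<in> sets borel"
    using assms by auto
  define a where "a k x = (indicator G x * indicator (- G) (x - z k) :: ennreal)" for k x
  have [measurable]: "a k \<in> borel_measurable borel" for k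
    unfolding a_def by measurable
  have fin: "emeasure lborel G \<noteq> \<infinity>"
    using assms by auto
  have eq: "translation_error (indicator G) (z k) = 2 * (\<integral>\<^sup>+x. a k x \<partial>lborel)" for k
  proof -
    have "ennreal \<bar>indicator G (x - z k) - indicator G x\<bar> + indicator G x
        = indicator G (x - z k) + 2 * a k x" for x
      by (auto simp: a_def indicator_def)
    then have "(\<integral>\<^sup>+x. (ennreal \<bar>indicator G (x - z k) - indicator G x\<bar> + indicator G x) \<partial>lborel)
        = (\<integral>\<^sup>+x. (indicator G (x - z k) + 2 * a k x) \<partial>lborel)"
      by simp
    then have "translation_error (indicator G) (z k) + emeasure lborel G
        = (\<integral>\<^sup>+x. indicator G (x - z k) \<partial>lborel) + 2 * (\<integral>\<^sup>+x. a k x \<partial>lborel)"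
      by (simp add: translation_error_def nn_integral_add nn_integral_cmult)
    also have "(\<integral>\<^sup>+x. indicator G (x - z k) \<partial>lborel) = emeasure lborel G"
      by (subst nn_integral_lborel_diff) auto
    finally show ?thesis
      using fin by (simp add: add.commute ennreal_add_left_cancel)
  qed
  have "(\<lambda>k. \<integral>\<^sup>+x. a k x \<partial>lborel) \<longlonglongrightarrow> (\<integral>\<^sup>+(x::'a). 0 \<partial>lborel)"
  proof (rule nn_integral_dominated_convergence[where u' = "\<lambda>_. 0" and w = "indicator G"])
    show "AE x in lborel. (\<lambda>k. a k x) \<longlonglongrightarrow> 0"
    proof (intro AE_I2)
      fix x
      show "(\<lambda>k. a k x) \<longlonglongrightarrow> 0"
      proof (cases "x \<in> G")
        case True
        have "(\<lambda>k. x - z k) \<longlonglongrightarrow> x - 0"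
          by (intro tendsto_intros assms)
        with True assms(1) have "eventually (\<lambda>k. x - z k \<in> G) sequentially"
          by (simp add: topological_tendstoD)
        then have "eventually (\<lambda>k. 0 = a k x) sequentially"
          by eventually_elim (auto simp: a_def)
        then show ?thesis
          by (rule Lim_transform_eventually[OF tendsto_const])
      qed (simp add: a_def)
    qed
    show "AE x in lborel. a k x \<le> indicator G x" for k
      by (auto simp: a_def indicator_def)
    show "(\<integral>\<^sup>+x. indicator G x \<partial>lborel) < \<infinity>"
      using assms(2) by simp
  qed auto
  then have "(\<lambda>k. 2 * (\<integral>\<^sup>+x. a k x \<partial>lborel)) \<longlonglongrightarrow> 2 * 0"
    by (intro ennreal_tendsto_cmult) (auto simp: ennreal_numeral_less_top)
  then show ?thesis
    by (simp add: eq)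
qed

text \<open>The factor 2 arises because f - g is counted at x - z and at x; the two integrals agree
  by translation invariance.\<close>

lemma translation_error_triangle:
  assumes [measurable]: "f \<in> borel_measurable borel" "g \<in> borel_measurable borel"
  shows "translation_error f z
    \<le> 2 * (\<integral>\<^sup>+x. ennreal \<bar>f x - g x\<bar> \<partial>lborel) + translation_error g z"
proof -
  have "translation_error f z \<le> (\<integral>\<^sup>+x. ennreal \<bar>f (x - z) - g (x - z)\<bar> + ennreal \<bar>f x - g x\<bar>
      + ennreal \<bar>g (x - z) - g x\<bar> \<partial>lborel)"
    unfolding translation_error_def by (intro nn_integral_mono) (auto simp flip: ennreal_plus)
  also have "\<dots> = (\<integral>\<^sup>+x. ennreal \<bar>f (x - z) - g (x - z)\<bar> \<partial>lborel)
      + (\<integral>\<^sup>+x. ennreal \<bar>f x - g x\<bar> \<partial>lborel) + translation_error g z"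
    by (simp add: nn_integral_add translation_error_def)
  also have "(\<integral>\<^sup>+x. ennreal \<bar>f (x - z) - g (x - z)\<bar> \<partial>lborel) = (\<integral>\<^sup>+x. ennreal \<bar>f x - g x\<bar> \<partial>lborel)"
    by (rule nn_integral_lborel_diff[of "\<lambda>x. ennreal \<bar>f x - g x\<bar>"]) measurable
  finally show ?thesis
    by (simp add: mult_2)
qed

text \<open>Continuity in the mean is stable under L^1 approximation. Both the passage from open to
  Borel sets and the passage from simple to integrable functions have this form.\<close>

lemma translation_error_tendsto_0_approx:
  assumes "f \<in> borel_measurable borel"
    and approx: "\<And>e. e > 0 \<Longrightarrow> \<exists>g\<in>borel_measurable borel. (\<integral>\<^sup>+x. ennreal \<bar>f x - g x\<bar> \<partial>lborel) \<le> ennreal e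
      \<and> (\<lambda>k. translation_error g (z k)) \<longlonglongrightarrow> 0"
  shows "(\<lambda>k. translation_error f (z k)) \<longlonglongrightarrow> 0"
proof (rule order_tendstoI)
  fix e :: ennreal
  assume "0 < e"
  then obtain d where d: "0 < d" "ennreal d < e"
  proof -
    from dense[OF \<open>0 < e\<close>] obtain c where "0 < c" "c < e"
      by auto
    then show ?thesis
      using that[of "enn2real c"] by (cases c) (auto simp: top.not_eq_extremum)
  qed
  \<comment> \<open>The triangle estimate counts the approximation error twice: 2 * d/4 + d/2 =
    d.\<close>
  obtain g where g: "g \<in> borel_measurable borel" "(\<integral>\<^sup>+x. ennreal \<bar>f x - g x\<bar> \<partial>lborel) \<le> ennreal (d/4)"
     "(\<lambda>k. translation_error g (z k)) \<longlonglongrightarrow> 0"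
    using approx[of "d/4"] d by auto
  have "eventually (\<lambda>k. translation_error g (z k) < ennreal (d/2)) sequentially"
    using d by (intro order_tendstoD(2)[OF g(3)]) auto
  then show "eventually (\<lambda>k. translation_error f (z k) < e) sequentially"
  proof eventually_elim
    case (elim k)
    have "translation_error f (z k) \<le> 2 * ennreal (d/4) + ennreal (d/2)"
      using translation_error_triangle[OF assms(1) g(1), of "z k"] g(2) elim
      by (meson add_mono less_imp_le mult_left_mono order_trans zero_le)
    also have "\<dots> = ennreal d"
      using d by (simp add: ennreal_mult'[symmetric] flip: ennreal_plus ennreal_numeral)
    finally show ?case
      using d by simp
  qed
qed auto

text \<open>Induction over integrable functions: outer regularity reduces indicators to open sets,
  the error is subadditive, and dominated limits are L^1 limits.\<close>

lemma translation_error_tendsto_0: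
  fixes f :: "'a::euclidean_space \<Rightarrow> real"
  assumes "integrable lborel f" "z \<longlonglongrightarrow> 0"
  shows "(\<lambda>k. translation_error f (z k)) \<longlonglongrightarrow> 0"
  using assms(1)
proof (induction rule: integrable_induct)
  case (base A c)
  have [measurable]: "A \<in> sets borel"
    using base by auto
  have "(\<lambda>k. translation_error (indicator A) (z k)) \<longlonglongrightarrow> 0"
  proof (rule translation_error_tendsto_0_approx)
    fix e :: real
    assume "e > 0"
    obtain G where G: "open G" "A \<subseteq> G" "emeasure lborel (G - A) < ennreal e"
      using outer_regular_lborel[OF _ \<open>e > 0\<close>, of A] by auto
    have [measurable]: "G \<in> sets borel"
      using G by auto
    \<comment> \<open>The case of open sets needs finite measure, which \<open>G\<close> inherits
      from \<open>A\<close>.\<close>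
    have "emeasure lborel G = emeasure lborel (G - A) + emeasure lborel A"
      using G(2) by (subst plus_emeasure) (auto intro!: arg_cong[where f = "emeasure lborel"])
    then have fin: "emeasure lborel G < \<infinity>"
      using G(3) base(2) by (auto simp: ennreal_add_eq_top less_top order.strict_trans[OF _ ennreal_less_top])
    have "ennreal \<bar>indicator A x - indicator G x\<bar> = indicator (G - A) x" for x
      using G(2) by (auto simp: indicator_def)
    then have "(\<integral>\<^sup>+x. ennreal \<bar>indicator A x - indicator G x\<bar> \<partial>lborel) \<le> ennreal e"
      using G(3) by simp
    then show "\<exists>g\<in>borel_measurable borel. (\<integral>\<^sup>+x. ennreal \<bar>indicator A x - g x\<bar> \<partial>lborel) \<le> ennreal e
      \<and> (\<lambda>k. translation_error g (z k)) \<longlonglongrightarrow> 0"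
      using translation_error_open[OF G(1) fin assms(2)] by (intro bexI[of _ "indicator G"]) auto
  qed auto
  then have "(\<lambda>k. ennreal \<bar>c\<bar> * translation_error (indicator A) (z k)) \<longlonglongrightarrow> ennreal \<bar>c\<bar> * 0"
    by (intro ennreal_tendsto_cmult) auto
  moreover have "translation_error (\<lambda>x. indicator A x *\<^sub>R c) w = ennreal \<bar>c\<bar> * translation_error (indicator A) w" for w
    unfolding translation_error_def
    by (subst nn_integral_cmult[symmetric])
      (auto intro!: nn_integral_cong simp: ennreal_mult[symmetric] abs_mult[symmetric] algebra_simps)
  ultimately show ?case
    by simp
next
  case (add f g)
  have [measurable]: "f \<in> borel_measurable borel" "g \<in> borel_measurable borel"
    using add by auto
  have "(\<lambda>k. translation_error f (z k) + translation_error g (z k)) \<longlonglongrightarrow> 0 + 0"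
    by (intro tendsto_add add)
  moreover have "translation_error (\<lambda>x. f x + g x) w \<le> translation_error f w + translation_error g w" for w
    unfolding translation_error_def
    by (subst nn_integral_add[symmetric]) (auto intro!: nn_integral_mono simp flip: ennreal_plus)
  ultimately show ?case
    using tendsto_sandwich[where f = "\<lambda>_. 0" and g = "\<lambda>k. translation_error (\<lambda>x. f x + g x) (z k)"
        and h = "\<lambda>k. translation_error f (z k) + translation_error g (z k)" and c = 0 and net = sequentially]
    by simp
next
  case (lim f s)
  have [measurable]: "f \<in> borel_measurable borel" "s i \<in> borel_measurable borel" for i
    using lim by auto
  have L: "(\<lambda>i. \<integral>\<^sup>+x. norm (f x - s i x) \<partial>lborel) \<longlonglongrightarrow> 0"
  proof (rule nn_integral_dominated_convergence_norm)
    show "AE x in lborel. norm (s j x) \<le> 2 * norm (f x)" for j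
      using lim by auto
    show "(\<integral>\<^sup>+x. ennreal (2 * norm (f x)) \<partial>lborel) < \<infinity>"
      using lim by (auto simp: integrable_iff_bounded ennreal_mult nn_integral_cmult ennreal_mult_less_top)
  qed (use lim in auto)
  show ?case
  proof (rule translation_error_tendsto_0_approx)
    fix e :: real
    assume "e > 0"
    then have "eventually (\<lambda>i. (\<integral>\<^sup>+x. norm (f x - s i x) \<partial>lborel) < ennreal e) sequentially"
      by (intro order_tendstoD(2)[OF L]) auto
    then obtain i where "(\<integral>\<^sup>+x. norm (f x - s i x) \<partial>lborel) < ennreal e"
      by (auto simp: eventually_sequentially)
    then show "\<exists>g\<in>borel_measurable borel. (\<integral>\<^sup>+x. ennreal \<bar>f x - g x\<bar> \<partial>lborel) \<le> ennreal e
      \<and> (\<lambda>k. translation_error g (z k)) \<longlonglongrightarrow> 0"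
      using lim by (intro bexI[of _ "s i"]) (auto simp: abs_minus_commute)
  qed auto
qed

lemma translation_error_small:
  fixes f :: "'a::euclidean_space \<Rightarrow> real"
  assumes "integrable lborel f" "e > 0"
  shows "\<exists>d>0. \<forall>z. norm z < d \<longrightarrow> translation_error f z \<le> e"
proof -
  have "eventually (\<lambda>z. translation_error f z \<le> e) (at 0 within UNIV)"
  proof (rule sequentially_imp_eventually_within, intro allI impI, elim conjE)
    fix z :: "nat \<Rightarrow> 'a"
    assume "z \<longlonglongrightarrow> 0"
    from order_tendstoD(2)[OF translation_error_tendsto_0[OF assms(1) this] assms(2)]
    show "eventually (\<lambda>n. translation_error f (z n) \<le> e) sequentially"
      by (rule eventually_mono) auto
  qed
  then obtain d where "d > 0" "\<And>z. z \<noteq> 0 \<Longrightarrow> norm z < d \<Longrightarrow> translation_error f z \<le> e"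
    by (auto simp: eventually_at)
  \<comment> \<open>The filter \<open>at 0\<close> says nothing about the point 0 itself.\<close>
  moreover have "translation_error f 0 \<le> e"
    by (simp add: translation_error_def)
  ultimately show ?thesis
    by metis
qed

section \<open>Test functions and mollification\<close>

definition grad :: "(real^'n \<Rightarrow> real) \<Rightarrow> real^'n \<Rightarrow> real^'n" where
  "grad f x = (\<chi> i. partial_deriv i f x)"

lemma grad_nth [simp]: "grad f x $ i = partial_deriv i f x"
  by (simp add: grad_def)

lemma has_derivative_grad:
  assumes "f differentiable (at x)"
  shows "(f has_derivative (\<lambda>h. grad f x \<bullet> h)) (at x)"
proof -
  have lin: "linear (frechet_derivative f (at x))"
    using assms by (rule linear_frechet_derivative)
  have "frechet_derivative f (at x) h = grad f x \<bullet> h" for h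
  proof -
    have "frechet_derivative f (at x) (\<Sum>i\<in>UNIV. (h $ i) *\<^sub>R axis i 1)
        = (\<Sum>i\<in>UNIV. h $ i * partial_deriv i f x)"
      by (simp add: linear_sum[OF lin] linear_cmul[OF lin] partial_deriv_def)
    also have "(\<Sum>i\<in>UNIV. (h $ i) *\<^sub>R axis i 1) = h"
      using basis_expansion[of h] by (simp add: scalar_mult_eq_scaleR)
    finally show ?thesis
      by (simp add: inner_vec_def mult.commute)
  qed
  then have "frechet_derivative f (at x) = (\<lambda>h. grad f x \<bullet> h)"
    by (rule ext)
  then show ?thesis
    using assms[unfolded frechet_derivative_works] by simp
qed

lemma mean_value_grad:
  fixes f :: "real^'n \<Rightarrow> real"
  assumes "\<And>x. f differentiable (at x)"
  obtains t where "0 < t" "t < 1" "f (x + h) - f x = grad f (x + t *\<^sub>R h) \<bullet> h"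
proof -
  have D: "((\<lambda>t. f (x + t *\<^sub>R h)) has_field_derivative grad f (x + t *\<^sub>R h) \<bullet> h) (at t)" for t
  proof -
    have "((\<lambda>t. x + t *\<^sub>R h) has_derivative (\<lambda>s. s *\<^sub>R h)) (at t)"
      by (auto intro!: derivative_eq_intros)
    from has_derivative_compose[OF this has_derivative_grad[OF assms]]
    show ?thesis
      by (simp add: has_field_derivative_def mult_commute_abs)
  qed
  show ?thesis
    using MVT2[of 0 1 "\<lambda>t. f (x + t *\<^sub>R h)" "\<lambda>t. grad f (x + t *\<^sub>R h) \<bullet> h"] D that by auto
qed

lemma test_functions_mono: "A \<subseteq> B \<Longrightarrow> test_functions A \<subseteq> test_functions B"
  by (auto simp: test_functions_def)

lemma test_functions_UNIV: "\<phi> \<in> test_functions A \<Longrightarrow> \<phi> \<in> test_functions UNIV"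
  by (auto simp: test_functions_def)

text \<open>Any compact set outside which \<phi> vanishes may serve in place of the closure in the
  definition, since that closure is a closed subset of it.\<close>

lemma test_functionsI:
  assumes "\<And>k. C_k k \<phi>" "compact K" "K \<subseteq> A" "\<And>x. x \<notin> K \<Longrightarrow> \<phi> x = 0"
  shows "\<phi> \<in> test_functions A"
proof -
  have "closure {x. \<phi> x \<noteq> 0} \<subseteq> K"
    using assms by (intro closure_minimal compact_imp_closed) auto
  moreover from this have "compact (closure {x. \<phi> x \<noteq> 0})"
    using \<open>compact K\<close> by (metis closed_closure compact_Int_closed inf.absorb_iff2)
  ultimately show ?thesis
    using assms by (auto simp: test_functions_def)
qed

lemma partial_deriv_eq_0:
  assumes "closed K" "\<And>x. x \<notin> K \<Longrightarrow> \<phi> x = 0" "x \<notin> K"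
  shows "partial_deriv i \<phi> x = 0"
proof -
  have "(\<phi> has_derivative (\<lambda>_. 0)) (at x)"
    by (rule has_derivative_transform_within_open[of "\<lambda>_. 0" _ x UNIV "- K"]) (use assms in auto)
  then show ?thesis
    by (simp add: partial_deriv_eq)
qed

lemma partial_deriv_cong_open:
  assumes "open S" "\<And>x. x \<in> S \<Longrightarrow> f x = g x" "x \<in> S"  "g differentiable (at x)"
  shows "partial_deriv i f x = partial_deriv i g x"
proof -
  have "(f has_derivative frechet_derivative g (at x)) (at x)"
    by (rule has_derivative_transform_within_open[of g _ x UNIV S])
      (use assms in \<open>auto simp: frechet_derivative_works\<close>)
  then show ?thesis
    by (simp add: partial_deriv_eq) (simp add: partial_deriv_def)
qed

lemma test_functionsE:
  assumes "\<phi> \<in> test_functions A"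
  obtains K where "compact K" "K \<subseteq> A" "\<And>x. x \<notin> K \<Longrightarrow> \<phi> x = 0"
    "\<And>x i. x \<notin> K \<Longrightarrow> partial_deriv i \<phi> x = 0"
proof
  let ?K = "closure {x. \<phi> x \<noteq> 0}"
  show "compact ?K" "?K \<subseteq> A"
    using assms by (auto simp: test_functions_def)
  show 0: "\<phi> x = 0" if "x \<notin> ?K" for x
    using that closure_subset[of "{x. \<phi> x \<noteq> 0}"] by auto
  show "partial_deriv i \<phi> x = 0" if "x \<notin> ?K" for x i
    by (rule partial_deriv_eq_0[OF closed_closure 0 that])
qed

lemma test_functions_C_k: "\<phi> \<in> test_functions A \<Longrightarrow> C_k k \<phi>"
  by (auto simp: test_functions_def)

lemma test_functions_differentiable: "\<phi> \<in> test_functions A \<Longrightarrow> \<phi> differentiable (at x)"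
  using test_functions_C_k[of \<phi> A 1] by simp

lemma test_functions_continuous: "\<phi> \<in> test_functions A \<Longrightarrow> continuous_on S \<phi>"
  using test_functions_C_k[of \<phi> A 0] by (auto intro: continuous_on_subset)

lemma test_functions_partial_deriv:
  assumes "\<phi> \<in> test_functions A"
  shows "partial_deriv i \<phi> \<in> test_functions A"
proof -
  obtain K where K: "compact K" "K \<subseteq> A" "\<And>x i. x \<notin> K \<Longrightarrow> partial_deriv i \<phi> x = 0"
    using test_functionsE[OF assms] by metis
  have "C_k k (partial_deriv i \<phi>)" for k
    using test_functions_C_k[OF assms, of "Suc k"] by auto
  then show ?thesis
    using K by (intro test_functionsI) auto
qed

lemma test_functions_continuous_partial:
  "\<phi> \<in> test_functions A \<Longrightarrow> continuous_on S (partial_deriv i \<phi>)"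
  by (rule test_functions_continuous[OF test_functions_partial_deriv])

lemma test_functions_mult:
  assumes "\<phi> \<in> test_functions A" "\<And>k. C_k k \<psi>"
  shows "(\<lambda>x. \<psi> x * \<phi> x) \<in> test_functions A"
proof -
  obtain K where K: "compact K" "K \<subseteq> A" "\<And>x. x \<notin> K \<Longrightarrow> \<phi> x = 0"
    using test_functionsE[OF assms(1)] by metis
  then show ?thesis
    using assms by (intro test_functionsI[OF _ K(1,2)]) (auto intro: C_k_mult test_functions_C_k)
qed

lemma compact_support_bounded:
  fixes f :: "'a::topological_space \<Rightarrow> 'b::real_normed_vector"
  assumes "compact K" "continuous_on UNIV f" "\<And>x. x \<notin> K \<Longrightarrow> f x = 0"
  obtains B where "B > 0" "\<And>x. norm (f x) \<le> B"
proof -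
  have "bounded (f ` K)"
    using assms(1) by (intro compact_imp_bounded compact_continuous_image continuous_on_subset[OF assms(2)]) auto
  then obtain B where "B > 0" "\<And>x. x \<in> K \<Longrightarrow> norm (f x) \<le> B"
    by (auto simp: bounded_pos)
  then have "norm (f x) \<le> B" for x
    using assms(3)[of x] by (cases "x \<in> K") auto
  then show ?thesis
    using that \<open>B > 0\<close> by blast
qed

lemma test_functions_bounded:
  assumes "\<phi> \<in> test_functions A"
  obtains B where "B > 0" "\<And>x. \<bar>\<phi> x\<bar> \<le> B"
proof -
  obtain K where "compact K" "\<And>x. x \<notin> K \<Longrightarrow> \<phi> x = 0"
    using test_functionsE[OF assms] by metis
  from compact_support_bounded[OF this(1) test_functions_continuous[OF assms] this(2)]
  show ?thesis
    using that by auto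
qed

lemma compact_cball_thickening:
  fixes K :: "'a::euclidean_space set"
  assumes "compact K"
  shows "compact (\<Union>x\<in>K. cball x r)"
proof -
  have "(\<Union>x\<in>K. cball x r) = {x + y | x y. x \<in> K \<and> y \<in> cball 0 r}"
  proof (safe, goal_cases)
    case (1 y x)
    then show ?case
      by (intro exI[of _ x] exI[of _ "y - x"]) (auto simp: dist_norm norm_minus_commute)
  next
    case (2 _ x y)
    then show ?case
      by (auto simp: dist_norm intro!: bexI[of _ x])
  qed
  then show ?thesis
    using compact_sums[OF assms compact_cball[of 0 r]] by simp
qed

text \<open>If one of two points at distance below 1 lies in \<open>K\<close>, both lie in the
  compact unit thickening of \<open>K\<close>; if neither does, both values are 0.\<close>

lemma compact_support_uniformly_continuous:
  fixes f :: "'a::euclidean_space \<Rightarrow> 'b::real_normed_vector"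
  assumes "compact K" "continuous_on UNIV f" "\<And>x. x \<notin> K \<Longrightarrow> f x = 0" "e > 0"
  obtains d where "d > 0" "\<And>x y. dist x y < d \<Longrightarrow> dist (f x) (f y) < e"
proof -
  let ?K = "\<Union>x\<in>K. cball x 1"
  have "uniformly_continuous_on ?K f"
    using compact_cball_thickening[OF assms(1)]
    by (intro compact_uniformly_continuous continuous_on_subset[OF assms(2)]) auto
  then obtain d where d: "d > 0" "\<And>x y. x \<in> ?K \<Longrightarrow> y \<in> ?K \<Longrightarrow> dist x y < d \<Longrightarrow> dist (f x) (f y) < e"
    using \<open>e > 0\<close> by (metis uniformly_continuous_onE dist_commute)
  show ?thesis
  proof
    show "min d 1 > 0"
      using d by simp
    fix x y :: 'a
    assume xy: "dist x y < min d 1"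
    show "dist (f x) (f y) < e"
    proof (cases "x \<in> K \<or> y \<in> K")
      case True
      then have "x \<in> ?K" "y \<in> ?K"
        using xy by (auto intro: bexI[of _ x] bexI[of _ y] simp: dist_commute)
      then show ?thesis
        using d xy by auto
    qed (use assms in auto)
  qed
qed

lemma continuous_grad:
  assumes "C_k 1 f"
  shows "continuous_on S (grad f)"
proof -
  have "continuous_on S (partial_deriv i f)" for i
    using assms by (intro continuous_on_subset[of UNIV "partial_deriv i f" S]) auto
  then show ?thesis
    unfolding grad_def by (rule continuous_on_vec_lambda)
qed

text \<open>The intermediate point of the mean value theorem lies within \<open>norm h\<close> of
  \<open>z\<close>, so uniform continuity of the gradient bounds the error. Uniformity in
  \<open>z\<close> is what permits differentiation under the integral sign.\<close>

lemma test_functions_uniformly_differentiable: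
  fixes \<phi> :: "real^'n \<Rightarrow> real"
  assumes \<phi>: "\<phi> \<in> test_functions A" and "e > 0"
  obtains d where "d > 0" "\<And>z h. norm h < d \<Longrightarrow> \<bar>\<phi> (z + h) - \<phi> z - grad \<phi> z \<bullet> h\<bar> \<le> e * norm h"
proof -
  obtain K where K: "compact K" "\<And>x i. x \<notin> K \<Longrightarrow> partial_deriv i \<phi> x = 0"
    using test_functionsE[OF \<phi>] by metis
  then have "grad \<phi> x = 0" if "x \<notin> K" for x
    using that by (simp add: vec_eq_iff)
  then obtain d where d: "d > 0" "\<And>x y. dist x y < d \<Longrightarrow> dist (grad \<phi> x) (grad \<phi> y) < e"
    using compact_support_uniformly_continuous[OF K(1) continuous_grad[OF test_functions_C_k[OF \<phi>]] _ \<open>e > 0\<close>]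
    by metis
  show ?thesis
  proof (rule that[OF d(1)])
    fix z h :: "real^'n"
    assume h: "norm h < d"
    obtain t where t: "0 < t" "t < 1" "\<phi> (z + h) - \<phi> z = grad \<phi> (z + t *\<^sub>R h) \<bullet> h"
      using mean_value_grad[of \<phi> z h] test_functions_differentiable[OF \<phi>] by blast
    have "norm (t *\<^sub>R h) \<le> norm h"
      using t by (simp add: mult_left_le_one_le)
    then have "norm (grad \<phi> (z + t *\<^sub>R h) - grad \<phi> z) \<le> e"
      using d(2)[of "z + t *\<^sub>R h" z] h by (auto simp: dist_norm)
    then have "\<bar>(grad \<phi> (z + t *\<^sub>R h) - grad \<phi> z) \<bullet> h\<bar> \<le> e * norm h"
      by (meson Cauchy_Schwarz_ineq2 mult_right_mono norm_ge_zero order_trans)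
    then show "\<bar>\<phi> (z + h) - \<phi> z - grad \<phi> z \<bullet> h\<bar> \<le> e * norm h"
      by (simp add: t(3) inner_diff_left)
  qed
qed

section \<open>Convolution with test functions\<close>

lemma measurable_lebesgue_continuous:
  "continuous_on UNIV f \<Longrightarrow> f \<in> borel_measurable lebesgue"
  by (simp add: borel_measurable_continuous_onI measurable_completion)

lemma integrable_bounded_mult:
  fixes f g :: "'a \<Rightarrow> real"
  assumes "integrable M f" "g \<in> borel_measurable M" "\<And>x. \<bar>g x\<bar> \<le> B"
  shows "integrable M (\<lambda>x. f x * g x)"
proof (rule Bochner_Integration.integrable_bound)
  show "integrable M (\<lambda>x. B * f x)"
    using assms by simp
  show "AE x in M. norm (f x * g x) \<le> norm (B * f x)"
  proof (intro AE_I2)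
    fix x
    have "\<bar>f x\<bar> * \<bar>g x\<bar> \<le> \<bar>f x\<bar> * \<bar>B\<bar>"
      using assms(3)[of x] by (intro mult_left_mono) auto
    then show "norm (f x * g x) \<le> norm (B * f x)"
      by (simp add: abs_mult mult.commute)
  qed
qed (use assms in auto)

text \<open>The kernel is an argument without normalisation, so that derivatives of a kernel are
  again kernels.\<close>

definition mollify :: "(real^'n \<Rightarrow> real) \<Rightarrow> (real^'n \<Rightarrow> real) \<Rightarrow> real^'n \<Rightarrow> real" where
  "mollify \<eta> f x = (LINT y|lebesgue. f y * \<eta> (x - y))"

lemma integrable_mollify:
  assumes "integrable lebesgue f" "\<eta> \<in> test_functions A"
  shows "integrable lebesgue (\<lambda>y. f y * \<eta> (x - y))"
proof -
  obtain B where "\<And>x. \<bar>\<eta> x\<bar> \<le> B"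
    using test_functions_bounded[OF assms(2)] by metis
  moreover have "continuous_on UNIV (\<lambda>y. \<eta> (x - y))"
    by (rule continuous_on_compose2[OF test_functions_continuous[OF assms(2), of UNIV]])
      (auto intro!: continuous_intros)
  ultimately show ?thesis
    by (intro integrable_bounded_mult[OF assms(1)] measurable_lebesgue_continuous)
qed

text \<open>Differentiation under the integral: the Taylor error of the kernel is uniform in the
  base point, and integrating it against |f| costs the L^1 norm of \<open>f\<close>.\<close>

lemma mollify_has_derivative:
  assumes f: "integrable lebesgue f" and \<eta>: "\<eta> \<in> test_functions A"
  shows "(mollify \<eta> f has_derivative (\<lambda>h. (\<chi> i. mollify (partial_deriv i \<eta>) f x) \<bullet> h)) (at x)"
proof -
  have int: "integrable lebesgue (\<lambda>y. f y * \<eta> (x - y))"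
    "integrable lebesgue (\<lambda>y. f y * partial_deriv i \<eta> (x - y))" for x i
    using integrable_mollify[OF f] \<eta> test_functions_partial_deriv[OF \<eta>] by auto
  have G: "(\<chi> i. mollify (partial_deriv i \<eta>) f x) \<bullet> h = (LINT y|lebesgue. f y * (grad \<eta> (x - y) \<bullet> h))"
    and intG: "integrable lebesgue (\<lambda>y. f y * (grad \<eta> (x - y) \<bullet> h))" for h
  proof -
    have eq: "f y * (grad \<eta> (x - y) \<bullet> h) = (\<Sum>i\<in>UNIV. f y * partial_deriv i \<eta> (x - y) * h $ i)" for y
      by (simp add: inner_vec_def sum_distrib_left mult.assoc)
    show "integrable lebesgue (\<lambda>y. f y * (grad \<eta> (x - y) \<bullet> h))"
      unfolding eq using int by (intro Bochner_Integration.integrable_sum) auto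
    show "(\<chi> i. mollify (partial_deriv i \<eta>) f x) \<bullet> h = (LINT y|lebesgue. f y * (grad \<eta> (x - y) \<bullet> h))"
      unfolding eq using int by (subst Bochner_Integration.integral_sum) (auto simp: mollify_def inner_vec_def)
  qed
  show ?thesis
    unfolding has_derivative_at_alt
  proof (intro conjI allI impI)
    fix e :: real
    assume "e > 0"
    define I where "I = (LINT y|lebesgue. \<bar>f y\<bar>)"
    have "I \<ge> 0"
      by (simp add: I_def)
    \<comment> \<open>Division by \<open>I + 1\<close> also covers the case that \<open>f\<close>
      vanishes almost everywhere.\<close>
    obtain d where d: "d > 0"
      "\<And>z h. norm h < d \<Longrightarrow> \<bar>\<eta> (z + h) - \<eta> z - grad \<eta> z \<bullet> h\<bar> \<le> e / (I + 1) * norm h"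
      using test_functions_uniformly_differentiable[OF \<eta>, of "e / (I + 1)"] \<open>e > 0\<close> \<open>I \<ge> 0\<close>
      by (auto simp: add_nonneg_pos)
    show "\<exists>d>0. \<forall>y. norm (y - x) < d \<longrightarrow> norm (mollify \<eta> f y - mollify \<eta> f x -
            (\<chi> i. mollify (partial_deriv i \<eta>) f x) \<bullet> (y - x)) \<le> e * norm (y - x)"
    proof (intro exI[of _ d] conjI allI impI d(1))
      fix x'
      assume "norm (x' - x) < d"
      define h where "h = x' - x"
      have h: "norm h < d" "x' = x + h"
        using \<open>norm (x' - x) < d\<close> by (auto simp: h_def)
      have "mollify \<eta> f x' - mollify \<eta> f x - (\<chi> i. mollify (partial_deriv i \<eta>) f x) \<bullet> h
          = (LINT y|lebesgue. f y * \<eta> (x' - y) - f y * \<eta> (x - y) - f y * (grad \<eta> (x - y) \<bullet> h))"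
        unfolding G unfolding mollify_def using int intG by simp
      also have "norm \<dots> \<le> (LINT y|lebesgue. \<bar>f y\<bar> * (e / (I + 1) * norm h))"
      proof (rule order_trans[OF integral_norm_bound], rule integral_mono)
        fix y
        have "f y * \<eta> (x' - y) - f y * \<eta> (x - y) - f y * (grad \<eta> (x - y) \<bullet> h)
            = f y * (\<eta> (x - y + h) - \<eta> (x - y) - grad \<eta> (x - y) \<bullet> h)"
          by (simp add: h algebra_simps)
        then show "norm (f y * \<eta> (x' - y) - f y * \<eta> (x - y) - f y * (grad \<eta> (x - y) \<bullet> h))
            \<le> \<bar>f y\<bar> * (e / (I + 1) * norm h)"
          using mult_left_mono[OF d(2)[OF h(1), of "x - y"], of "\<bar>f y\<bar>"] by (simp only: real_norm_def abs_mult)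
      qed (use int intG f in auto)
      also have "\<dots> = I * (e / (I + 1)) * norm h"
        by (simp add: I_def)
      also have "\<dots> \<le> e * norm h"
        using \<open>I \<ge> 0\<close> \<open>e > 0\<close> by (intro mult_right_mono) (auto simp: field_simps)
      finally show "norm (mollify \<eta> f x' - mollify \<eta> f x -
            (\<chi> i. mollify (partial_deriv i \<eta>) f x) \<bullet> (x' - x)) \<le> e * norm (x' - x)"
        by (simp add: h_def)
    qed
  qed (rule bounded_linear_inner_right)
qed

lemma partial_deriv_mollify:
  assumes "integrable lebesgue f" "\<eta> \<in> test_functions A"
  shows "partial_deriv i (mollify \<eta> f) = mollify (partial_deriv i \<eta>) f"
  using partial_deriv_eq[OF mollify_has_derivative[OF assms]]
  by (auto simp: inner_axis)

text \<open>Every derivative falls on the kernel, whose partial derivatives are test functions;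
  hence the induction generalises \<eta>.\<close>

lemma C_k_mollify:
  assumes f: "integrable lebesgue f"
  shows "\<eta> \<in> test_functions A \<Longrightarrow> C_k k (mollify \<eta> f)"
proof (induction k arbitrary: \<eta>)
  case 0
  show ?case
    using mollify_has_derivative[OF f 0] has_derivative_continuous
    by (fastforce intro!: continuous_at_imp_continuous_on)
next
  case (Suc k)
  then show ?case
    using mollify_has_derivative[OF f Suc.prems] test_functions_partial_deriv[OF Suc.prems]
    by (auto simp: partial_deriv_mollify[OF f Suc.prems] intro: differentiableI)
qed

text \<open>The sum of the integrals is finite, so the series is finite almost everywhere and its
  terms tend to 0. It serves both the mollified functions and the capacity test functions.\<close>

lemma AE_tendsto_0_of_summable_nn_integral:
  fixes f :: "nat \<Rightarrow> 'a \<Rightarrow> ennreal"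
  assumes [measurable]: "\<And>k. f k \<in> borel_measurable M" and "\<And>k. (\<integral>\<^sup>+x. f k x \<partial>M) \<le> ennreal ((1/2)^k)"
  shows "AE x in M. (\<lambda>k. f k x) \<longlonglongrightarrow> 0"
proof -
  have "(\<integral>\<^sup>+x. (\<Sum>k. f k x) \<partial>M) = (\<Sum>k. \<integral>\<^sup>+x. f k x \<partial>M)"
    by (rule nn_integral_suminf) measurable
  also have "\<dots> \<le> (\<Sum>k. ennreal ((1/2)^k))"
    by (intro suminf_le assms) auto
  also have "\<dots> < \<infinity>"
    by (subst suminf_ennreal_eq[OF _ geometric_sums]) auto
  finally have "AE x in M. (\<Sum>k. f k x) \<noteq> \<infinity>"
    by (intro nn_integral_PInf_AE) auto
  then show ?thesis
  proof eventually_elim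
    case (elim x)
    have "f k x < \<infinity>" for k
      using elim sum_le_suminf[of "\<lambda>k. f k x" "{k}"] by (auto simp: less_top[symmetric] top_unique)
    then have eq: "f k x = ennreal (enn2real (f k x))" for k
      by (simp add: ennreal_enn2real)
    have "summable (\<lambda>k. enn2real (f k x))"
      using elim by (intro summable_suminf_not_top) (auto simp flip: eq)
    then have "(\<lambda>k. ennreal (enn2real (f k x))) \<longlonglongrightarrow> ennreal 0"
      by (intro tendsto_ennrealI summable_LIMSEQ_zero)
    then show ?case
      by (simp flip: eq)
  qed
qed

section \<open>Mollifiers and convergence in the mean\<close>

definition mollifier :: "real \<Rightarrow> (real^'n \<Rightarrow> real) \<Rightarrow> bool" where
  "mollifier r \<eta> \<longleftrightarrow> \<eta> \<in> test_functions UNIV \<and> (\<forall>x. 0 \<le> \<eta> x) \<and> (\<forall>x. r \<le> norm x \<longrightarrow> \<eta> x = 0)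
     \<and> (LINT x|lborel. \<eta> x) = 1"

lemma mollifier_mono: "mollifier r \<eta> \<Longrightarrow> r \<le> s \<Longrightarrow> mollifier s \<eta>"
  unfolding mollifier_def by (meson order_trans)

lemma test_functions_integrable:
  assumes "\<phi> \<in> test_functions A"
  shows "integrable lborel \<phi>"
proof -
  obtain K where K: "compact K" "\<And>x. x \<notin> K \<Longrightarrow> \<phi> x = 0"
    using test_functionsE[OF assms] by metis
  have "integrable lborel (\<lambda>x. indicator K x *\<^sub>R \<phi> x)"
    by (intro borel_integrable_compact K test_functions_continuous[OF assms])
  moreover have "(\<lambda>x. indicator K x *\<^sub>R \<phi> x) = \<phi>"
    using K(2) by (intro ext) (auto simp: indicator_def)
  ultimately show ?thesis
    by simp
qed

lemma test_functions_measurable: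
  "\<phi> \<in> test_functions A \<Longrightarrow> \<phi> \<in> borel_measurable borel"
  by (intro borel_measurable_continuous_onI test_functions_continuous)

lemma bump_scaled_test_function:
  assumes "r > 0"
  shows "(\<lambda>x. bump ((1 / r) *\<^sub>R x)) \<in> test_functions UNIV"
proof (rule test_functionsI[OF _ compact_cball[of 0 r]])
  show "C_k k (\<lambda>x. bump ((1 / r) *\<^sub>R x))" for k
    using C_k_comp_affine[OF C_k_bump, of k 0] by simp
  show "bump ((1 / r) *\<^sub>R x) = 0" if "x \<notin> cball 0 r" for x :: "real^'n"
    using that assms by (intro bump_eq_0) (auto simp: field_simps)
qed auto

lemma mollifier_exists:
  assumes "r > 0"
  shows "\<exists>\<eta>::real^'n \<Rightarrow> real. mollifier r \<eta>"
proof -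
  define f :: "real^'n \<Rightarrow> real" where "f x = bump ((1 / r) *\<^sub>R x)" for x
  have f: "f \<in> test_functions UNIV"
    unfolding f_def using assms by (rule bump_scaled_test_function)
  have nonneg: "f x \<ge> 0" for x
    by (simp add: f_def bump_nonneg)
  define I where "I = (LINT x|lborel. f x)"
  \<comment> \<open>Zero mass would make the set where \<open>f\<close> is nonzero negligible,
    although it is open and contains the origin.\<close>
  have "I \<noteq> 0"
  proof
    assume "I = 0"
    then have "AE x in lborel. f x = 0"
      unfolding I_def using integral_nonneg_eq_0_iff_AE[OF test_functions_integrable[OF f]] nonneg by auto
    then have "{x. f x \<noteq> 0} \<in> null_sets lborel"
      using test_functions_measurable[OF f] by (subst AE_iff_null_sets) auto
    moreover have "open {x. f x \<noteq> 0}"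
      using test_functions_continuous[OF f] by (intro open_Collect_neq) auto
    moreover have "0 \<in> {x. f x \<noteq> 0}"
      by (simp add: f_def bump_zero)
    ultimately show False
      using open_not_negligible[of "{x. f x \<noteq> 0}"] by (auto simp: negligible_iff_null_sets null_sets_completionI)
  qed
  moreover have "I \<ge> 0"
    by (simp add: I_def nonneg)
  ultimately have I: "I > 0"
    by simp
  have "(\<lambda>x. (1 / I) * f x) \<in> test_functions UNIV"
    by (rule test_functions_mult[OF f C_k_const])
  moreover have "f x = 0" if "r \<le> norm x" for x
    unfolding f_def using that assms by (intro bump_eq_0) (auto simp: field_simps)
  moreover have "(LINT x|lborel. (1 / I) * f x) = 1"
    using I by (simp add: I_def)
  ultimately have "mollifier r (\<lambda>x. (1 / I) * f x)"
    unfolding mollifier_def using I nonneg by auto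
  then show ?thesis
    by blast
qed

text \<open>Since \<eta> has mass one, the difference at x is the \<eta>-average of f(x - z) - f(x).
  After exchanging the integrals, the bound is an average of translation errors over norm z <
  r.\<close>

lemma mollify_L1_bound:
  assumes f [measurable]: "f \<in> borel_measurable borel" and int: "integrable lborel f"
    and \<eta>: "mollifier r \<eta>" and e: "\<And>z. norm z < r \<Longrightarrow> translation_error f z \<le> e"
  shows "(\<integral>\<^sup>+x. ennreal \<bar>mollify \<eta> f x - f x\<bar> \<partial>lborel) \<le> e"
proof -
  have test: "\<eta> \<in> test_functions UNIV" and pos: "\<And>x. 0 \<le> \<eta> x"
    and supp: "\<And>x. r \<le> norm x \<Longrightarrow> \<eta> x = 0" and one: "(LINT x|lborel. \<eta> x) = 1"
    using \<eta> by (auto simp: mollifier_def)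
  note [measurable] = test_functions_measurable[OF test]
  have int\<eta>: "integrable lborel \<eta>"
    by (rule test_functions_integrable[OF test])
  have "ennreal \<bar>mollify \<eta> f x - f x\<bar> \<le> (\<integral>\<^sup>+z. ennreal \<bar>f (x - z) - f x\<bar> * ennreal (\<eta> z) \<partial>lborel)" for x
  proof -
    have i1: "integrable lborel (\<lambda>y. f y * \<eta> (x - y))"
      using integrable_mollify[OF _ test, of f x] int by (simp add: integrable_completion)
    have eq: "mollify \<eta> f x = (LINT y|lborel. f y * \<eta> (x - y))"
      unfolding mollify_def by (rule integral_completion) measurable
    also have "\<dots> = (LINT z|lborel. f (x - z) * \<eta> z)"
      using integral_lborel_reflect(1)[of "\<lambda>y. f y * \<eta> (x - y)" x] by simp
    finally have eq: "mollify \<eta> f x = (LINT z|lborel. f (x - z) * \<eta> z)" .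
    have i2: "integrable lborel (\<lambda>z. f (x - z) * \<eta> z)"
      using integral_lborel_reflect(2)[of "\<lambda>y. f y * \<eta> (x - y)" x] i1 by simp
    have "mollify \<eta> f x - f x = (LINT z|lborel. f (x - z) * \<eta> z) - (LINT z|lborel. f x * \<eta> z)"
      by (simp add: eq one)
    also have "\<dots> = (LINT z|lborel. f (x - z) * \<eta> z - f x * \<eta> z)"
      using i2 int\<eta> by (intro Bochner_Integration.integral_diff[symmetric]) auto
    also have "\<dots> = (LINT z|lborel. (f (x - z) - f x) * \<eta> z)"
      by (simp add: algebra_simps)
    finally have "ennreal \<bar>mollify \<eta> f x - f x\<bar> = ennreal (norm (LINT z|lborel. (f (x - z) - f x) * \<eta> z))"
      by simp
    also have "\<dots> \<le> (\<integral>\<^sup>+z. norm ((f (x - z) - f x) * \<eta> z) \<partial>lborel)"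
      using Bochner_Integration.integrable_diff[OF i2 integrable_mult_right[OF int\<eta>, of "f x"]]
      by (intro integral_norm_bound_ennreal) (simp add: algebra_simps)
    also have "\<dots> = (\<integral>\<^sup>+z. ennreal \<bar>f (x - z) - f x\<bar> * ennreal (\<eta> z) \<partial>lborel)"
      using pos by (intro nn_integral_cong) (simp add: abs_mult ennreal_mult)
    finally show ?thesis .
  qed
  then have "(\<integral>\<^sup>+x. ennreal \<bar>mollify \<eta> f x - f x\<bar> \<partial>lborel)
      \<le> (\<integral>\<^sup>+x. \<integral>\<^sup>+z. ennreal \<bar>f (x - z) - f x\<bar> * ennreal (\<eta> z) \<partial>lborel \<partial>lborel)"
    by (intro nn_integral_mono)
  also have "\<dots> = (\<integral>\<^sup>+z. \<integral>\<^sup>+x. ennreal \<bar>f (x - z) - f x\<bar> * ennreal (\<eta> z) \<partial>lborel \<partial>lborel)"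
    by (rule lborel_pair.Fubini'[symmetric]) measurable
  also have "\<dots> = (\<integral>\<^sup>+z. ennreal (\<eta> z) * translation_error f z \<partial>lborel)"
    by (simp add: nn_integral_cmult translation_error_def mult.commute)
  also have "\<dots> \<le> (\<integral>\<^sup>+z. ennreal (\<eta> z) * e \<partial>lborel)"
  proof (intro nn_integral_mono)
    fix z
    show "ennreal (\<eta> z) * translation_error f z \<le> ennreal (\<eta> z) * e"
      using e[of z] supp[of z] by (cases "norm z < r") (auto intro: mult_left_mono)
  qed
  also have "\<dots> = (\<integral>\<^sup>+z. ennreal (\<eta> z) \<partial>lborel) * e"
    by (rule nn_integral_multc) measurable
  also have "(\<integral>\<^sup>+z. ennreal (\<eta> z) \<partial>lborel) = 1"
    using nn_integral_eq_integral[OF int\<eta>] pos one by simp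
  finally show ?thesis
    by simp
qed

text \<open>The translation estimates concern Borel functions. A Borel version \<open>f0\<close> has
  the same convolution with \<eta> at every point and differs from \<open>f\<close> only on a null
  set.\<close>

lemma mollify_L1_small:
  fixes f :: "real^'n \<Rightarrow> real"
  assumes f: "integrable lebesgue f" and "e > 0"
  shows "\<exists>d>0. \<forall>\<eta>. mollifier d \<eta> \<longrightarrow> (\<integral>\<^sup>+x. ennreal \<bar>mollify \<eta> f x - f x\<bar> \<partial>lebesgue) \<le> e"
proof -
  obtain f0 where f0 [measurable]: "f0 \<in> borel_measurable borel" and ae: "AE x in lborel. f x = f0 x"
    using completion_ex_borel_measurable_real[of f lborel] f by auto
  have ae': "AE x in lebesgue. f x = f0 x"
    using ae by (rule AE_completion)
  have "integrable lebesgue f0"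
    by (rule integrable_cong_AE_imp[OF f _ ae']) (simp add: measurable_completion)
  then have int: "integrable lborel f0"
    by (simp add: integrable_completion)
  obtain d where d: "d > 0" "\<And>z. norm z < d \<Longrightarrow> translation_error f0 z \<le> e"
    using translation_error_small[OF int \<open>e > 0\<close>] by blast
  have "(\<integral>\<^sup>+x. ennreal \<bar>mollify \<eta> f x - f x\<bar> \<partial>lebesgue) \<le> e" if "mollifier d \<eta>" for \<eta>
  proof -
    have cont: "continuous_on UNIV \<eta>"
      using that by (intro test_functions_continuous) (auto simp: mollifier_def)
    have "mollify \<eta> f x = mollify \<eta> f0 x" for x
      unfolding mollify_def
    proof (rule integral_cong_AE)
      have [measurable]: "(\<lambda>y. \<eta> (x - y)) \<in> borel_measurable lebesgue"
        by (intro measurable_lebesgue_continuous continuous_on_compose2[OF cont] continuous_intros) auto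
      show "(\<lambda>y. f y * \<eta> (x - y)) \<in> borel_measurable lebesgue"
        using f by measurable
      show "(\<lambda>y. f0 y * \<eta> (x - y)) \<in> borel_measurable lebesgue"
        using \<open>integrable lebesgue f0\<close> by measurable
      show "AE y in lebesgue. f y * \<eta> (x - y) = f0 y * \<eta> (x - y)"
        using ae' by eventually_elim simp
    qed
    then have "(\<integral>\<^sup>+x. ennreal \<bar>mollify \<eta> f x - f x\<bar> \<partial>lebesgue)
        = (\<integral>\<^sup>+x. ennreal \<bar>mollify \<eta> f0 x - f0 x\<bar> \<partial>lebesgue)"
      using ae' by (intro nn_integral_cong_AE) (auto elim: eventually_mono)
    also have "\<dots> \<le> e"
      unfolding nn_integral_completion by (rule mollify_L1_bound[OF f0 int that d(2)])
    finally show ?thesis .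
  qed
  then show ?thesis
    using d(1) by blast
qed

text \<open>The indicator of the thickening by 2r/3, mollified at scale r/3, vanishes beyond
  distance r and is 1 within distance r/3 of \<open>K\<close>. The value 1 on an open
  \<open>S\<close>, and not only on \<open>K\<close>, makes products with \<kappa> keep their
  derivatives on \<open>K\<close>.\<close>

lemma smooth_cutoff_exists:
  fixes K :: "(real^'n) set"
  assumes "compact K" "open \<Omega>" "K \<subseteq> \<Omega>"
  obtains \<kappa> S where "\<kappa> \<in> test_functions \<Omega>" "open S" "K \<subseteq> S" "\<And>x. x \<in> S \<Longrightarrow> \<kappa> x = 1"
proof -
  obtain r where r: "r > 0" "(\<Union>x\<in>K. cball x r) \<subseteq> \<Omega>"
    using compact_subset_open_imp_cball_epsilon_subset[OF assms] .
  define K1 where "K1 = (\<Union>x\<in>K. cball x (2 * r / 3))"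
  obtain \<eta> :: "real^'n \<Rightarrow> real" where "mollifier (r / 3) \<eta>"
    using mollifier_exists[of "r / 3"] r by auto
  then have \<eta>: "\<eta> \<in> test_functions UNIV" "\<And>x. r / 3 \<le> norm x \<Longrightarrow> \<eta> x = 0" "(LINT x|lborel. \<eta> x) = 1"
    by (auto simp: mollifier_def)
  note [measurable] = test_functions_measurable[OF \<eta>(1)]
  have "compact K1"
    unfolding K1_def by (intro compact_cball_thickening assms)
  then have int: "integrable lebesgue (indicator K1 :: _ \<Rightarrow> real)"
    using lmeasurable_compact[of K1] by (intro integrable_real_indicator) (auto simp: fmeasurable_def)
  show ?thesis
  proof
    show "mollify \<eta> (indicator K1) \<in> test_functions \<Omega>"
    proof (rule test_functionsI[OF C_k_mollify[OF int \<eta>(1)] compact_cball_thickening[OF assms(1)] r(2)])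
      fix x
      assume x: "x \<notin> (\<Union>x\<in>K. cball x r)"
      have 0: "indicator K1 y * \<eta> (x - y) = 0" for y
      proof (rule ccontr)
        assume *: "indicator K1 y * \<eta> (x - y) \<noteq> 0"
        then obtain k where k: "k \<in> K" "dist k y \<le> 2 * r / 3"
          by (auto simp: K1_def indicator_def split: if_splits)
        moreover have "dist y x < r / 3"
          using * \<eta>(2)[of "x - y"] by (force simp: dist_norm norm_minus_commute)
        ultimately have "dist k x \<le> r"
          using dist_triangle[of k x y] by simp
        then show False
          using x k by auto
      qed
      show "mollify \<eta> (indicator K1) x = 0"
        unfolding mollify_def 0 by simp
    qed
    show "open (\<Union>x\<in>K. ball x (r / 3))"
      by auto
    show "K \<subseteq> (\<Union>x\<in>K. ball x (r / 3))"
      using r by auto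
    fix x
    assume "x \<in> (\<Union>x\<in>K. ball x (r / 3))"
    then obtain k where k: "k \<in> K" "dist k x < r / 3"
      by auto
    have 1: "indicator K1 y * \<eta> (x - y) = \<eta> (x - y)" for y
    proof (cases "norm (x - y) < r / 3")
      case True
      then have "dist k y \<le> 2 * r / 3"
        using dist_triangle[of k y x] k by (simp add: dist_norm)
      then have "y \<in> K1"
        using k(1) unfolding K1_def by (intro UN_I) auto
      then show ?thesis
        by simp
    qed (use \<eta>(2) in auto)
    have "mollify \<eta> (indicator K1) x = (LINT y|lebesgue. \<eta> (x - y))"
      unfolding mollify_def 1 ..
    also have "\<dots> = (LINT y|lborel. \<eta> (x - y))"
      by (intro integral_completion) measurable
    also have "\<dots> = 1"
      using integral_lborel_reflect(1)[OF test_functions_measurable[OF \<eta>(1)]] \<eta>(3) by simp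
    finally show "mollify \<eta> (indicator K1) x = 1" .
  qed
qed

section \<open>Weak gradients\<close>

text \<open>Difference quotients of \<open>F\<close> have integral 0 by translation invariance, and
  they converge dominatedly to the partial derivative. The steps are at most 1, so the unit
  thickening of \<open>K\<close> carries all quotients.\<close>

lemma lborel_integral_partial_deriv_eq_0:
  fixes F :: "real^'n \<Rightarrow> real"
  assumes diff: "\<And>x. F differentiable (at x)" and cont: "continuous_on UNIV (partial_deriv i F)"
    and K: "compact K" "\<And>x. x \<notin> K \<Longrightarrow> F x = 0"
  shows "(LINT x|lebesgue. partial_deriv i F x) = 0"
proof -
  define e where "e = (axis i 1 :: real^'n)"
  have ne: "norm e = 1"
    by (simp add: e_def)
  define t where "t n = inverse (real (Suc n))" for n
  have t: "0 < t n" "t n \<le> 1" for n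
    by (auto simp: t_def field_simps)
  define K1 where "K1 = (\<Union>x\<in>K. cball x 1)"
  have K1: "compact K1" "K \<subseteq> K1"
    unfolding K1_def using compact_cball_thickening[OF K(1)] by auto
  have contF: "continuous_on UNIV F"
    using diff by (intro continuous_at_imp_continuous_on) (auto intro: differentiable_imp_continuous_within)
  have [measurable]: "F \<in> borel_measurable borel" "partial_deriv i F \<in> borel_measurable borel"
    using contF cont by (auto intro: borel_measurable_continuous_onI)
  have "partial_deriv i F x = 0" if "x \<notin> K" for x
    by (rule partial_deriv_eq_0[OF compact_imp_closed[OF K(1)] K(2) that])
  then obtain B where B: "B > 0" "\<And>x. norm (partial_deriv i F x) \<le> B"
    using compact_support_bounded[OF K(1) cont] by metis
  define D where "D n x = (F (x + t n *\<^sub>R e) - F x) / t n" for n x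
  have int: "integrable lborel F"
  proof -
    have "integrable lborel (\<lambda>x. indicator K x *\<^sub>R F x)"
      by (intro borel_integrable_compact K continuous_on_subset[OF contF]) auto
    moreover have "(\<lambda>x. indicator K x *\<^sub>R F x) = F"
      using K(2) by (intro ext) (auto simp: indicator_def)
    ultimately show ?thesis
      by simp
  qed
  have LD: "(LINT x|lborel. D n x) = 0" for n
    using integral_lborel_diff[of F "- (t n *\<^sub>R e)"] int by (simp add: D_def)
  have "(\<lambda>n. LINT x|lborel. D n x) \<longlonglongrightarrow> (LINT x|lborel. partial_deriv i F x)"
  proof (rule integral_dominated_convergence[where w = "\<lambda>x. B * indicator K1 x"])
    show "integrable lborel (\<lambda>x. B * indicator K1 x)"
      using borel_integrable_compact[OF K1(1), of "\<lambda>_. B"] by (simp add: mult.commute)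
    show "AE x in lborel. (\<lambda>n. D n x) \<longlonglongrightarrow> partial_deriv i F x"
    proof (intro AE_I2)
      fix x
      have "((\<lambda>s. x + s *\<^sub>R e) has_derivative (\<lambda>s. s *\<^sub>R e)) (at 0)"
        by (auto intro!: derivative_eq_intros)
      from has_derivative_compose[OF this, of F "\<lambda>h. grad F x \<bullet> h"] has_derivative_grad[OF diff]
      have "((\<lambda>s. F (x + s *\<^sub>R e)) has_field_derivative partial_deriv i F x) (at 0)"
        by (simp add: has_field_derivative_def mult_commute_abs e_def inner_axis)
      then have lim: "((\<lambda>s. (F (x + s *\<^sub>R e) - F x) / s) \<longlongrightarrow> partial_deriv i F x) (at 0)"
        by (simp add: has_field_derivative_iff)
      have "filterlim t (at 0) sequentially"
        unfolding filterlim_at t_def using LIMSEQ_inverse_real_of_nat by auto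
      from filterlim_compose[OF lim this]
      show "(\<lambda>n. D n x) \<longlonglongrightarrow> partial_deriv i F x"
        by (simp add: D_def)
    qed
    show "AE x in lborel. norm (D n x) \<le> B * indicator K1 x" for n
    proof (intro AE_I2)
      fix x
      show "norm (D n x) \<le> B * indicator K1 x"
      proof (cases "x \<in> K1")
        case True
        \<comment> \<open>Each quotient is a value of the partial derivative at an intermediate
          point, hence bounded by \<open>B\<close>.\<close>
        obtain s where "F (x + t n *\<^sub>R e) - F x = grad F (x + s *\<^sub>R t n *\<^sub>R e) \<bullet> t n *\<^sub>R e"
          using mean_value_grad[OF diff] by metis
        then have "D n x = partial_deriv i F (x + s *\<^sub>R t n *\<^sub>R e)"
          using t[of n] by (simp add: D_def e_def inner_axis)
        then show ?thesis
          using B True by simp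
      next
        case False
        have "x + t n *\<^sub>R e \<notin> K"
        proof
          assume "x + t n *\<^sub>R e \<in> K"
          moreover have "dist (x + t n *\<^sub>R e) x \<le> 1"
            using t[of n] ne by (simp add: dist_norm)
          ultimately show False
            using False by (auto simp: K1_def)
        qed
        moreover have "x \<notin> K"
          using False K1 by auto
        ultimately show ?thesis
          using False K(2) by (simp add: D_def)
      qed
    qed
  qed (auto simp: D_def)
  then have "(LINT x|lborel. partial_deriv i F x) = 0"
    using LD LIMSEQ_unique[OF _ tendsto_const] by simp
  then show ?thesis
    by (subst integral_completion) auto
qed

text \<open>Split a_k f_k - b g into a_k (f_k - g), small in L^1, and (a_k - b) g, handled by
  dominated convergence. This fits compositions, which converge boundedly almost everywhere,
  multiplied by gradients, which converge in the mean.\<close>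

lemma tendsto_integral_mult_bounded:
  fixes a :: "nat \<Rightarrow> 'a \<Rightarrow> real"
  assumes [measurable]: "\<And>k. a k \<in> borel_measurable M" "b \<in> borel_measurable M"
    and B: "\<And>k x. \<bar>a k x\<bar> \<le> B" and lim: "AE x in M. (\<lambda>k. a k x) \<longlonglongrightarrow> b x"
    and int: "\<And>k. integrable M (f k)" "integrable M g"
    and L1: "(\<lambda>k. \<integral>\<^sup>+x. ennreal \<bar>f k x - g x\<bar> \<partial>M) \<longlonglongrightarrow> 0"
  shows "(\<lambda>k. LINT x|M. a k x * f k x) \<longlonglongrightarrow> (LINT x|M. b x * g x)"
proof -
  note [measurable] = borel_measurable_integrable[OF int(1)] borel_measurable_integrable[OF int(2)]
  have B0: "B \<ge> 0"
    using B[of undefined undefined] by linarith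
  have i1: "integrable M (\<lambda>x. a k x * h x)" if "integrable M h" for k h
    using integrable_bounded_mult[OF that, of "a k" B] B by (simp add: mult.commute)
  have "(\<lambda>k. LINT x|M. a k x * (f k x - g x)) \<longlonglongrightarrow> (LINT x|M. 0)"
  proof (rule tendsto_L1_int)
    show "integrable M (\<lambda>x. a k x * (f k x - g x))" for k
      using int by (intro i1) auto
    have "(\<integral>\<^sup>+x. ennreal (norm (a k x * (f k x - g x) - 0)) \<partial>M)
        \<le> ennreal B * (\<integral>\<^sup>+x. ennreal \<bar>f k x - g x\<bar> \<partial>M)" for k
    proof -
      have "(\<integral>\<^sup>+x. ennreal (norm (a k x * (f k x - g x) - 0)) \<partial>M)
          \<le> (\<integral>\<^sup>+x. ennreal B * ennreal \<bar>f k x - g x\<bar> \<partial>M)"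
        using B B0 by (intro nn_integral_mono)
          (auto simp: abs_mult ennreal_mult[symmetric] intro!: ennreal_leI mult_right_mono)
      also have "\<dots> = ennreal B * (\<integral>\<^sup>+x. ennreal \<bar>f k x - g x\<bar> \<partial>M)"
        by (intro nn_integral_cmult) measurable
      finally show ?thesis .
    qed
    moreover have "(\<lambda>k. ennreal B * (\<integral>\<^sup>+x. ennreal \<bar>f k x - g x\<bar> \<partial>M)) \<longlonglongrightarrow> ennreal B * 0"
      by (intro ennreal_tendsto_cmult L1) auto
    ultimately show "(\<lambda>k. \<integral>\<^sup>+x. ennreal (norm (a k x * (f k x - g x) - 0)) \<partial>M) \<longlonglongrightarrow> 0"
      using tendsto_sandwich[where f = "\<lambda>_. 0" and g = "\<lambda>k. \<integral>\<^sup>+x. ennreal (norm (a k x * (f k x - g x) - 0)) \<partial>M"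
        and h = "\<lambda>k. ennreal B * (\<integral>\<^sup>+x. ennreal \<bar>f k x - g x\<bar> \<partial>M)" and c = 0 and net = sequentially]
      by simp
  qed auto
  moreover have "(\<lambda>k. LINT x|M. a k x * g x) \<longlonglongrightarrow> (LINT x|M. b x * g x)"
  proof (rule integral_dominated_convergence[where w = "\<lambda>x. B * \<bar>g x\<bar>"])
    show "AE x in M. (\<lambda>k. a k x * g x) \<longlonglongrightarrow> b x * g x"
      using lim by eventually_elim (intro tendsto_intros)
    show "AE x in M. norm (a k x * g x) \<le> B * \<bar>g x\<bar>" for k
      using B by (intro AE_I2) (simp add: abs_mult mult_right_mono)
  qed (use int in auto)
  ultimately have "(\<lambda>k. (LINT x|M. a k x * (f k x - g x)) + (LINT x|M. a k x * g x)) \<longlonglongrightarrow> 0 + (LINT x|M. b x * g x)"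
    by (intro tendsto_add) auto
  moreover have "(LINT x|M. a k x * (f k x - g x)) + (LINT x|M. a k x * g x) = (LINT x|M. a k x * f k x)" for k
  proof -
    have "integrable M (\<lambda>x. a k x * (f k x - g x))" "integrable M (\<lambda>x. a k x * g x)"
      using int by (auto intro!: i1)
    then show ?thesis
      by (subst Bochner_Integration.integral_add[symmetric]) (auto simp: algebra_simps)
  qed
  ultimately show ?thesis
    by simp
qed

section \<open>Elementary calculus of weak gradients\<close>

lemma LINT_lebesgue_on_eq:
  fixes f :: "'a::euclidean_space \<Rightarrow> real"
  assumes "A \<in> sets lebesgue" "\<And>x. x \<notin> A \<Longrightarrow> f x = 0"
  shows "(LINT x|lebesgue_on A. f x) = (LINT x|lebesgue. f x)"
proof -
  have "(\<lambda>x. indicator A x *\<^sub>R f x) = f"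
    using assms(2) by (intro ext) (auto simp: indicator_def)
  then show ?thesis
    using assms(1) by (simp add: integral_restrict_space)
qed

lemma weak_gradient_iff:
  assumes "open \<Omega>"
  shows "weak_gradient \<Omega> u g \<longleftrightarrow> locally_integrable \<Omega> u \<and> locally_integrable \<Omega> g \<and>
     (\<forall>\<phi>\<in>test_functions \<Omega>. \<forall>i.
        (LINT x|lebesgue. u x * partial_deriv i \<phi> x) = - (LINT x|lebesgue. g x $ i * \<phi> x))"
proof -
  have "(LINT x|lebesgue_on \<Omega>. u x * partial_deriv i \<phi> x) = (LINT x|lebesgue. u x * partial_deriv i \<phi> x)"
    "(LINT x|lebesgue_on \<Omega>. g x $ i * \<phi> x) = (LINT x|lebesgue. g x $ i * \<phi> x)"
    if \<phi>: "\<phi> \<in> test_functions \<Omega>" for \<phi> i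
  proof -
    obtain K where "K \<subseteq> \<Omega>" "\<And>x. x \<notin> K \<Longrightarrow> \<phi> x = 0" "\<And>x i. x \<notin> K \<Longrightarrow> partial_deriv i \<phi> x = 0"
      using test_functionsE[OF \<phi>] by metis
    then have "\<phi> x = 0" "partial_deriv i \<phi> x = 0" if "x \<notin> \<Omega>" for x
      using that by blast+
    then show "(LINT x|lebesgue_on \<Omega>. u x * partial_deriv i \<phi> x) = (LINT x|lebesgue. u x * partial_deriv i \<phi> x)"
      "(LINT x|lebesgue_on \<Omega>. g x $ i * \<phi> x) = (LINT x|lebesgue. g x $ i * \<phi> x)"
      using assms by (auto intro!: LINT_lebesgue_on_eq)
  qed
  then show ?thesis
    unfolding weak_gradient_def by simp
qed

lemma locally_integrable_subset:
  "locally_integrable B u \<Longrightarrow> A \<subseteq> B \<Longrightarrow> locally_integrable A u"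
  unfolding locally_integrable_def by auto

lemma weak_gradient_subset:
  assumes "weak_gradient B u g" "open A" "open B" "A \<subseteq> B"
  shows "weak_gradient A u g"
  using assms test_functions_mono[OF assms(4)]
  by (auto simp: weak_gradient_iff intro: locally_integrable_subset)

lemma locally_integrable_component:
  assumes "locally_integrable \<Omega> (g :: _ \<Rightarrow> real^'n)"
  shows "locally_integrable \<Omega> (\<lambda>x. g x $ i)"
  using assms unfolding locally_integrable_def
  by (auto intro: integrable_bounded_linear[OF bounded_linear_vec_nth])

lemma integrable_lebesgue_on_compact:
  assumes "locally_integrable \<Omega> u" "compact K" "K \<subseteq> \<Omega>"
  shows "integrable lebesgue (\<lambda>x. indicator K x *\<^sub>R u x)"
  using assms integrable_restrict_space[of K lebesgue u] by (auto simp: locally_integrable_def borel_compact)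

lemma integrable_mult_test:
  fixes u :: "real^'n \<Rightarrow> real"
  assumes "locally_integrable \<Omega> u" "\<phi> \<in> test_functions \<Omega>"
  shows "integrable lebesgue (\<lambda>x. u x * \<phi> x)"
proof -
  obtain K where K: "compact K" "K \<subseteq> \<Omega>" "\<And>x. x \<notin> K \<Longrightarrow> \<phi> x = 0"
    using test_functionsE[OF assms(2)] by metis
  obtain B where "\<And>x. \<bar>\<phi> x\<bar> \<le> B"
    using test_functions_bounded[OF assms(2)] by metis
  then have "integrable lebesgue (\<lambda>x. indicator K x *\<^sub>R u x * \<phi> x)"
    by (intro integrable_bounded_mult integrable_lebesgue_on_compact[OF assms(1) K(1,2)]
        measurable_lebesgue_continuous test_functions_continuous[OF assms(2)])
  moreover have "(\<lambda>x. indicator K x *\<^sub>R u x * \<phi> x) = (\<lambda>x. u x * \<phi> x)"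
    using K(3) by (intro ext) (auto simp: indicator_def)
  ultimately show ?thesis
    by simp
qed

lemma locally_integrable_lincomb:
  assumes "locally_integrable \<Omega> u" "locally_integrable \<Omega> v"
  shows "locally_integrable \<Omega> (\<lambda>x. a *\<^sub>R u x + b *\<^sub>R v x)"
  using assms unfolding locally_integrable_def by auto

lemma weak_gradient_lincomb:
  assumes "open \<Omega>" "weak_gradient \<Omega> u g" "weak_gradient \<Omega> v h"
  shows "weak_gradient \<Omega> (\<lambda>x. a * u x + b * v x) (\<lambda>x. a *\<^sub>R g x + b *\<^sub>R h x)"
  unfolding weak_gradient_iff[OF assms(1)]
proof (intro conjI ballI allI)
  have li: "locally_integrable \<Omega> u" "locally_integrable \<Omega> v" "locally_integrable \<Omega> g" "locally_integrable \<Omega> h"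
    using assms by (auto simp: weak_gradient_def)
  then show "locally_integrable \<Omega> (\<lambda>x. a * u x + b * v x)" "locally_integrable \<Omega> (\<lambda>x. a *\<^sub>R g x + b *\<^sub>R h x)"
    using locally_integrable_lincomb[of \<Omega> u v a b] locally_integrable_lincomb[of \<Omega> g h a b] by auto
  fix \<phi> i
  assume \<phi>: "\<phi> \<in> test_functions \<Omega>"
  note int = integrable_mult_test[OF li(1) test_functions_partial_deriv[OF \<phi>], of i]
    integrable_mult_test[OF li(2) test_functions_partial_deriv[OF \<phi>], of i]
    integrable_mult_test[OF locally_integrable_component[OF li(3)] \<phi>, of i]
    integrable_mult_test[OF locally_integrable_component[OF li(4)] \<phi>, of i]
  have "(LINT x|lebesgue. (a * u x + b * v x) * partial_deriv i \<phi> x)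
      = a * (LINT x|lebesgue. u x * partial_deriv i \<phi> x) + b * (LINT x|lebesgue. v x * partial_deriv i \<phi> x)"
    using int by (simp add: distrib_right mult.assoc)
  also have "\<dots> = - (a * (LINT x|lebesgue. g x $ i * \<phi> x) + b * (LINT x|lebesgue. h x $ i * \<phi> x))"
    using assms \<phi> by (simp add: weak_gradient_iff)
  also have "a * (LINT x|lebesgue. g x $ i * \<phi> x) + b * (LINT x|lebesgue. h x $ i * \<phi> x)
      = (LINT x|lebesgue. (a *\<^sub>R g x + b *\<^sub>R h x) $ i * \<phi> x)"
    using int by (simp add: distrib_right mult.assoc)
  finally show "(LINT x|lebesgue. (a * u x + b * v x) * partial_deriv i \<phi> x)
      = - (LINT x|lebesgue. (a *\<^sub>R g x + b *\<^sub>R h x) $ i * \<phi> x)" .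
qed

text \<open>Measurability of the factor is asked over compact subsets, since a factor composed from
  a locally integrable function is known to be measurable there.\<close>

lemma locally_integrable_scale_bounded:
  fixes u :: "'a::euclidean_space \<Rightarrow> 'b::euclidean_space"
  assumes "locally_integrable \<Omega> u"
    and a: "\<And>K. compact K \<Longrightarrow> K \<subseteq> \<Omega> \<Longrightarrow> a \<in> borel_measurable (lebesgue_on K)" "\<And>x. \<bar>a x\<bar> \<le> B"
  shows "locally_integrable \<Omega> (\<lambda>x. a x *\<^sub>R u x)"
  unfolding locally_integrable_def
proof (intro allI impI, elim conjE)
  fix K :: "'a set"
  assume K: "compact K" "K \<subseteq> \<Omega>"
  then have int: "integrable (lebesgue_on K) u"
    using assms(1) by (auto simp: locally_integrable_def)
  show "integrable (lebesgue_on K) (\<lambda>x. a x *\<^sub>R u x)"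
  proof (rule Bochner_Integration.integrable_bound)
    show "integrable (lebesgue_on K) (\<lambda>x. B *\<^sub>R u x)"
      using int by simp
    show "(\<lambda>x. a x *\<^sub>R u x) \<in> borel_measurable (lebesgue_on K)"
      using int a(1)[OF K] by measurable
    show "AE x in lebesgue_on K. norm (a x *\<^sub>R u x) \<le> norm (B *\<^sub>R u x)"
      using a(2) by (intro AE_I2) (auto intro!: mult_right_mono order_trans[OF _ abs_ge_self])
  qed
qed

text \<open>Testing \<open>u\<close> with \<zeta>\<phi>, again a test function of \<Omega>, and
  expanding by Leibniz gives the rule directly, without a limit.\<close>

lemma weak_gradient_mult_test:
  fixes u :: "real^'n \<Rightarrow> real"
  assumes "open \<Omega>" "weak_gradient \<Omega> u g" and \<zeta>: "\<zeta> \<in> test_functions UNIV"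
  shows "weak_gradient \<Omega> (\<lambda>x. \<zeta> x * u x) (\<lambda>x. \<zeta> x *\<^sub>R g x + u x *\<^sub>R grad \<zeta> x)"
  unfolding weak_gradient_iff[OF assms(1)]
proof (intro conjI ballI allI)
  have li: "locally_integrable \<Omega> u" "locally_integrable \<Omega> g"
    using assms by (auto simp: weak_gradient_def)
  obtain B where B: "\<And>x. \<bar>\<zeta> x\<bar> \<le> B"
    using test_functions_bounded[OF \<zeta>] by metis
  have m: "\<zeta> \<in> borel_measurable (lebesgue_on K)" "partial_deriv i \<zeta> \<in> borel_measurable (lebesgue_on K)" for K i
    using measurable_lebesgue_continuous[OF test_functions_continuous[OF \<zeta>]]
     measurable_lebesgue_continuous[OF test_functions_continuous_partial[OF \<zeta>]]
    by (auto intro: measurable_restrict_space1)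
  show "locally_integrable \<Omega> (\<lambda>x. \<zeta> x * u x)"
    using locally_integrable_scale_bounded[OF li(1) m(1) B] by simp
  have 1: "locally_integrable \<Omega> (\<lambda>x. \<zeta> x *\<^sub>R g x)"
    by (rule locally_integrable_scale_bounded[OF li(2) m(1) B])
  have 2: "locally_integrable \<Omega> (\<lambda>x. u x *\<^sub>R grad \<zeta> x)"
    unfolding locally_integrable_def
  proof (intro allI impI, elim conjE)
    fix K
    assume K: "compact K" "K \<subseteq> \<Omega>"
    have "integrable (lebesgue_on K) (\<lambda>x. u x * partial_deriv i \<zeta> x)" for i
    proof -
      obtain C where C: "\<And>x. \<bar>partial_deriv i \<zeta> x\<bar> \<le> C"
        using test_functions_bounded[OF test_functions_partial_deriv[OF \<zeta>]] by metis
      show ?thesis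
        using li(1) K by (intro integrable_bounded_mult[OF _ m(2) C]) (auto simp: locally_integrable_def)
    qed
    \<comment> \<open>The field is reassembled from its components along the coordinate axes, which
      gives integrability of the vector-valued function.\<close>
    then have "integrable (lebesgue_on K) (\<lambda>x. \<Sum>i\<in>UNIV. (u x * partial_deriv i \<zeta> x) *\<^sub>R (axis i 1 :: real^'n))"
      by (intro Bochner_Integration.integrable_sum integrable_scaleR_left)
    moreover have "(\<Sum>i\<in>UNIV. (u x * partial_deriv i \<zeta> x) *\<^sub>R (axis i 1 :: real^'n)) = u x *\<^sub>R grad \<zeta> x" for x
      by (simp add: vec_eq_iff axis_def if_distrib cong: if_cong)
    ultimately show "integrable (lebesgue_on K) (\<lambda>x. u x *\<^sub>R grad \<zeta> x)"
      by simp
  qed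
  show "locally_integrable \<Omega> (\<lambda>x. \<zeta> x *\<^sub>R g x + u x *\<^sub>R grad \<zeta> x)"
    using locally_integrable_lincomb[OF 1 2, of 1 1] by simp
  fix \<phi> i
  assume \<phi>: "\<phi> \<in> test_functions \<Omega>"
  have \<zeta>\<phi>: "(\<lambda>x. \<zeta> x * \<phi> x) \<in> test_functions \<Omega>" "(\<lambda>x. \<zeta> x * partial_deriv i \<phi> x) \<in> test_functions \<Omega>"
    "(\<lambda>x. partial_deriv i \<zeta> x * \<phi> x) \<in> test_functions \<Omega>"
    using test_functions_C_k[OF \<zeta>] test_functions_C_k[OF test_functions_partial_deriv[OF \<zeta>]] \<phi>
    by (auto intro!: test_functions_mult test_functions_partial_deriv)
  note int = integrable_mult_test[OF li(1) \<zeta>\<phi>(2)] integrable_mult_test[OF li(1) \<zeta>\<phi>(3)]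
    integrable_mult_test[OF locally_integrable_component[OF li(2)] \<zeta>\<phi>(1), of i]
  have pd: "partial_deriv i (\<lambda>x. \<zeta> x * \<phi> x) x = \<zeta> x * partial_deriv i \<phi> x + partial_deriv i \<zeta> x * \<phi> x" for x
    by (intro partial_deriv_mult test_functions_differentiable[OF \<zeta>] test_functions_differentiable[OF \<phi>])
  have "(LINT x|lebesgue. u x * (\<zeta> x * partial_deriv i \<phi> x)) + (LINT x|lebesgue. u x * (partial_deriv i \<zeta> x * \<phi> x))
      = - (LINT x|lebesgue. g x $ i * (\<zeta> x * \<phi> x))"
  proof -
    have "(LINT x|lebesgue. u x * (\<zeta> x * partial_deriv i \<phi> x + partial_deriv i \<zeta> x * \<phi> x))
        = - (LINT x|lebesgue. g x $ i * (\<zeta> x * \<phi> x))"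
      using assms(2) \<zeta>\<phi>(1) unfolding weak_gradient_iff[OF assms(1)] pd[symmetric] by blast
    then show ?thesis
      using int(1,2) by (simp add: distrib_left)
  qed
  moreover have "(LINT x|lebesgue. (\<zeta> x *\<^sub>R g x + u x *\<^sub>R grad \<zeta> x) $ i * \<phi> x)
      = (LINT x|lebesgue. g x $ i * (\<zeta> x * \<phi> x)) + (LINT x|lebesgue. u x * (partial_deriv i \<zeta> x * \<phi> x))"
    using int by (subst Bochner_Integration.integral_add[symmetric]) (auto simp: algebra_simps)
  ultimately show "(LINT x|lebesgue. \<zeta> x * u x * partial_deriv i \<phi> x)
      = - (LINT x|lebesgue. (\<zeta> x *\<^sub>R g x + u x *\<^sub>R grad \<zeta> x) $ i * \<phi> x)"
    by (simp add: mult_ac)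
qed

text \<open>For x in \<open>K\<close> and a kernel of radius at most r, y -> \<eta>(x - y) is a test
  function of \<Omega>, so differentiating the mollified \<open>u\<close> yields the mollified
  \<open>g\<close>. Cutting both down to the thickening \<open>K'\<close> makes them integrable on
  the whole space and leaves their convolutions on \<open>K\<close> unchanged.\<close>

lemma weak_gradient_mollify:
  fixes u :: "real^'n \<Rightarrow> real"
  assumes "open \<Omega>" and wg: "weak_gradient \<Omega> u g" and K: "compact K" "K \<subseteq> \<Omega>"
  shows "\<exists>U. (\<forall>k. C_k 1 (U k)) \<and> (AE x in lebesgue_on K. (\<lambda>k. U k x) \<longlonglongrightarrow> u x) \<and>
    (\<forall>i. (\<lambda>k. \<integral>\<^sup>+x. ennreal \<bar>partial_deriv i (U k) x - g x $ i\<bar> \<partial>lebesgue_on K) \<longlonglongrightarrow> 0)"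
proof -
  have li: "locally_integrable \<Omega> u" "locally_integrable \<Omega> (\<lambda>x. g x $ i)" for i
    using wg locally_integrable_component by (auto simp: weak_gradient_def)
  obtain r where r: "r > 0" "(\<Union>x\<in>K. cball x r) \<subseteq> \<Omega>"
    using compact_subset_open_imp_cball_epsilon_subset[OF K(1) \<open>open \<Omega>\<close> K(2)] .
  define K' where "K' = (\<Union>x\<in>K. cball x r)"
  have K': "compact K'" "K' \<subseteq> \<Omega>" "K \<subseteq> K'"
    using r compact_cball_thickening[OF K(1)] by (auto simp: K'_def)
  define u' where "u' x = indicator K' x * u x" for x
  define g' where "g' i x = indicator K' x * g x $ i" for i x
  have int: "integrable lebesgue u'" "integrable lebesgue (g' i)" for i
    using integrable_lebesgue_on_compact[OF li(1) K'(1,2)] integrable_lebesgue_on_compact[OF li(2) K'(1,2)]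
    by (simp_all add: u'_def[abs_def] g'_def[abs_def])
  \<comment> \<open>Two demands on the kernel: the shrinking radius gives convergence of the
    gradients in the mean, and the rate 2^-k gives convergence of the functions almost
    everywhere.\<close>
  have "\<exists>\<eta>. mollifier (min r (inverse (Suc k))) \<eta> \<and>
    (\<integral>\<^sup>+x. ennreal \<bar>mollify \<eta> u' x - u' x\<bar> \<partial>lebesgue) \<le> ennreal ((1/2)^k)" for k
  proof -
    obtain d where d: "d > 0"
      "\<And>\<eta>. mollifier d \<eta> \<Longrightarrow> (\<integral>\<^sup>+x. ennreal \<bar>mollify \<eta> u' x - u' x\<bar> \<partial>lebesgue) \<le> ennreal ((1/2)^k)"
      using mollify_L1_small[OF int(1), of "ennreal ((1/2)^k)"] by auto
    obtain \<eta> :: "real^'n \<Rightarrow> real" where "mollifier (min d (min r (inverse (Suc k)))) \<eta>"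
      using mollifier_exists[of "min d (min r (inverse (Suc k)))"] d r by auto
    then have "mollifier d \<eta>" "mollifier (min r (inverse (Suc k))) \<eta>"
      by (rule mollifier_mono; linarith)+
    then show ?thesis
      using d(2) by blast
  qed
  then obtain \<eta> where \<eta>: "\<And>k. mollifier (min r (inverse (real (Suc k)))) (\<eta> k)"
    and L1: "\<And>k. (\<integral>\<^sup>+x. ennreal \<bar>mollify (\<eta> k) u' x - u' x\<bar> \<partial>lebesgue) \<le> ennreal ((1/2)^k)"
    by metis
  have test: "\<eta> k \<in> test_functions UNIV" for k
    using \<eta>[of k] by (simp add: mollifier_def)
  have supp: "\<eta> k x = 0" if "r \<le> norm x" for k x
    using \<eta>[of k] that by (auto simp: mollifier_def)
  have meas: "mollify (\<eta> k) f \<in> borel_measurable lebesgue" if "integrable lebesgue f" for k f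
    using C_k_mollify[OF that test[of k], of 0] by (intro measurable_lebesgue_continuous) simp
  have sub: "AE x in lebesgue_on K. P x" if "AE x in lebesgue. x \<in> K \<longrightarrow> P x" for P
    using that K by (subst AE_restrict_space_iff) (auto simp: borel_compact)
  show ?thesis
  proof (intro exI[of _ "\<lambda>k. mollify (\<eta> k) u'"] conjI allI)
    show "C_k 1 (mollify (\<eta> k) u')" for k
      by (rule C_k_mollify[OF int(1) test])
    have "AE x in lebesgue. (\<lambda>k. ennreal \<bar>mollify (\<eta> k) u' x - u' x\<bar>) \<longlonglongrightarrow> 0"
      using meas[OF int(1)] int(1) by (intro AE_tendsto_0_of_summable_nn_integral L1) auto
    then show "AE x in lebesgue_on K. (\<lambda>k. mollify (\<eta> k) u' x) \<longlonglongrightarrow> u x"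
    proof (intro sub, eventually_elim, intro impI)
      fix x
      assume lim: "(\<lambda>k. ennreal \<bar>mollify (\<eta> k) u' x - u' x\<bar>) \<longlonglongrightarrow> 0" and x: "x \<in> K"
      have "(\<lambda>k. \<bar>mollify (\<eta> k) u' x - u' x\<bar>) \<longlonglongrightarrow> 0"
        using lim by (simp add: tendsto_ennreal_iff[of _ _ 0, simplified])
      then have "(\<lambda>k. mollify (\<eta> k) u' x - u' x) \<longlonglongrightarrow> 0"
        by (rule tendsto_rabs_zero_cancel)
      moreover have "u' x = u x"
        using x K' by (auto simp: u'_def)
      ultimately show "(\<lambda>k. mollify (\<eta> k) u' x) \<longlonglongrightarrow> u x"
        using LIM_zero_cancel by fastforce
    qed
    fix i
    have key: "partial_deriv i (mollify (\<eta> k) u') x = mollify (\<eta> k) (g' i) x" if x: "x \<in> K" for k x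
    proof -
      \<comment> \<open>Affine form, so that the composition rules for
        \<open>a + c *\<^sub>R x\<close> apply with \<open>c = - 1\<close>.\<close>
      define \<phi> where "\<phi> y = \<eta> k (x + (- 1) *\<^sub>R y)" for y
      have "\<phi> \<in> test_functions \<Omega>"
      proof (rule test_functionsI[OF _ compact_cball[of x r]])
        show "C_k m \<phi>" for m
          unfolding \<phi>_def by (intro C_k_comp_affine test_functions_C_k[OF test])
        show "cball x r \<subseteq> \<Omega>"
          using r x by auto
        show "\<phi> y = 0" if "y \<notin> cball x r" for y
          unfolding \<phi>_def using that by (intro supp) (auto simp: dist_norm)
      qed
      have pd: "partial_deriv i \<phi> y = - partial_deriv i (\<eta> k) (x - y)" for y
        using partial_deriv_comp_affine[OF test_functions_differentiable[OF test[of k]],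
            where a = x and c = "- 1"]
        by (simp add: \<phi>_def[abs_def])
      have inK': "y \<in> K'" if "\<not> r < norm (x - y)" for y
        unfolding K'_def using that by (intro UN_I[OF x]) (simp add: dist_norm)
      have "partial_deriv i (\<eta> k) z = 0" if "z \<notin> cball 0 r" for z
        by (rule partial_deriv_eq_0[of "cball 0 r", OF _ _ that]) (auto intro: supp)
      then have pd0: "partial_deriv i (\<eta> k) (x - y) = 0" if "r < norm (x - y)" for y
        using that by auto
      have 1: "u' y * partial_deriv i (\<eta> k) (x - y) = - (u y * partial_deriv i \<phi> y)" for y
        using inK'[of y] pd0[of y] by (cases "r < norm (x - y)") (auto simp: u'_def pd)
      have 2: "g y $ i * \<phi> y = g' i y * \<eta> k (x - y)" for y
        using inK'[of y] supp[of "x - y" k] by (cases "r < norm (x - y)") (auto simp: g'_def \<phi>_def)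
      have "partial_deriv i (mollify (\<eta> k) u') x = - (LINT y|lebesgue. u y * partial_deriv i \<phi> y)"
        unfolding partial_deriv_mollify[OF int(1) test] mollify_def 1 by simp
      also have "\<dots> = (LINT y|lebesgue. g y $ i * \<phi> y)"
        using wg \<open>\<phi> \<in> test_functions \<Omega>\<close> by (simp add: weak_gradient_iff[OF \<open>open \<Omega>\<close>])
      also have "\<dots> = mollify (\<eta> k) (g' i) x"
        unfolding mollify_def 2 ..
      finally show ?thesis .
    qed
    have le: "(\<integral>\<^sup>+x. ennreal \<bar>partial_deriv i (mollify (\<eta> k) u') x - g x $ i\<bar> \<partial>lebesgue_on K)
        \<le> (\<integral>\<^sup>+x. ennreal \<bar>mollify (\<eta> k) (g' i) x - g' i x\<bar> \<partial>lebesgue)" for k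
    proof -
      have "(\<integral>\<^sup>+x. ennreal \<bar>partial_deriv i (mollify (\<eta> k) u') x - g x $ i\<bar> \<partial>lebesgue_on K)
          = (\<integral>\<^sup>+x. ennreal \<bar>partial_deriv i (mollify (\<eta> k) u') x - g x $ i\<bar> * indicator K x \<partial>lebesgue)"
        using K by (subst nn_integral_restrict_space) (auto simp: borel_compact)
      also have "\<dots> \<le> (\<integral>\<^sup>+x. ennreal \<bar>mollify (\<eta> k) (g' i) x - g' i x\<bar> \<partial>lebesgue)"
        using K'(3) by (intro nn_integral_mono) (auto simp: indicator_def key g'_def)
      finally show ?thesis .
    qed
    show "(\<lambda>k. \<integral>\<^sup>+x. ennreal \<bar>partial_deriv i (mollify (\<eta> k) u') x - g x $ i\<bar> \<partial>lebesgue_on K) \<longlonglongrightarrow> 0"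
    proof (rule order_tendstoI)
      fix e :: ennreal
      assume "0 < e"
      then obtain c where c: "0 < c" "c < e"
        using dense by blast
      obtain d where d: "d > 0"
        "\<And>\<eta>. mollifier d \<eta> \<Longrightarrow> (\<integral>\<^sup>+x. ennreal \<bar>mollify \<eta> (g' i) x - g' i x\<bar> \<partial>lebesgue) \<le> c"
        using mollify_L1_small[OF int(2) c(1)] by auto
      have "eventually (\<lambda>k. inverse (real (Suc k)) < d) sequentially"
        using order_tendstoD(2)[OF LIMSEQ_inverse_real_of_nat d(1)] .
      then show "eventually (\<lambda>k. (\<integral>\<^sup>+x. ennreal \<bar>partial_deriv i (mollify (\<eta> k) u') x - g x $ i\<bar>
          \<partial>lebesgue_on K) < e) sequentially"
      proof eventually_elim
        case (elim k)
        then have "mollifier d (\<eta> k)"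
          by (intro mollifier_mono[OF \<eta>]) auto
        then show ?case
          using le[of k] d(2) c(2) by (meson order.strict_trans1 order_trans)
      qed
    qed auto
  qed
qed

text \<open>The values are bounded along with the derivative because in a product rule \<psi>(u)
  multiplies a gradient that is only locally integrable.\<close>

definition bounded_C1 :: "(real \<Rightarrow> real) \<Rightarrow> (real \<Rightarrow> real) \<Rightarrow> bool" where
  "bounded_C1 \<psi> \<psi>' \<longleftrightarrow> (\<forall>t. (\<psi> has_field_derivative \<psi>' t) (at t)) \<and> continuous_on UNIV \<psi>'
     \<and> (\<exists>B. \<forall>t. \<bar>\<psi> t\<bar> \<le> B \<and> \<bar>\<psi>' t\<bar> \<le> B)"

lemma bounded_C1_continuous: "bounded_C1 \<psi> \<psi>' \<Longrightarrow> continuous_on S \<psi>"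
  unfolding bounded_C1_def by (meson DERIV_isCont continuous_at_imp_continuous_on)

lemma bounded_C1_measurable:
  assumes "bounded_C1 \<psi> \<psi>'"
  shows "\<psi> \<in> borel_measurable borel" "\<psi>' \<in> borel_measurable borel"
  using bounded_C1_continuous[OF assms, of UNIV] assms
  by (simp_all add: borel_measurable_continuous_onI bounded_C1_def)

text \<open>With \<open>U\<close>, \<open>W\<close> mollified near the support of the test function \<open>\<phi>\<close>, the integral of
  \<open>\<partial>\<^sub>i(\<psi>(U) \<xi>(W) \<phi>)\<close> vanishes classically; the identity passes to the limit since \<open>U\<close>, \<open>W\<close> converge
  almost everywhere and their gradients in the mean.\<close>

lemma weak_gradient_comp_mult:
  fixes u w :: "real^'n \<Rightarrow> real"
  assumes "open \<Omega>" and u: "weak_gradient \<Omega> u g" and w: "weak_gradient \<Omega> w h"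
    and \<psi>: "bounded_C1 \<psi> \<psi>'" and \<xi>: "bounded_C1 \<xi> \<xi>'"
  shows "weak_gradient \<Omega> (\<lambda>x. \<psi> (u x) * \<xi> (w x))
    (\<lambda>x. (\<psi>' (u x) * \<xi> (w x)) *\<^sub>R g x + (\<psi> (u x) * \<xi>' (w x)) *\<^sub>R h x)"
  unfolding weak_gradient_iff[OF assms(1)]
proof (intro conjI ballI allI)
  have li: "locally_integrable \<Omega> u" "locally_integrable \<Omega> g" "locally_integrable \<Omega> w" "locally_integrable \<Omega> h"
    using u w by (auto simp: weak_gradient_def)
  note [measurable] = bounded_C1_measurable[OF \<psi>] bounded_C1_measurable[OF \<xi>]
  obtain B1 B2 where B12: "\<And>t. \<bar>\<psi> t\<bar> \<le> B1" "\<And>t. \<bar>\<psi>' t\<bar> \<le> B1" "\<And>t. \<bar>\<xi> t\<bar> \<le> B2" "\<And>t. \<bar>\<xi>' t\<bar> \<le> B2"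
    using \<psi> \<xi> unfolding bounded_C1_def by metis
  define B where "B = B1 * B2"
  have "B1 \<ge> 0" "B2 \<ge> 0"
    using B12(1,3)[of 0] by linarith+
  then have B: "\<bar>\<psi> s * \<xi> t\<bar> \<le> B" "\<bar>\<psi>' s * \<xi> t\<bar> \<le> B" "\<bar>\<psi> s * \<xi>' t\<bar> \<le> B" for s t
    unfolding B_def abs_mult using B12 by (auto intro!: mult_mono)
  have meas: "u \<in> borel_measurable (lebesgue_on K)" "w \<in> borel_measurable (lebesgue_on K)"
    if "compact K" "K \<subseteq> \<Omega>" for K
    using that li(1,3) unfolding locally_integrable_def by blast+
  have meas': "(\<lambda>x. a (u x) * b (w x)) \<in> borel_measurable (lebesgue_on K)"
    if "compact K" "K \<subseteq> \<Omega>" "a \<in> borel_measurable borel" "b \<in> borel_measurable borel"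
    for K and a b :: "real \<Rightarrow> real"
    using that(3,4) meas[OF that(1,2)] by measurable
  have one: "locally_integrable \<Omega> (\<lambda>_. 1::real)"
    unfolding locally_integrable_def using lmeasurable_compact finite_measure_lebesgue_on
    by (auto intro: finite_measure.integrable_const)
  show "locally_integrable \<Omega> (\<lambda>x. \<psi> (u x) * \<xi> (w x))"
    using locally_integrable_scale_bounded[OF one, of "\<lambda>x. \<psi> (u x) * \<xi> (w x)" B] meas' B(1) by simp
  have "locally_integrable \<Omega> (\<lambda>x. (\<psi>' (u x) * \<xi> (w x)) *\<^sub>R g x)"
       "locally_integrable \<Omega> (\<lambda>x. (\<psi> (u x) * \<xi>' (w x)) *\<^sub>R h x)"
    by (rule locally_integrable_scale_bounded[OF li(2) meas' B(2)] locally_integrable_scale_bounded[OF li(4) meas' B(3)]; simp)+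
  from locally_integrable_lincomb[OF this, of 1 1]
  show "locally_integrable \<Omega> (\<lambda>x. (\<psi>' (u x) * \<xi> (w x)) *\<^sub>R g x + (\<psi> (u x) * \<xi>' (w x)) *\<^sub>R h x)"
    by simp
  fix \<phi> i
  assume \<phi>: "\<phi> \<in> test_functions \<Omega>"
  obtain K where K: "compact K" "K \<subseteq> \<Omega>" "\<And>x. x \<notin> K \<Longrightarrow> \<phi> x = 0" "\<And>x. x \<notin> K \<Longrightarrow> partial_deriv i \<phi> x = 0"
    using test_functionsE[OF \<phi>] by metis
  \<comment> \<open>The test function and its derivative vanish off \<open>K\<close>, so the limits
    may be taken over a set of finite measure, on which bounded measurable functions are
    integrable.\<close>
  define \<mu> where "\<mu> = lebesgue_on K"
  interpret \<mu>: finite_measure \<mu>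
    unfolding \<mu>_def using K by (intro finite_measure_lebesgue_on lmeasurable_compact)
  have Kl: "K \<in> sets lebesgue"
    using K by (simp add: borel_compact)
  obtain U where U: "\<And>k. C_k 1 (U k)" "AE x in \<mu>. (\<lambda>k. U k x) \<longlonglongrightarrow> u x"
    "\<And>i. (\<lambda>k. \<integral>\<^sup>+x. ennreal \<bar>partial_deriv i (U k) x - g x $ i\<bar> \<partial>\<mu>) \<longlonglongrightarrow> 0"
    using weak_gradient_mollify[OF assms(1) u K(1,2)] unfolding \<mu>_def by blast
  obtain W where W: "\<And>k. C_k 1 (W k)" "AE x in \<mu>. (\<lambda>k. W k x) \<longlonglongrightarrow> w x"
    "\<And>i. (\<lambda>k. \<integral>\<^sup>+x. ennreal \<bar>partial_deriv i (W k) x - h x $ i\<bar> \<partial>\<mu>) \<longlonglongrightarrow> 0"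
    using weak_gradient_mollify[OF assms(1) w K(1,2)] unfolding \<mu>_def by blast
  have cont_meas: "f \<in> borel_measurable \<mu>" if "continuous_on UNIV f" for f :: "real^'n \<Rightarrow> real"
    unfolding \<mu>_def using measurable_lebesgue_continuous[OF that] by (rule measurable_restrict_space1)
  have UW: "continuous_on UNIV (U k)" "continuous_on UNIV (W k)" "continuous_on UNIV (partial_deriv i (U k))"
     "continuous_on UNIV (partial_deriv i (W k))" "U k differentiable (at x)" "W k differentiable (at x)" for k x
    using U(1)[of k] W(1)[of k] C_k_Suc_D[of 0 "U k"] C_k_Suc_D[of 0 "W k"] by auto
  note c\<phi> = test_functions_continuous[OF \<phi>, of UNIV] test_functions_continuous_partial[OF \<phi>, of UNIV i]
  obtain C C' where C: "\<And>x. \<bar>\<phi> x\<bar> \<le> C" "\<And>x. \<bar>partial_deriv i \<phi> x\<bar> \<le> C'"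
    using test_functions_bounded[OF \<phi>] test_functions_bounded[OF test_functions_partial_deriv[OF \<phi>]] by metis
  have [measurable]: "U k \<in> borel_measurable \<mu>" "W k \<in> borel_measurable \<mu>"
    "partial_deriv i (U k) \<in> borel_measurable \<mu>" "partial_deriv i (W k) \<in> borel_measurable \<mu>"
    "\<phi> \<in> borel_measurable \<mu>" "partial_deriv i \<phi> \<in> borel_measurable \<mu>" for k
    using UW c\<phi> by (auto intro: cont_meas)
  have [measurable]: "u \<in> borel_measurable \<mu>" "w \<in> borel_measurable \<mu>"
    using meas[OF K(1,2)] by (auto simp: \<mu>_def)
  have D: "(\<psi> has_field_derivative \<psi>' t) (at t)" "(\<xi> has_field_derivative \<xi>' t) (at t)" for t
    using \<psi> \<xi> by (simp_all add: bounded_C1_def)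
  have cont\<psi>: "isCont \<psi> t" "isCont \<psi>' t" "isCont \<xi> t" "isCont \<xi>' t" for t
    using \<psi> \<xi> DERIV_isCont[OF D(1)] DERIV_isCont[OF D(2)]
    by (simp_all add: bounded_C1_def continuous_on_eq_continuous_at)
  have lim: "AE x in \<mu>. (\<lambda>k. a (U k x) * b (W k x) * \<theta> x) \<longlonglongrightarrow> a (u x) * b (w x) * \<theta> x"
    if "\<And>t. isCont a t" "\<And>t. isCont b t" for a b \<theta> :: "_ \<Rightarrow> real"
    using U(2) W(2)
    by eventually_elim (intro tendsto_mult tendsto_const isCont_tendsto_compose[OF that(1)] isCont_tendsto_compose[OF that(2)])
  have bd: "\<bar>\<psi> s * \<xi> t * \<phi> x\<bar> \<le> B * C" "\<bar>\<psi>' s * \<xi> t * \<phi> x\<bar> \<le> B * C" "\<bar>\<psi> s * \<xi>' t * \<phi> x\<bar> \<le> B * C"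
    "\<bar>\<psi> s * \<xi> t * partial_deriv i \<phi> x\<bar> \<le> B * C'" for s t x
    using B C order_trans[OF abs_ge_zero B(1)[of 0 0]] order_trans[OF abs_ge_zero C(1)[of x]]
     order_trans[OF abs_ge_zero C(2)[of x]]
    by (simp_all only: abs_mult[of _ "\<phi> x"] abs_mult[of _ "partial_deriv i \<phi> x"]) (auto intro!: mult_mono)
  have intc: "integrable \<mu> f" if "continuous_on UNIV f" for f :: "real^'n \<Rightarrow> real"
  proof -
    have "bounded (f ` K)"
      by (rule compact_imp_bounded[OF compact_continuous_image[OF continuous_on_subset[OF that] K(1)]]) simp
    then obtain D where D: "\<And>x. x \<in> K \<Longrightarrow> norm (f x) \<le> D"
      by (auto simp: bounded_iff)
    show ?thesis
      by (rule \<mu>.integrable_const_bound[where B = D]) (use D cont_meas[OF that] in \<open>auto simp: \<mu>_def\<close>)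
  qed
  have intg: "integrable \<mu> (\<lambda>x. g x $ i)" "integrable \<mu> (\<lambda>x. h x $ i)"
    using locally_integrable_component[OF li(2)] locally_integrable_component[OF li(4)] K
    by (auto simp: locally_integrable_def \<mu>_def)
  have T1: "(\<lambda>k. LINT x|\<mu>. (\<psi>' (U k x) * \<xi> (W k x) * \<phi> x) * partial_deriv i (U k) x)
      \<longlonglongrightarrow> (LINT x|\<mu>. (\<psi>' (u x) * \<xi> (w x) * \<phi> x) * g x $ i)"
    by (rule tendsto_integral_mult_bounded[OF _ _ bd(2) lim[OF cont\<psi>(2,3)] intc[OF UW(3)] intg(1) U(3)]) measurable
  have T2: "(\<lambda>k. LINT x|\<mu>. (\<psi> (U k x) * \<xi>' (W k x) * \<phi> x) * partial_deriv i (W k) x)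
      \<longlonglongrightarrow> (LINT x|\<mu>. (\<psi> (u x) * \<xi>' (w x) * \<phi> x) * h x $ i)"
    by (rule tendsto_integral_mult_bounded[OF _ _ bd(3) lim[OF cont\<psi>(1,4)] intc[OF UW(4)] intg(2) W(3)]) measurable
  \<comment> \<open>The factor 1 plays the role of a constant sequence of gradients, which brings
    the third term into the shape of the other two.\<close>
  have T3: "(\<lambda>k. LINT x|\<mu>. (\<psi> (U k x) * \<xi> (W k x) * partial_deriv i \<phi> x) * 1)
      \<longlonglongrightarrow> (LINT x|\<mu>. (\<psi> (u x) * \<xi> (w x) * partial_deriv i \<phi> x) * 1)"
    by (rule tendsto_integral_mult_bounded[OF _ _ bd(4) lim[OF cont\<psi>(1,3)]]) (use intc in auto)
  have bm: "integrable \<mu> (\<lambda>x. a x * f x)"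
    if "integrable \<mu> f" "a \<in> borel_measurable \<mu>" "\<And>x. \<bar>a x\<bar> \<le> D" for a f :: "_ \<Rightarrow> real" and D
    using integrable_bounded_mult[OF that] by (simp add: mult.commute)
  have ints: "integrable \<mu> (\<lambda>x. (\<psi>' (U k x) * \<xi> (W k x) * \<phi> x) * partial_deriv i (U k) x)"
    "integrable \<mu> (\<lambda>x. (\<psi> (U k x) * \<xi>' (W k x) * \<phi> x) * partial_deriv i (W k) x)"
    "integrable \<mu> (\<lambda>x. (\<psi> (U k x) * \<xi> (W k x) * partial_deriv i \<phi> x) * 1)" for k
    by (rule bm[OF intc[OF UW(3)] _ bd(2)] bm[OF intc[OF UW(4)] _ bd(3)] bm[OF intc[OF continuous_on_const] _ bd(4)];
        measurable)+
  have zero: "(LINT x|\<mu>. (\<psi>' (U k x) * \<xi> (W k x) * \<phi> x) * partial_deriv i (U k) x)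
      + (LINT x|\<mu>. (\<psi> (U k x) * \<xi>' (W k x) * \<phi> x) * partial_deriv i (W k) x)
      + (LINT x|\<mu>. (\<psi> (U k x) * \<xi> (W k x) * partial_deriv i \<phi> x) * 1) = 0" for k
  proof -
    define F where "F x = \<psi> (U k x) * \<xi> (W k x) * \<phi> x" for x
    have d: "(\<lambda>x. \<psi> (U k x)) differentiable (at x)" "(\<lambda>x. \<xi> (W k x)) differentiable (at x)"
      "\<phi> differentiable (at x)" for x
      by (rule differentiableI[OF has_derivative_comp_real[OF UW(5) D(1)]]
          differentiableI[OF has_derivative_comp_real[OF UW(6) D(2)]] test_functions_differentiable[OF \<phi>])+
    have pd: "partial_deriv i F x = (\<psi>' (U k x) * \<xi> (W k x) * \<phi> x) * partial_deriv i (U k) x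
      + (\<psi> (U k x) * \<xi>' (W k x) * \<phi> x) * partial_deriv i (W k) x
      + (\<psi> (U k x) * \<xi> (W k x) * partial_deriv i \<phi> x) * 1" for x
    proof -
      have p: "partial_deriv i (\<lambda>x. \<psi> (U k x)) x = \<psi>' (U k x) * partial_deriv i (U k) x"
        "partial_deriv i (\<lambda>x. \<xi> (W k x)) x = \<xi>' (W k x) * partial_deriv i (W k) x"
        by (rule partial_deriv_comp[OF UW(5) D(1)] partial_deriv_comp[OF UW(6) D(2)])+
      have "partial_deriv i F x = \<psi> (U k x) * \<xi> (W k x) * partial_deriv i \<phi> x
          + partial_deriv i (\<lambda>x. \<psi> (U k x) * \<xi> (W k x)) x * \<phi> x"
        unfolding F_def by (intro partial_deriv_mult d differentiable_mult)
      also have "partial_deriv i (\<lambda>x. \<psi> (U k x) * \<xi> (W k x)) x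
          = \<psi> (U k x) * partial_deriv i (\<lambda>x. \<xi> (W k x)) x + partial_deriv i (\<lambda>x. \<psi> (U k x)) x * \<xi> (W k x)"
        by (intro partial_deriv_mult d)
      finally show ?thesis
        unfolding p by (simp add: algebra_simps)
    qed
    have "(LINT x|lebesgue. partial_deriv i F x) = 0"
    proof (rule lborel_integral_partial_deriv_eq_0[OF _ _ K(1)])
      show "F differentiable (at x)" for x
        unfolding F_def by (intro d differentiable_mult)
      show "continuous_on UNIV (partial_deriv i F)"
      proof -
        have "continuous_on UNIV (\<lambda>x. a (U k x))" "continuous_on UNIV (\<lambda>x. a (W k x))"
          if "\<And>t. isCont a t" for a :: "real \<Rightarrow> real"
        proof -
          have "continuous_on UNIV a"
            using that by (simp add: continuous_at_imp_continuous_on)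
          then show "continuous_on UNIV (\<lambda>x. a (U k x))" "continuous_on UNIV (\<lambda>x. a (W k x))"
            by (rule continuous_on_compose2[OF _ UW(1)] continuous_on_compose2[OF _ UW(2)]; simp)+
        qed
        note this(1)[OF cont\<psi>(1)] this(1)[OF cont\<psi>(2)] this(2)[OF cont\<psi>(3)] this(2)[OF cont\<psi>(4)]
        then show ?thesis
          unfolding pd[abs_def] by (intro continuous_on_add continuous_on_mult continuous_on_const c\<phi> UW(3,4))
      qed
      show "F x = 0" if "x \<notin> K" for x
        using K(3)[OF that] by (simp add: F_def)
    qed
    moreover have "(LINT x|\<mu>. partial_deriv i F x) = (LINT x|lebesgue. partial_deriv i F x)"
      unfolding \<mu>_def by (rule LINT_lebesgue_on_eq[OF Kl]) (simp add: pd K(3,4))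
    ultimately have "(LINT x|\<mu>. partial_deriv i F x) = 0"
      by simp
    then show ?thesis
      unfolding pd using ints[of k] by simp
  qed
  have "(LINT x|\<mu>. (\<psi>' (u x) * \<xi> (w x) * \<phi> x) * g x $ i) + (LINT x|\<mu>. (\<psi> (u x) * \<xi>' (w x) * \<phi> x) * h x $ i)
      + (LINT x|\<mu>. (\<psi> (u x) * \<xi> (w x) * partial_deriv i \<phi> x) * 1) = 0"
    using tendsto_add[OF tendsto_add[OF T1 T2] T3] unfolding zero
    by (rule LIMSEQ_unique[OF _ tendsto_const])
  moreover have "integrable \<mu> (\<lambda>x. (\<psi>' (u x) * \<xi> (w x) * \<phi> x) * g x $ i)"
    "integrable \<mu> (\<lambda>x. (\<psi> (u x) * \<xi>' (w x) * \<phi> x) * h x $ i)"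
    by (rule bm[OF intg(1) _ bd(2)] bm[OF intg(2) _ bd(3)]; measurable)+
  ultimately have eq: "(LINT x|\<mu>. (\<psi> (u x) * \<xi> (w x) * partial_deriv i \<phi> x)) =
      - (LINT x|\<mu>. (\<psi>' (u x) * \<xi> (w x) * \<phi> x) * g x $ i + (\<psi> (u x) * \<xi>' (w x) * \<phi> x) * h x $ i)"
    by simp
  have "(LINT x|lebesgue. \<psi> (u x) * \<xi> (w x) * partial_deriv i \<phi> x)
      = (LINT x|\<mu>. \<psi> (u x) * \<xi> (w x) * partial_deriv i \<phi> x)"
    unfolding \<mu>_def by (rule LINT_lebesgue_on_eq[OF Kl, symmetric]) (simp add: K(4))
  moreover have "(LINT x|lebesgue. ((\<psi>' (u x) * \<xi> (w x)) *\<^sub>R g x + (\<psi> (u x) * \<xi>' (w x)) *\<^sub>R h x) $ i * \<phi> x)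
      = (LINT x|\<mu>. ((\<psi>' (u x) * \<xi> (w x)) *\<^sub>R g x + (\<psi> (u x) * \<xi>' (w x)) *\<^sub>R h x) $ i * \<phi> x)"
    unfolding \<mu>_def by (rule LINT_lebesgue_on_eq[OF Kl, symmetric]) (simp add: K(3))
  ultimately show "(LINT x|lebesgue. \<psi> (u x) * \<xi> (w x) * partial_deriv i \<phi> x)
      = - (LINT x|lebesgue. ((\<psi>' (u x) * \<xi> (w x)) *\<^sub>R g x + (\<psi> (u x) * \<xi>' (w x)) *\<^sub>R h x) $ i * \<phi> x)"
    using eq by (simp add: algebra_simps)
qed

section \<open>Truncations and cutoffs\<close>

text \<open>A test function of the whole space need not be supported in \<Omega>. Multiplying it by
  a cutoff equal to 1 near \<open>K\<close> repairs this and changes neither integral, because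
  \<open>v\<close> and \<open>g\<close> vanish almost everywhere in \<Omega> off
  \<open>K\<close>.\<close>

lemma weak_gradient_extend_zero:
  fixes v :: "real^'n \<Rightarrow> real"
  assumes "open \<Omega>" and wg: "weak_gradient \<Omega> v g"
    and meas: "v \<in> borel_measurable (lebesgue_on \<Omega>)" "g \<in> borel_measurable (lebesgue_on \<Omega>)"
    and K: "compact K" "K \<subseteq> \<Omega>"
    and ae: "AE x in lebesgue. x \<in> \<Omega> - K \<longrightarrow> v x = 0 \<and> g x = 0"
  shows "weak_gradient UNIV (\<lambda>x. indicator \<Omega> x * v x) (\<lambda>x. indicator \<Omega> x *\<^sub>R g x)"
  unfolding weak_gradient_iff[OF open_UNIV]
proof (intro conjI ballI allI)
  define v0 where "v0 x = indicator \<Omega> x * v x" for x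
  define g0 where "g0 x = indicator \<Omega> x *\<^sub>R g x" for x
  have \<Omega>: "\<Omega> \<in> sets lebesgue"
    using \<open>open \<Omega>\<close> by simp
  have li: "locally_integrable \<Omega> v" "locally_integrable \<Omega> g"
    using wg by (auto simp: weak_gradient_def)
  have m0: "v0 \<in> borel_measurable lebesgue" "g0 \<in> borel_measurable lebesgue"
    using meas \<Omega> by (simp_all add: borel_measurable_restrict_space_iff v0_def[abs_def] g0_def[abs_def])
  have ae0: "AE x in lebesgue. x \<notin> K \<longrightarrow> v0 x = 0 \<and> g0 x = 0"
    using ae by eventually_elim (auto simp: v0_def g0_def indicator_def)
  \<comment> \<open>Local integrability in \<Omega> says nothing near the boundary; both functions
    are integrable because almost everywhere they are carried by \<open>K\<close>.\<close>
  have int: "integrable lebesgue v0" "integrable lebesgue g0"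
  proof -
    show "integrable lebesgue v0"
      by (rule integrable_cong_AE_imp[OF integrable_lebesgue_on_compact[OF li(1) K] m0(1)])
        (use ae0 K(2) in \<open>auto elim!: eventually_mono simp: v0_def indicator_def\<close>)
    show "integrable lebesgue g0"
      by (rule integrable_cong_AE_imp[OF integrable_lebesgue_on_compact[OF li(2) K] m0(2)])
        (use ae0 K(2) in \<open>auto elim!: eventually_mono simp: g0_def indicator_def\<close>)
  qed
  have "integrable (lebesgue_on L) f" if "integrable lebesgue f" "compact L"
    for L and f :: "real^'n \<Rightarrow> 'b::{banach, second_countable_topology}"
    using that by (subst integrable_restrict_space) (auto intro!: integrable_mult_indicator simp: borel_compact)
  then have "locally_integrable UNIV v0" "locally_integrable UNIV g0"
    using int by (auto simp: locally_integrable_def)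
  then show "locally_integrable UNIV (\<lambda>x. indicator \<Omega> x * v x)"
     "locally_integrable UNIV (\<lambda>x. indicator \<Omega> x *\<^sub>R g x)"
    by (simp_all add: v0_def[abs_def] g0_def[abs_def])
  fix \<phi> :: "real^'n \<Rightarrow> real" and i
  assume \<phi>: "\<phi> \<in> test_functions UNIV"
  obtain \<kappa> S where \<kappa>: "\<kappa> \<in> test_functions \<Omega>" "open S" "K \<subseteq> S" "\<And>x. x \<in> S \<Longrightarrow> \<kappa> x = 1"
    using smooth_cutoff_exists[OF K(1) \<open>open \<Omega>\<close> K(2)] by metis
  define \<phi>' where "\<phi>' x = \<phi> x * \<kappa> x" for x
  have \<phi>': "\<phi>' \<in> test_functions \<Omega>"
    unfolding \<phi>'_def using test_functions_mult[OF \<kappa>(1) test_functions_C_k[OF \<phi>]] .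
  have eqS: "\<phi>' x = \<phi> x" "partial_deriv i \<phi>' x = partial_deriv i \<phi> x" if "x \<in> S" for x
    using \<kappa>(4) that
    by (auto simp: \<phi>'_def intro!: partial_deriv_cong_open[OF \<kappa>(2) _ that] test_functions_differentiable[OF \<phi>])
  obtain L where L: "L \<subseteq> \<Omega>" "\<And>x. x \<notin> L \<Longrightarrow> \<phi>' x = 0" "\<And>x i. x \<notin> L \<Longrightarrow> partial_deriv i \<phi>' x = 0"
    using test_functionsE[OF \<phi>'] by metis
  have cm: "f \<in> borel_measurable lebesgue" if "f \<in> test_functions UNIV" for f :: "real^'n \<Rightarrow> real"
    by (intro measurable_lebesgue_continuous test_functions_continuous[OF that])
  note test_functions_UNIV[OF \<phi>']
  note [measurable] = m0 cm[OF \<phi>] cm[OF this] cm[OF test_functions_partial_deriv[OF \<phi>]]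
    cm[OF test_functions_partial_deriv[OF this]]
  have g0i [measurable]: "(\<lambda>x. g0 x $ i) \<in> borel_measurable lebesgue"
    by (rule borel_measurable_integrable[OF integrable_bounded_linear[OF bounded_linear_vec_nth int(2)]])
  have "(LINT x|lebesgue. v0 x * partial_deriv i \<phi> x) = (LINT x|lebesgue. v0 x * partial_deriv i \<phi>' x)"
    by (rule integral_cong_AE, measurable)
      (use ae0 \<kappa>(3) eqS(2) in \<open>auto elim!: eventually_mono\<close>)
  also have "\<dots> = (LINT x|lebesgue. v x * partial_deriv i \<phi>' x)"
    using L(1,3) by (intro Bochner_Integration.integral_cong) (auto simp: v0_def indicator_def)
  also have "\<dots> = - (LINT x|lebesgue. g x $ i * \<phi>' x)"
    using wg \<phi>' by (simp add: weak_gradient_iff[OF \<open>open \<Omega>\<close>])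
  also have "(LINT x|lebesgue. g x $ i * \<phi>' x) = (LINT x|lebesgue. g0 x $ i * \<phi>' x)"
    using L(1,2) by (intro Bochner_Integration.integral_cong) (auto simp: g0_def indicator_def)
  also have "\<dots> = (LINT x|lebesgue. g0 x $ i * \<phi> x)"
    by (rule integral_cong_AE, measurable)
      (use ae0 \<kappa>(3) eqS(1) in \<open>auto elim!: eventually_mono\<close>)
  finally show "(LINT x|lebesgue. indicator \<Omega> x * v x * partial_deriv i \<phi> x)
      = - (LINT x|lebesgue. (indicator \<Omega> x *\<^sub>R g x) $ i * \<phi> x)"
    by (simp add: v0_def g0_def)
qed

lemma weak_gradient_zero: "weak_gradient \<Omega> (\<lambda>_. 0) (\<lambda>_. 0)"
  by (simp add: weak_gradient_def locally_integrable_def)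

lemma bounded_C1_const: "bounded_C1 (\<lambda>_. c) (\<lambda>_. 0)"
  by (auto simp: bounded_C1_def intro!: exI[of _ "\<bar>c\<bar>"])

lemma weak_gradient_comp:
  fixes u :: "real^'n \<Rightarrow> real"
  assumes "open \<Omega>" "weak_gradient \<Omega> u g" "bounded_C1 \<psi> \<psi>'"
  shows "weak_gradient \<Omega> (\<lambda>x. \<psi> (u x)) (\<lambda>x. \<psi>' (u x) *\<^sub>R g x)"
  using weak_gradient_comp_mult[OF assms(1,2) weak_gradient_zero assms(3) bounded_C1_const[of 1]]
  by simp

text \<open>\<rho> is a trapezoid in |t|: 0 up to 1/n, rising to 1 at 2/n, falling to 0 between n
  and n + 1; \<psi> is its primitive with \<psi>(0) = 0. On the plateau \<psi>(t) - t is constant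
  and equals its value at \<plusminus>2/n, which is at most 2/n in modulus. If 2/n > n there is no
  plateau, and the product of the two ramps still lies between 0 and 1.\<close>

lemma truncation_exists:
  fixes n :: real
  assumes n: "n \<ge> 1"
  shows "\<exists>\<psi> \<rho>. bounded_C1 \<psi> \<rho> \<and> (\<forall>t. \<bar>\<psi> t\<bar> \<le> \<bar>t\<bar>) \<and> (\<forall>t. \<bar>\<psi> t\<bar> \<le> n + 1) \<and> (\<forall>t. \<bar>\<rho> t\<bar> \<le> 1)
    \<and> (\<forall>t. \<bar>t\<bar> \<le> 1 / n \<longrightarrow> \<psi> t = 0 \<and> \<rho> t = 0)
    \<and> (\<forall>t. \<bar>t\<bar> \<le> n \<longrightarrow> \<bar>\<psi> t - t\<bar> \<le> 2 / n) \<and> (\<forall>t. 2 / n \<le> \<bar>t\<bar> \<longrightarrow> \<bar>t\<bar> \<le> n \<longrightarrow> \<rho> t = 1)"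
proof -
  define \<rho> where "\<rho> t = max 0 (min 1 (n * \<bar>t\<bar> - 1)) * max 0 (min 1 (n + 1 - \<bar>t\<bar>))" for t
  have cont: "continuous_on UNIV \<rho>"
    unfolding \<rho>_def by (intro continuous_intros)
  then have "isCont \<rho> t" for t
    by (simp add: continuous_on_eq_continuous_at)
  then obtain F where F: "\<And>t. (F has_vector_derivative \<rho> t) (at t)"
    using einterval_antiderivative[of "-\<infinity>" "\<infinity>" \<rho>] by auto
  define \<psi> where "\<psi> t = F t - F 0" for t
  have D: "(\<psi> has_field_derivative \<rho> t) (at t within S)" for t S
  proof -
    have "(F has_field_derivative \<rho> t) (at t within S)"
      using F[of t] unfolding has_real_derivative_iff_has_vector_derivative[symmetric]
      by (rule has_field_derivative_at_within)
    from DERIV_diff[OF this DERIV_const, of "F 0"] show ?thesis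
      by (simp add: \<psi>_def[abs_def])
  qed
  have D': "((\<lambda>t. \<psi> t - t) has_field_derivative (\<rho> t - 1)) (at t within S)" for t S
    by (rule DERIV_diff[OF D DERIV_ident])
  have \<psi>0: "\<psi> 0 = 0"
    by (simp add: \<psi>_def)
  have \<rho>01: "0 \<le> \<rho> t" "\<rho> t \<le> 1" for t
    unfolding \<rho>_def by (auto intro!: mult_nonneg_nonneg mult_le_one)
  have \<rho>small: "\<rho> t = 0" if "\<bar>t\<bar> \<le> 1 / n" for t
    using that n by (simp add: \<rho>_def field_simps max_def min_def)
  have \<rho>large: "\<rho> t = 0" if "n + 1 \<le> \<bar>t\<bar>" for t
    using that by (simp add: \<rho>_def)
  have \<rho>mid: "\<rho> t = 1" if "2 / n \<le> \<bar>t\<bar>" "\<bar>t\<bar> \<le> n" for t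
    using that n by (simp add: \<rho>_def field_simps)
  have const: "\<psi> x = \<psi> y" if "convex S" "\<And>z. z \<in> S \<Longrightarrow> \<rho> z = 0" "x \<in> S" "y \<in> S" for x y S
    using field_differentiable_bound[of S \<psi> \<rho> 0 x y, OF that(1) D _ that(3,4)] that(2) by simp
  have const': "\<psi> x - x = \<psi> y - y" if "convex S" "\<And>z. z \<in> S \<Longrightarrow> \<rho> z = 1" "x \<in> S" "y \<in> S" for x y S
    using field_differentiable_bound[of S "\<lambda>t. \<psi> t - t" "\<lambda>t. \<rho> t - 1" 0 x y, OF that(1) D' _ that(3,4)]
      that(2) by simp
  have le: "\<bar>\<psi> t\<bar> \<le> \<bar>t\<bar>" for t
    using field_differentiable_bound[of UNIV \<psi> \<rho> 1 t 0] D \<rho>01 \<psi>0 by (auto simp: abs_le_iff)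
  have small: "\<psi> t = 0" if "\<bar>t\<bar> \<le> 1 / n" for t
    using const[of "cball 0 (1 / n)" t 0] \<rho>small \<psi>0 that n by simp
  have bd: "\<bar>\<psi> t\<bar> \<le> n + 1" for t
  proof -
    consider "\<bar>t\<bar> \<le> n + 1" | "n + 1 \<le> t" | "t \<le> - (n + 1)"
      by linarith
    then show ?thesis
    proof cases
      case 1
      then show ?thesis using le[of t] by linarith
    next
      case 2
      then have "\<psi> t = \<psi> (n + 1)"
        using const[of "{n + 1..}" t "n + 1"] \<rho>large n by simp
      then show ?thesis using le[of "n + 1"] n by simp
    next
      case 3
      then have "\<psi> t = \<psi> (- (n + 1))"
        using const[of "{..- (n + 1)}" t "- (n + 1)"] \<rho>large n by simp
      then show ?thesis using le[of "- (n + 1)"] n by simp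
    qed
  qed
  have le': "\<bar>\<psi> t - t\<bar> \<le> \<bar>t\<bar>" for t
    using field_differentiable_bound[of UNIV "\<lambda>t. \<psi> t - t" "\<lambda>t. \<rho> t - 1" 1 t 0] D' \<rho>01 \<psi>0
    by (auto simp: abs_le_iff)
  have close: "\<bar>\<psi> t - t\<bar> \<le> 2 / n" if "\<bar>t\<bar> \<le> n" for t
  proof -
    have n2: "0 \<le> 2 / n"
      using n by simp
    consider "\<bar>t\<bar> \<le> 2 / n" | "2 / n \<le> t" | "t \<le> - (2 / n)"
      by linarith
    then show ?thesis
    proof cases
      case 1
      then show ?thesis using le'[of t] by linarith
    next
      case 2
      then have "\<psi> t - t = \<psi> (2 / n) - 2 / n"
        using that n2 by (intro const'[OF convex_real_interval(5), of "2 / n" "n"] \<rho>mid;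
            unfold atLeastAtMost_iff; linarith)
      then show ?thesis using le'[of "2 / n"] n by simp
    next
      case 3
      then have "\<psi> t - t = \<psi> (- (2 / n)) - (- (2 / n))"
        using that n2 by (intro const'[OF convex_real_interval(5), of "- n" "- (2 / n)"] \<rho>mid;
            unfold atLeastAtMost_iff; linarith)
      then show ?thesis using le'[of "- (2 / n)"] n by simp
    qed
  qed
  have "bounded_C1 \<psi> \<rho>"
    unfolding bounded_C1_def
  proof (intro conjI allI exI[of _ "n + 1"] D cont bd)
    show "\<bar>\<rho> t\<bar> \<le> n + 1" for t
      using \<rho>01[of t] n by simp
  qed
  moreover have "\<bar>\<rho> t\<bar> \<le> 1" for t
    using \<rho>01[of t] by simp
  ultimately show ?thesis
    using le bd small \<rho>small close \<rho>mid by (intro exI[of _ \<psi>] exI[of _ \<rho>] conjI allI impI)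
qed

text \<open>The level is n = k + 1, whence the bound k + 2. At t = 0 every derivative is 0, so
  \<rho>_k tends to the indicator of t \<noteq> 0; limits of truncated gradients therefore vanish on
  the zero set.\<close>

lemma truncation_sequence:
  obtains \<psi> \<rho> :: "nat \<Rightarrow> real \<Rightarrow> real" where "\<And>k. bounded_C1 (\<psi> k) (\<rho> k)"
    "\<And>k t. \<bar>\<psi> k t\<bar> \<le> \<bar>t\<bar>" "\<And>k t. \<bar>\<psi> k t\<bar> \<le> real k + 2" "\<And>k t. \<bar>\<rho> k t\<bar> \<le> 1"
    "\<And>k t. \<bar>t\<bar> \<le> 1 / real (Suc k) \<Longrightarrow> \<psi> k t = 0" "\<And>k t. \<bar>t\<bar> \<le> 1 / real (Suc k) \<Longrightarrow> \<rho> k t = 0"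
    "\<And>t. (\<lambda>k. \<psi> k t) \<longlonglongrightarrow> t" "\<And>t. t \<noteq> 0 \<Longrightarrow> (\<lambda>k. \<rho> k t) \<longlonglongrightarrow> 1"
proof -
  have "\<forall>k. \<exists>\<psi> \<rho>. bounded_C1 \<psi> \<rho> \<and> (\<forall>t. \<bar>\<psi> t\<bar> \<le> \<bar>t\<bar>) \<and> (\<forall>t. \<bar>\<psi> t\<bar> \<le> real (Suc k) + 1) \<and> (\<forall>t. \<bar>\<rho> t\<bar> \<le> 1)
    \<and> (\<forall>t. \<bar>t\<bar> \<le> 1 / real (Suc k) \<longrightarrow> \<psi> t = 0 \<and> \<rho> t = 0)
    \<and> (\<forall>t. \<bar>t\<bar> \<le> real (Suc k) \<longrightarrow> \<bar>\<psi> t - t\<bar> \<le> 2 / real (Suc k))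
    \<and> (\<forall>t. 2 / real (Suc k) \<le> \<bar>t\<bar> \<longrightarrow> \<bar>t\<bar> \<le> real (Suc k) \<longrightarrow> \<rho> t = 1)"
    by (intro allI truncation_exists) simp
  then obtain \<psi> \<rho> where *: "\<And>k. bounded_C1 (\<psi> k) (\<rho> k)" "\<And>k t. \<bar>\<psi> k t\<bar> \<le> \<bar>t\<bar>"
    "\<And>k t. \<bar>\<psi> k t\<bar> \<le> real (Suc k) + 1" "\<And>k t. \<bar>\<rho> k t\<bar> \<le> 1"
    "\<And>k t. \<bar>t\<bar> \<le> 1 / real (Suc k) \<Longrightarrow> \<psi> k t = 0 \<and> \<rho> k t = 0"
    "\<And>k t. \<bar>t\<bar> \<le> real (Suc k) \<Longrightarrow> \<bar>\<psi> k t - t\<bar> \<le> 2 / real (Suc k)"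
    "\<And>k t. 2 / real (Suc k) \<le> \<bar>t\<bar> \<Longrightarrow> \<bar>t\<bar> \<le> real (Suc k) \<Longrightarrow> \<rho> k t = 1"
    unfolding choice_iff by blast
  have large: "eventually (\<lambda>k. \<bar>t\<bar> \<le> real (Suc k)) sequentially" for t
    using eventually_ge_at_top[of "nat \<lceil>\<bar>t\<bar>\<rceil>"] by eventually_elim linarith
  have inv: "(\<lambda>k. 2 / real (Suc k)) \<longlonglongrightarrow> 0"
    using tendsto_mult[OF tendsto_const[of 2] LIMSEQ_inverse_real_of_nat] by (simp add: field_simps)
  show ?thesis
  proof (rule that[of \<psi> \<rho>])
    show "(\<lambda>k. \<psi> k t) \<longlonglongrightarrow> t" for t
    proof -
      have "(\<lambda>k. \<psi> k t - t) \<longlonglongrightarrow> 0"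
      proof (rule Lim_null_comparison[OF _ inv])
        show "eventually (\<lambda>k. norm (\<psi> k t - t) \<le> 2 / real (Suc k)) sequentially"
          using large[of t] by eventually_elim (use *(6) in simp)
      qed
      then show ?thesis
        by (simp add: LIM_zero_iff)
    qed
    show "(\<lambda>k. \<rho> k t) \<longlonglongrightarrow> 1" if "t \<noteq> 0" for t
    proof -
      have "eventually (\<lambda>k. 2 / real (Suc k) < \<bar>t\<bar>) sequentially"
        using that by (intro order_tendstoD(2)[OF inv]) simp
      then have "eventually (\<lambda>k. 1 = \<rho> k t) sequentially"
        using large[of t] by eventually_elim (use *(7) in simp)
      then show ?thesis
        by (rule Lim_transform_eventually[OF tendsto_const])
    qed
  qed (use * in \<open>auto simp: add.commute\<close>)
qed

text \<open>This gradient is the limit of the gradients of the truncations of \<open>u\<close>, so the a.e. vanishing of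
  \<open>g\<close> on the zero set of \<open>u\<close> is not needed later.\<close>

lemma weak_gradient_zero_level:
  fixes u :: "real^'n \<Rightarrow> real"
  assumes "open \<Omega>" and wg: "weak_gradient \<Omega> u g"
  shows "weak_gradient \<Omega> u (\<lambda>x. if u x = 0 then 0 else g x)"
  unfolding weak_gradient_iff[OF assms(1)]
proof (intro conjI ballI allI)
  obtain \<psi> \<rho> :: "nat \<Rightarrow> real \<Rightarrow> real" where \<psi>: "\<And>k. bounded_C1 (\<psi> k) (\<rho> k)"
    "\<And>k t. \<bar>\<psi> k t\<bar> \<le> \<bar>t\<bar>" "\<And>k t. \<bar>\<rho> k t\<bar> \<le> 1" "\<And>k t. \<bar>t\<bar> \<le> 1 / real (Suc k) \<Longrightarrow> \<rho> k t = 0"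
    "\<And>t. (\<lambda>k. \<psi> k t) \<longlonglongrightarrow> t" "\<And>t. t \<noteq> 0 \<Longrightarrow> (\<lambda>k. \<rho> k t) \<longlonglongrightarrow> 1"
    using truncation_sequence by metis
  have li: "locally_integrable \<Omega> u" "locally_integrable \<Omega> g"
    using wg by (auto simp: weak_gradient_def)
  show "locally_integrable \<Omega> u"
    by fact
  have "(\<lambda>x. if u x = 0 then 0 else 1 :: real) \<in> borel_measurable (lebesgue_on K)" if "compact K" "K \<subseteq> \<Omega>" for K
  proof -
    have [measurable]: "u \<in> borel_measurable (lebesgue_on K)"
      using li(1) that by (auto simp: locally_integrable_def)
    show ?thesis
      by measurable
  qed
  then have "locally_integrable \<Omega> (\<lambda>x. (if u x = 0 then 0 else 1 :: real) *\<^sub>R g x)"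
    by (rule locally_integrable_scale_bounded[OF li(2), where B = 1]) auto
  moreover have "(\<lambda>x. (if u x = 0 then 0 else 1 :: real) *\<^sub>R g x) = (\<lambda>x. if u x = 0 then 0 else g x)"
    by auto
  ultimately show li': "locally_integrable \<Omega> (\<lambda>x. if u x = 0 then 0 else g x)"
    by simp
  fix \<phi> i
  assume \<phi>: "\<phi> \<in> test_functions \<Omega>"
  have wk: "weak_gradient \<Omega> (\<lambda>x. \<psi> k (u x)) (\<lambda>x. \<rho> k (u x) *\<^sub>R g x)" for k
    by (rule weak_gradient_comp[OF assms \<psi>(1)])
  then have lik: "locally_integrable \<Omega> (\<lambda>x. \<psi> k (u x))" "locally_integrable \<Omega> (\<lambda>x. \<rho> k (u x) *\<^sub>R g x)" for k
    by (auto simp: weak_gradient_def)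
  have int: "integrable lebesgue (\<lambda>x. u x * partial_deriv i \<phi> x)" "integrable lebesgue (\<lambda>x. g x $ i * \<phi> x)"
    "integrable lebesgue (\<lambda>x. (if u x = 0 then 0 else g x) $ i * \<phi> x)"
    by (rule integrable_mult_test locally_integrable_component li li' \<phi> test_functions_partial_deriv)+
  have intk: "integrable lebesgue (\<lambda>x. \<psi> k (u x) * partial_deriv i \<phi> x)"
    "integrable lebesgue (\<lambda>x. (\<rho> k (u x) *\<^sub>R g x) $ i * \<phi> x)" for k
    by (rule integrable_mult_test locally_integrable_component lik \<phi> test_functions_partial_deriv)+
  have "(\<lambda>k. LINT x|lebesgue. \<psi> k (u x) * partial_deriv i \<phi> x) \<longlonglongrightarrow> (LINT x|lebesgue. u x * partial_deriv i \<phi> x)"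
  proof (rule integral_dominated_convergence[where w = "\<lambda>x. norm (u x * partial_deriv i \<phi> x)"])
    show "AE x in lebesgue. (\<lambda>k. \<psi> k (u x) * partial_deriv i \<phi> x) \<longlonglongrightarrow> u x * partial_deriv i \<phi> x"
      by (intro AE_I2 tendsto_intros \<psi>)
    show "AE x in lebesgue. norm (\<psi> k (u x) * partial_deriv i \<phi> x) \<le> norm (u x * partial_deriv i \<phi> x)" for k
      using \<psi>(2) by (intro AE_I2) (simp add: abs_mult mult_right_mono)
  qed (use int intk in auto)
  moreover have "(\<lambda>k. LINT x|lebesgue. (\<rho> k (u x) *\<^sub>R g x) $ i * \<phi> x)
      \<longlonglongrightarrow> (LINT x|lebesgue. (if u x = 0 then 0 else g x) $ i * \<phi> x)"
  proof (rule integral_dominated_convergence[where w = "\<lambda>x. norm (g x $ i * \<phi> x)"])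
    have "(\<lambda>k. \<rho> k t * c) \<longlonglongrightarrow> (if t = 0 then 0 else c)" for t c
    proof (cases "t = 0")
      case False
      then show ?thesis
        using tendsto_mult[OF \<psi>(6)[OF False] tendsto_const[of c]] by simp
    qed (simp add: \<psi>(4))
    then show "AE x in lebesgue. (\<lambda>k. (\<rho> k (u x) *\<^sub>R g x) $ i * \<phi> x)
        \<longlonglongrightarrow> (if u x = 0 then 0 else g x) $ i * \<phi> x"
      by (intro AE_I2 tendsto_mult tendsto_const) (simp add: if_distrib[of "\<lambda>v. v $ i"] cong: if_cong)
    show "AE x in lebesgue. norm ((\<rho> k (u x) *\<^sub>R g x) $ i * \<phi> x) \<le> norm (g x $ i * \<phi> x)" for k
      using \<psi>(3) by (intro AE_I2) (simp add: abs_mult mult_right_mono mult_left_le_one_le)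
  qed (use int intk in auto)
  moreover have "(LINT x|lebesgue. \<psi> k (u x) * partial_deriv i \<phi> x)
      = - (LINT x|lebesgue. (\<rho> k (u x) *\<^sub>R g x) $ i * \<phi> x)" for k
    using wk[of k] \<phi> by (simp only: weak_gradient_iff[OF assms(1)])
  ultimately show "(LINT x|lebesgue. u x * partial_deriv i \<phi> x)
      = - (LINT x|lebesgue. (if u x = 0 then 0 else g x) $ i * \<phi> x)"
    using LIMSEQ_unique[OF _ tendsto_minus] by simp
qed

text \<open>The outer square makes the profile C^1 at |t| = 1. It is even, so the sign of its
  argument is irrelevant, and 1 - t^2 avoids the corner that 1 - |t| would have at 0.\<close>

definition tent :: "real \<Rightarrow> real" where "tent t = (max 0 (1 - t\<^sup>2))\<^sup>2"

definition tent_deriv :: "real \<Rightarrow> real" where "tent_deriv t = - 4 * t * max 0 (1 - t\<^sup>2)"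

lemma has_derivative_max_0_square:
  "((\<lambda>s::real. (max 0 s)\<^sup>2) has_field_derivative 2 * max 0 s) (at s)"
proof -
  consider "s > 0" | "s < 0" | "s = 0"
    by linarith
  then show ?thesis
  proof cases
    case 1
    have "eventually (\<lambda>t. t \<in> {0<..}) (nhds s)"
      using 1 by (intro eventually_nhds_in_open) auto
    then have "eventually (\<lambda>t. (max 0 t)\<^sup>2 = t\<^sup>2) (nhds s)"
      by eventually_elim auto
    then show ?thesis
      by (subst DERIV_cong_ev[OF refl _ refl]) (use 1 in \<open>auto intro!: derivative_eq_intros\<close>)
  next
    case 2
    have "eventually (\<lambda>t. t \<in> {..<0}) (nhds s)"
      using 2 by (intro eventually_nhds_in_open) auto
    then have "eventually (\<lambda>t. (max 0 t)\<^sup>2 = 0) (nhds s)"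
      by eventually_elim auto
    from DERIV_cong_ev[OF refl this refl, of 0] show ?thesis
      using 2 by simp
  next
    case 3
    have "((\<lambda>h::real. (max 0 h)\<^sup>2 / h) \<longlongrightarrow> 0) (at 0)"
    proof (rule Lim_null_comparison)
      show "eventually (\<lambda>h. norm ((max 0 h)\<^sup>2 / h) \<le> \<bar>h\<bar>) (at (0::real))"
        by (intro always_eventually allI) (auto simp: max_def power2_eq_square)
      show "((\<lambda>h::real. \<bar>h\<bar>) \<longlongrightarrow> 0) (at 0)"
        by (rule tendsto_rabs_zero[OF tendsto_ident_at])
    qed
    then show ?thesis
      using 3 by (simp add: has_field_derivative_iff)
  qed
qed

lemma tent_bounds: "0 \<le> tent t" "tent t \<le> 1" "\<bar>tent_deriv t\<bar> \<le> 4"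
proof -
  have "max 0 (1 - t\<^sup>2) \<le> 1"
    by simp
  then show "0 \<le> tent t" "tent t \<le> 1"
    by (auto simp: tent_def power_le_one)
  show "\<bar>tent_deriv t\<bar> \<le> 4"
  proof (cases "\<bar>t\<bar> \<le> 1")
    case True
    then have "\<bar>t\<bar> * max 0 (1 - t\<^sup>2) \<le> 1 * 1"
      by (intro mult_mono) auto
    then show ?thesis
      by (simp add: tent_deriv_def abs_mult)
  next
    case False
    then have "1 - t\<^sup>2 \<le> 0"
      using abs_square_le_1[of t] by linarith
    then show ?thesis
      by (simp add: tent_deriv_def)
  qed
qed

lemma tent_has_derivative: "(tent has_field_derivative tent_deriv t) (at t within S)"
proof -
  have "((\<lambda>t::real. 1 - t\<^sup>2) has_field_derivative - (2 * t)) (at t)"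
    by (auto intro!: derivative_eq_intros)
  from DERIV_chain2[OF has_derivative_max_0_square this]
  have "(tent has_field_derivative tent_deriv t) (at t)"
    by (simp add: tent_def[abs_def] tent_deriv_def mult_ac)
  then show ?thesis
    by (rule has_field_derivative_at_within)
qed

lemma bounded_C1_tent: "bounded_C1 tent tent_deriv"
  unfolding bounded_C1_def
proof (intro conjI allI exI[of _ 4])
  show "continuous_on UNIV tent_deriv"
    unfolding tent_deriv_def by (intro continuous_intros)
  show "\<bar>tent t\<bar> \<le> 4" "\<bar>tent_deriv t\<bar> \<le> 4" for t
    using tent_bounds[of t] by auto
qed (rule tent_has_derivative)

lemma tent_eq_0: "1 \<le> \<bar>t\<bar> \<Longrightarrow> tent t = 0" "1 \<le> \<bar>t\<bar> \<Longrightarrow> tent_deriv t = 0"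
  using one_le_power[of "\<bar>t\<bar>" 2] by (auto simp: tent_def tent_deriv_def)

text \<open>The mean value inequality with the bound 4 for the derivative. It bounds the modular of
  1 - tent(w) by a multiple of that of w.\<close>

lemma one_minus_tent_le: "\<bar>1 - tent t\<bar> \<le> 4 * \<bar>t\<bar>"
proof -
  have "tent 0 = 1"
    by (simp add: tent_def)
  then show ?thesis
    using field_differentiable_bound[of UNIV tent tent_deriv 4 0 t] tent_has_derivative tent_bounds(3)
    by auto
qed

lemma isCont_tent: "isCont tent t"
  using tent_has_derivative DERIV_isCont by blast

section \<open>Modulars\<close>

text \<open>The logarithm in the log-Hoelder condition is at least 1, so comparing x with 0 gives
  p(x) \<le> p(0) + L. The bound holds at every point, which keeps exceptional null sets out of the
  modular estimates.\<close>

lemma admissible_exponent_bounds: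
  assumes "admissible_exponent p"
  obtains M where "\<And>x. 1 \<le> real_of_ereal (p x)" "\<And>x. real_of_ereal (p x) \<le> M"
    "(\<lambda>x. real_of_ereal (p x)) \<in> borel_measurable lebesgue"
proof -
  define P where "P x = real_of_ereal (p x)" for x
  have P: "p x = ereal (P x)" for x
    using admissible_exponent_finite[OF assms, of x] by (simp add: P_def ereal_real)
  obtain L where L: "L > 0" "\<And>x y. \<bar>p x - p y\<bar> \<le> ereal (L / ln (exp 1 + 1 / dist x y))"
    using assms unfolding admissible_exponent_def log_holder_def by auto
  have "P x \<le> P 0 + L" for x
  proof -
    have "ln (exp 1 + 1 / dist x 0) \<ge> ln (exp 1)"
      by (subst ln_le_cancel_iff) (auto intro: add_pos_nonneg)
    then have "L / ln (exp 1 + 1 / dist x 0) \<le> L"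
      using L(1) by (simp add: field_simps)
    then show ?thesis
      using L(2)[of x 0] by (simp add: P)
  qed
  moreover have "1 \<le> P x" for x
    using assms P[of x] by (metis admissible_exponent_def ereal_less_eq(3) one_ereal_def)
  moreover have "P \<in> borel_measurable lebesgue"
    using assms unfolding P_def[abs_def] admissible_exponent_def by (intro borel_measurable_real_of_ereal) auto
  ultimately show ?thesis
    using that[of "P 0 + L"] by (auto simp: P_def[abs_def])
qed

lemma lebesgue_on_measurable_subset:
  "f \<in> borel_measurable lebesgue \<Longrightarrow> f \<in> borel_measurable (lebesgue_on S)"
  by (rule measurable_restrict_space1)

locale bounded_exponent =
  fixes p :: "'a::euclidean_space \<Rightarrow> ereal" and M :: real
  assumes p_ge_1: "\<And>x. 1 \<le> real_of_ereal (p x)" and p_le: "\<And>x. real_of_ereal (p x) \<le> M"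
    and p_measurable: "(\<lambda>x. real_of_ereal (p x)) \<in> borel_measurable lebesgue"
begin

lemma p_pos: "0 < real_of_ereal (p x)"
  using p_ge_1[of x] by linarith

lemma M_ge_1: "1 \<le> M"
  using p_ge_1[of undefined] p_le[of undefined] by linarith

lemma p_measurable_on [measurable]: "(\<lambda>x. real_of_ereal (p x)) \<in> borel_measurable (lebesgue_on S)"
  using p_measurable by (rule lebesgue_on_measurable_subset)

lemma modular_mono:
  assumes "AE x in lebesgue_on \<Omega>. norm (f x) \<le> norm (g x)"
  shows "modular p \<Omega> f \<le> modular p \<Omega> g"
  unfolding modular_def
  using assms p_pos
  by (intro nn_integral_mono_AE) (auto elim!: eventually_mono intro!: ennreal_leI powr_mono2 less_imp_le[OF p_pos])

text \<open>The modular is not homogeneous; for c \<ge> 1 the factor c^p(x) is at most c^M. The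
  codomains may differ, so that vector fields can be compared with scalar functions.\<close>

lemma modular_cmult_le:
  fixes f :: "'a \<Rightarrow> 'b::euclidean_space" and g :: "'a \<Rightarrow> 'c::euclidean_space"
  assumes "c \<ge> 1" and [measurable]: "g \<in> borel_measurable (lebesgue_on \<Omega>)"
    and le: "AE x in lebesgue_on \<Omega>. norm (f x) \<le> c * norm (g x)"
  shows "modular p \<Omega> f \<le> ennreal (c powr M) * modular p \<Omega> g"
proof -
  have "modular p \<Omega> f \<le> (\<integral>\<^sup>+x. ennreal (c powr M) * ennreal (norm (g x) powr real_of_ereal (p x)) \<partial>lebesgue_on \<Omega>)"
    unfolding modular_def
  proof (intro nn_integral_mono_AE, use le in eventually_elim)
    fix x
    assume x: "norm (f x) \<le> c * norm (g x)"
    have "norm (f x) powr real_of_ereal (p x) \<le> (c * norm (g x)) powr real_of_ereal (p x)"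
      using x less_imp_le[OF p_pos] by (intro powr_mono2) auto
    also have "\<dots> = c powr real_of_ereal (p x) * norm (g x) powr real_of_ereal (p x)"
      by (rule powr_mult)
    also have "\<dots> \<le> c powr M * norm (g x) powr real_of_ereal (p x)"
      using assms(1) p_le by (intro mult_right_mono powr_mono) auto
    finally show "ennreal (norm (f x) powr real_of_ereal (p x))
        \<le> ennreal (c powr M) * ennreal (norm (g x) powr real_of_ereal (p x))"
      by (simp add: ennreal_mult[symmetric] ennreal_leI)
  qed
  also have "\<dots> = ennreal (c powr M) * modular p \<Omega> g"
    unfolding modular_def by (rule nn_integral_cmult) measurable
  finally show ?thesis .
qed

text \<open>Pointwise a + b \<le> 2 max(a, b), and the p-th power of the maximum is at most the sum
  of the p-th powers.\<close>

lemma modular_add_le: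
  fixes g h :: "'a \<Rightarrow> 'b::euclidean_space"
  assumes [measurable]: "g \<in> borel_measurable (lebesgue_on \<Omega>)" "h \<in> borel_measurable (lebesgue_on \<Omega>)"
    and le: "AE x in lebesgue_on \<Omega>. norm (f x) \<le> norm (g x) + norm (h x)"
  shows "modular p \<Omega> f \<le> ennreal (2 powr M) * (modular p \<Omega> g + modular p \<Omega> h)"
proof -
  have "modular p \<Omega> f \<le> (\<integral>\<^sup>+x. ennreal (2 powr M) * (ennreal (norm (g x) powr real_of_ereal (p x))
      + ennreal (norm (h x) powr real_of_ereal (p x))) \<partial>lebesgue_on \<Omega>)"
    unfolding modular_def
  proof (intro nn_integral_mono_AE, use le in eventually_elim)
    fix x
    assume x: "norm (f x) \<le> norm (g x) + norm (h x)"
    define a b P where "a = norm (g x)" "b = norm (h x)" "P = real_of_ereal (p x)"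
    have ab: "0 \<le> a" "0 \<le> b" "norm (f x) \<le> 2 * max a b"
      using x by (auto simp: a_b_P_def)
    have "norm (f x) powr P \<le> (2 * max a b) powr P"
      using ab p_pos[of x] by (intro powr_mono2) (auto simp: a_b_P_def)
    also have "\<dots> = 2 powr P * max a b powr P"
      by (rule powr_mult)
    also have "\<dots> \<le> 2 powr M * (a powr P + b powr P)"
      using p_le[of x] by (intro mult_mono powr_mono) (auto simp: a_b_P_def max_def)
    finally show "ennreal (norm (f x) powr real_of_ereal (p x)) \<le> ennreal (2 powr M) *
        (ennreal (norm (g x) powr real_of_ereal (p x)) + ennreal (norm (h x) powr real_of_ereal (p x)))"
      by (simp add: a_b_P_def ennreal_mult[symmetric] ennreal_plus[symmetric] ennreal_leI del: ennreal_plus)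
  qed
  also have "\<dots> = ennreal (2 powr M) * (modular p \<Omega> g + modular p \<Omega> h)"
    unfolding modular_def by (subst nn_integral_cmult) (auto simp: nn_integral_add)
  finally show ?thesis .
qed

text \<open>Since p \<ge> 1 and 1/l \<le> 1, the power (1/l)^p is at most 1/l.\<close>

lemma modular_divide_le:
  fixes f :: "'a \<Rightarrow> 'b::euclidean_space"
  assumes "l \<ge> 1" and [measurable]: "f \<in> borel_measurable (lebesgue_on \<Omega>)"
  shows "modular p \<Omega> (\<lambda>x. f x /\<^sub>R l) \<le> ennreal (1 / l) * modular p \<Omega> f"
proof -
  have "modular p \<Omega> (\<lambda>x. f x /\<^sub>R l)
      \<le> (\<integral>\<^sup>+x. ennreal (1 / l) * ennreal (norm (f x) powr real_of_ereal (p x)) \<partial>lebesgue_on \<Omega>)"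
    unfolding modular_def
  proof (intro nn_integral_mono)
    fix x
    have "norm (f x /\<^sub>R l) powr real_of_ereal (p x)
        = (1 / l) powr real_of_ereal (p x) * norm (f x) powr real_of_ereal (p x)"
      using assms(1) by (subst powr_mult[symmetric]) (auto simp: field_simps)
    also have "\<dots> \<le> (1 / l) powr 1 * norm (f x) powr real_of_ereal (p x)"
      using assms(1) p_ge_1 by (intro mult_right_mono powr_mono') auto
    finally show "ennreal (norm (f x /\<^sub>R l) powr real_of_ereal (p x))
        \<le> ennreal (1 / l) * ennreal (norm (f x) powr real_of_ereal (p x))"
      using assms(1) by (simp add: ennreal_mult[symmetric] ennreal_leI)
  qed
  also have "\<dots> = ennreal (1 / l) * modular p \<Omega> f"
    unfolding modular_def by (rule nn_integral_cmult) measurable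
  finally show ?thesis .
qed

text \<open>Rescaling by l changes the modular by at most max(1, l)^M, so a finite norm forces a
  finite modular; this direction fails for unbounded exponents.\<close>

lemma Lp_var_iff:
  fixes f :: "'a \<Rightarrow> 'b::euclidean_space"
  shows "f \<in> Lp_var p \<Omega> \<longleftrightarrow> f \<in> borel_measurable (lebesgue_on \<Omega>) \<and> modular p \<Omega> f < \<infinity>"
proof -
  have "luxemburg_norm p \<Omega> f < \<infinity> \<longleftrightarrow> modular p \<Omega> f < \<infinity>"
    if [measurable]: "f \<in> borel_measurable (lebesgue_on \<Omega>)"
  proof
    assume "luxemburg_norm p \<Omega> f < \<infinity>"
    then obtain l where l: "0 < l" "modular p \<Omega> (\<lambda>x. f x /\<^sub>R l) \<le> 1"
      unfolding luxemburg_norm_def by (auto simp: Inf_less_iff)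
    have "modular p \<Omega> f \<le> ennreal (max 1 l powr M) * modular p \<Omega> (\<lambda>x. f x /\<^sub>R l)"
    proof (intro modular_cmult_le AE_I2)
      fix x
      have "norm (f x) = l * norm (f x /\<^sub>R l)"
        using l by simp
      also have "\<dots> \<le> max 1 l * norm (f x /\<^sub>R l)"
        by (intro mult_right_mono) auto
      finally show "norm (f x) \<le> max 1 l * norm (f x /\<^sub>R l)" .
    qed auto
    also have "\<dots> \<le> ennreal (max 1 l powr M) * 1"
      by (intro mult_left_mono l) auto
    finally show "modular p \<Omega> f < \<infinity>"
      by (simp add: order.strict_trans1[OF _ ennreal_less_top])
  next
    assume fin: "modular p \<Omega> f < \<infinity>"
    then obtain m where m: "modular p \<Omega> f = ennreal m" "0 \<le> m"
      by (cases "modular p \<Omega> f") auto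
    \<comment> \<open>The maximum secures both l \<ge> 1 and m / l \<le> 1.\<close>
    define l where "l = max 1 m"
    have "modular p \<Omega> (\<lambda>x. f x /\<^sub>R l) \<le> ennreal (1 / l) * ennreal m"
      using modular_divide_le[of l f \<Omega>] m by (simp add: l_def)
    also have "\<dots> = ennreal (m / l)"
      using m by (simp add: ennreal_mult[symmetric] l_def)
    also have "\<dots> \<le> 1"
      by (simp add: l_def max_def)
    finally have "luxemburg_norm p \<Omega> f \<le> ennreal l"
      unfolding luxemburg_norm_def by (intro Inf_lower) (auto simp: l_def)
    then show "luxemburg_norm p \<Omega> f < \<infinity>"
      by (simp add: order.strict_trans1[OF _ ennreal_less_top])
  qed
  then show ?thesis
    unfolding Lp_var_def by auto
qed

text \<open>Dividing by l \<le> 1 multiplies the modular by at most l^-M, so a modular of at most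
  l^M becomes at most 1. This quantifies that modular convergence implies norm convergence.\<close>

lemma luxemburg_norm_le:
  fixes f :: "'a \<Rightarrow> 'b::euclidean_space"
  assumes l: "0 < l" "l \<le> 1" and [measurable]: "f \<in> borel_measurable (lebesgue_on \<Omega>)"
    and le: "modular p \<Omega> f \<le> ennreal (l powr M)"
  shows "luxemburg_norm p \<Omega> f \<le> ennreal l"
proof -
  have "modular p \<Omega> (\<lambda>x. f x /\<^sub>R l) \<le> ennreal ((1 / l) powr M) * modular p \<Omega> f"
    using l by (intro modular_cmult_le AE_I2) (auto simp: field_simps)
  also have "\<dots> \<le> ennreal ((1 / l) powr M) * ennreal (l powr M)"
    by (intro mult_left_mono le) auto
  also have "\<dots> = 1"
    using l by (simp add: ennreal_mult[symmetric] powr_mult[symmetric])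
  finally show ?thesis
    unfolding luxemburg_norm_def using l by (intro Inf_lower) auto
qed

lemma luxemburg_norm_tendsto_0:
  fixes f :: "nat \<Rightarrow> 'a \<Rightarrow> 'b::euclidean_space"
  assumes meas: "\<And>k. f k \<in> borel_measurable (lebesgue_on \<Omega>)"
    and lim: "(\<lambda>k. modular p \<Omega> (f k)) \<longlonglongrightarrow> 0"
  shows "(\<lambda>k. luxemburg_norm p \<Omega> (f k)) \<longlonglongrightarrow> 0"
proof (rule order_tendstoI)
  fix e :: ennreal
  assume "0 < e"
  then have "0 < min e 1"
    by simp
  then obtain c where c: "0 < c" "c < min e 1"
    using dense by blast
  then obtain l where l: "c = ennreal l" "0 < l" "l < 1"
    by (cases c) (auto simp: ennreal_less_one_iff)
  have "eventually (\<lambda>k. modular p \<Omega> (f k) < ennreal (l powr M)) sequentially"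
    using l by (intro order_tendstoD(2)[OF lim]) auto
  then show "eventually (\<lambda>k. luxemburg_norm p \<Omega> (f k) < e) sequentially"
  proof eventually_elim
    case (elim k)
    have "luxemburg_norm p \<Omega> (f k) \<le> ennreal l"
      using elim l by (intro luxemburg_norm_le meas) auto
    then show ?case
      using c l by (auto intro: order.strict_trans1)
  qed
qed auto

lemma modular_tendsto_0_dominated:
  fixes f :: "nat \<Rightarrow> 'a \<Rightarrow> 'b::euclidean_space" and F :: "'a \<Rightarrow> 'c::euclidean_space"
  assumes [measurable]: "\<And>k. f k \<in> borel_measurable (lebesgue_on \<Omega>)" "F \<in> borel_measurable (lebesgue_on \<Omega>)"
    and lim: "AE x in lebesgue_on \<Omega>. (\<lambda>k. f k x) \<longlonglongrightarrow> 0"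
    and le: "\<And>k. AE x in lebesgue_on \<Omega>. norm (f k x) \<le> norm (F x)"
    and fin: "modular p \<Omega> F < \<infinity>"
  shows "(\<lambda>k. modular p \<Omega> (f k)) \<longlonglongrightarrow> 0"
proof -
  have "(\<lambda>k. modular p \<Omega> (f k)) \<longlonglongrightarrow> (\<integral>\<^sup>+(x::'a). 0 \<partial>lebesgue_on \<Omega>)"
    unfolding modular_def
  proof (rule nn_integral_dominated_convergence[where u' = "\<lambda>_. 0"
        and w = "\<lambda>x. ennreal (norm (F x) powr real_of_ereal (p x))"])
    show "AE x in lebesgue_on \<Omega>. ennreal (norm (f k x) powr real_of_ereal (p x))
        \<le> ennreal (norm (F x) powr real_of_ereal (p x))" for k
      using le[of k] by eventually_elim (auto intro!: ennreal_leI powr_mono2 less_imp_le[OF p_pos])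
    show "AE x in lebesgue_on \<Omega>. (\<lambda>k. ennreal (norm (f k x) powr real_of_ereal (p x))) \<longlonglongrightarrow> 0"
      using lim
    proof eventually_elim
      case (elim x)
      have "(\<lambda>k. norm (f k x)) \<longlonglongrightarrow> 0"
        using elim by (rule tendsto_norm_zero)
      then have "(\<lambda>k. norm (f k x) powr real_of_ereal (p x)) \<longlonglongrightarrow> 0"
        by (rule tendsto_zero_powrI[OF _ tendsto_const]) (use p_pos in auto)
      then show ?case
        using tendsto_ennrealI by fastforce
    qed
    show "(\<integral>\<^sup>+x. ennreal (norm (F x) powr real_of_ereal (p x)) \<partial>lebesgue_on \<Omega>) < \<infinity>"
      using fin by (simp add: modular_def)
  qed auto
  then show ?thesis
    by simp
qed

lemma Lp_var_bound:
  fixes f :: "'a \<Rightarrow> 'b::euclidean_space" and g :: "'a \<Rightarrow> 'c::euclidean_space"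
  assumes "g \<in> Lp_var p \<Omega>" "f \<in> borel_measurable (lebesgue_on \<Omega>)" "c \<ge> 1"
    "AE x in lebesgue_on \<Omega>. norm (f x) \<le> c * norm (g x)"
  shows "f \<in> Lp_var p \<Omega>"
proof -
  have "modular p \<Omega> f \<le> ennreal (c powr M) * modular p \<Omega> g"
    using assms by (intro modular_cmult_le) (auto simp: Lp_var_iff)
  also have "\<dots> < \<infinity>"
    using assms(1) by (simp add: Lp_var_iff ennreal_mult_less_top)
  finally show ?thesis
    using assms(2) by (simp add: Lp_var_iff)
qed

lemma Lp_var_add:
  fixes f g :: "'a \<Rightarrow> 'b::euclidean_space"
  assumes "f \<in> Lp_var p \<Omega>" "g \<in> Lp_var p \<Omega>"
  shows "(\<lambda>x. f x + g x) \<in> Lp_var p \<Omega>"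
proof -
  have "modular p \<Omega> (\<lambda>x. f x + g x) \<le> ennreal (2 powr M) * (modular p \<Omega> f + modular p \<Omega> g)"
    using assms by (intro modular_add_le AE_I2 norm_triangle_ineq) (auto simp: Lp_var_iff)
  also have "\<dots> < \<infinity>"
    using assms by (simp add: Lp_var_iff ennreal_mult_less_top)
  finally show ?thesis
    using assms by (auto simp: Lp_var_iff)
qed

section \<open>Passage between a measurable set and the whole space\<close>

lemma modular_extend_zero:
  fixes f :: "'a \<Rightarrow> 'b::euclidean_space"
  assumes "\<Omega> \<in> sets lebesgue"
  shows "modular p UNIV (\<lambda>x. indicator \<Omega> x *\<^sub>R f x) = modular p \<Omega> f"
proof -
  have "modular p \<Omega> f = (\<integral>\<^sup>+x. ennreal (norm (f x) powr real_of_ereal (p x)) * indicator \<Omega> x \<partial>lebesgue)"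
    unfolding modular_def using assms by (subst nn_integral_restrict_space) auto
  also have "\<dots> = modular p UNIV (\<lambda>x. indicator \<Omega> x *\<^sub>R f x)"
    unfolding modular_def lebesgue_on_UNIV_eq
    by (intro nn_integral_cong) (auto simp: indicator_def p_pos)
  finally show ?thesis ..
qed

lemma Lp_var_extend_zero:
  fixes f :: "'a \<Rightarrow> 'b::euclidean_space"
  assumes "\<Omega> \<in> sets lebesgue" "f \<in> Lp_var p \<Omega>"
  shows "(\<lambda>x. indicator \<Omega> x *\<^sub>R f x) \<in> Lp_var p UNIV"
  using assms
  by (simp add: Lp_var_iff modular_extend_zero lebesgue_on_UNIV_eq borel_measurable_restrict_space_iff)

lemma modular_le_UNIV:
  fixes f :: "'a \<Rightarrow> 'b::euclidean_space"
  assumes "\<Omega> \<in> sets lebesgue"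
  shows "modular p \<Omega> f \<le> modular p UNIV f"
  unfolding modular_extend_zero[OF assms, symmetric]
  by (intro modular_mono AE_I2) (auto simp: indicator_def)

lemma Lp_var_restrict:
  fixes f :: "'a \<Rightarrow> 'b::euclidean_space"
  assumes "\<Omega> \<in> sets lebesgue" "f \<in> Lp_var p UNIV"
  shows "f \<in> Lp_var p \<Omega>"
  using assms modular_le_UNIV[OF assms(1), of f]
  by (auto simp: Lp_var_iff lebesgue_on_UNIV_eq intro: lebesgue_on_measurable_subset order.strict_trans1)

end

section \<open>Capacity\<close>

lemma norm_le_sum_add:
  fixes a b :: "'a::real_normed_vector"
  shows "norm a \<le> x \<Longrightarrow> norm b \<le> y \<Longrightarrow> norm (a + b) \<le> x + y"
  using norm_triangle_ineq[of a b] by linarith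

locale bounded_exponent_vec = bounded_exponent p M
  for p :: "real^'n \<Rightarrow> ereal" and M :: real
begin

lemma capacity_witness:
  assumes "capacity p E < c"
  obtains w h V where "w \<in> Lp_var p UNIV" "h \<in> Lp_var p UNIV" "weak_gradient UNIV w h" "open V" "E \<subseteq> V"
    "AE x in lebesgue. x \<in> V \<longrightarrow> 1 \<le> w x" "modular p UNIV w + modular p UNIV h < c"
proof -
  obtain w h V where *: "w \<in> W1p p UNIV" "h \<in> Lp_var p UNIV" "weak_gradient UNIV w h" "open V" "E \<subseteq> V"
    "AE x in lebesgue. x \<in> V \<longrightarrow> 1 \<le> w x"
    and less: "(\<integral>\<^sup>+x. ennreal (\<bar>w x\<bar> powr real_of_ereal (p x) + norm (h x) powr real_of_ereal (p x)) \<partial>lebesgue) < c"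
    using assms unfolding capacity_def by (auto simp: Inf_less_iff)
  have w: "w \<in> Lp_var p UNIV"
    using *(1) by (simp add: W1p_def)
  have [measurable]: "w \<in> borel_measurable lebesgue" "h \<in> borel_measurable lebesgue"
    using w *(2) by (simp_all add: Lp_var_iff lebesgue_on_UNIV_eq)
  note [measurable] = p_measurable
  have "(\<integral>\<^sup>+x. ennreal (\<bar>w x\<bar> powr real_of_ereal (p x) + norm (h x) powr real_of_ereal (p x)) \<partial>lebesgue)
      = (\<integral>\<^sup>+x. ennreal (\<bar>w x\<bar> powr real_of_ereal (p x)) + ennreal (norm (h x) powr real_of_ereal (p x)) \<partial>lebesgue)"
    by (intro nn_integral_cong) simp
  also have "\<dots> = modular p UNIV w + modular p UNIV h"
    unfolding modular_def lebesgue_on_UNIV_eq by (subst nn_integral_add) auto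
  finally show ?thesis
    using that[OF w *(2-6)] less by simp
qed

text \<open>Subadditivity of capacity in the form required: one test function covers the set where
  continuity fails and the null set where the boundary values may be wrong. A plain sum of test
  functions could drop below 1 where one of them is negative, so each is replaced by \<theta>(w) = 1
  - tent(w), which is nonnegative and equals 1 where w \<ge> 1.\<close>

lemma capacity_zero_union_witness:
  assumes E: "capacity p E < ennreal (d / (2 * 8 powr M))" and N: "capacity p N = 0" and "d > 0"
  obtains w h V where "w \<in> Lp_var p UNIV" "h \<in> Lp_var p UNIV" "weak_gradient UNIV w h" "open V" "E \<union> N \<subseteq> V"
    "AE x in lebesgue. x \<in> V \<longrightarrow> 1 \<le> w x" "modular p UNIV w \<le> ennreal d" "modular p UNIV h \<le> ennreal d"
proof -
  \<comment> \<open>\<open>2 powr M\<close> comes from adding two functions, \<open>4 powr M\<close>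
    from the bounds |\<theta>(t)| \<le> 4|t| and |\<theta>'| \<le> 4, and the remaining 2 from the
    two equal summands.\<close>
  define c where "c = d / (2 * 8 powr M)"
  have c: "c > 0"
    using \<open>d > 0\<close> by (simp add: c_def)
  obtain w1 h1 V1 where 1: "w1 \<in> Lp_var p UNIV" "h1 \<in> Lp_var p UNIV" "weak_gradient UNIV w1 h1" "open V1"
    "E \<subseteq> V1" "AE x in lebesgue. x \<in> V1 \<longrightarrow> 1 \<le> w1 x" "modular p UNIV w1 + modular p UNIV h1 < ennreal c"
    using capacity_witness[OF E[folded c_def]] .
  have "capacity p N < ennreal c"
    using N c by simp
  then obtain w2 h2 V2 where 2: "w2 \<in> Lp_var p UNIV" "h2 \<in> Lp_var p UNIV" "weak_gradient UNIV w2 h2" "open V2"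
    "N \<subseteq> V2" "AE x in lebesgue. x \<in> V2 \<longrightarrow> 1 \<le> w2 x" "modular p UNIV w2 + modular p UNIV h2 < ennreal c"
    by (rule capacity_witness)
  define \<theta> where "\<theta> t = 1 - tent t" for t
  define \<theta>' where "\<theta>' t = - tent_deriv t" for t
  have \<theta>: "bounded_C1 \<theta> \<theta>'"
    unfolding bounded_C1_def
  proof (intro conjI allI exI[of _ 4])
    show "(\<theta> has_field_derivative \<theta>' t) (at t)" for t
      using DERIV_diff[OF DERIV_const tent_has_derivative, of 1 t UNIV] by (simp add: \<theta>_def[abs_def] \<theta>'_def)
    show "continuous_on UNIV \<theta>'"
      using bounded_C1_tent unfolding bounded_C1_def \<theta>'_def by (auto intro: continuous_on_minus)
    show "\<bar>\<theta> t\<bar> \<le> 4" "\<bar>\<theta>' t\<bar> \<le> 4" for t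
      using tent_bounds[of t] by (auto simp: \<theta>_def \<theta>'_def)
  qed
  define w where "w x = 1 * \<theta> (w1 x) + 1 * \<theta> (w2 x)" for x
  define h where "h x = 1 *\<^sub>R \<theta>' (w1 x) *\<^sub>R h1 x + 1 *\<^sub>R \<theta>' (w2 x) *\<^sub>R h2 x" for x
  note [measurable] = bounded_C1_measurable[OF \<theta>]
  have m [measurable]: "w1 \<in> borel_measurable lebesgue" "h1 \<in> borel_measurable lebesgue"
    "w2 \<in> borel_measurable lebesgue" "h2 \<in> borel_measurable lebesgue"
    using 1 2 by (simp_all add: Lp_var_iff lebesgue_on_UNIV_eq)
  have mw: "w \<in> borel_measurable lebesgue" "h \<in> borel_measurable lebesgue"
    unfolding w_def h_def by measurable
  have bound: "modular p UNIV f \<le> ennreal d"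
    if f: "\<And>x. norm (f x) \<le> norm (4 *\<^sub>R norm (a x)) + norm (4 *\<^sub>R norm (b x))"
      and [measurable]: "a \<in> borel_measurable lebesgue" "b \<in> borel_measurable lebesgue"
      and ab: "modular p UNIV a \<le> ennreal c" "modular p UNIV b \<le> ennreal c"
    for f a b :: "real^'n \<Rightarrow> 'b::euclidean_space"
  proof -
    have 4: "modular p UNIV (\<lambda>x. 4 *\<^sub>R norm (g x)) \<le> ennreal (4 powr M) * modular p UNIV g"
      if "g \<in> borel_measurable lebesgue" for g :: "real^'n \<Rightarrow> 'b"
      using that by (intro modular_cmult_le) (auto simp: lebesgue_on_UNIV_eq)
    have "modular p UNIV f \<le> ennreal (2 powr M) *
        (modular p UNIV (\<lambda>x. 4 *\<^sub>R norm (a x)) + modular p UNIV (\<lambda>x. 4 *\<^sub>R norm (b x)))"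
      using f by (intro modular_add_le AE_I2) (auto simp: lebesgue_on_UNIV_eq)
    also have "\<dots> \<le> ennreal (2 powr M) * (ennreal (4 powr M) * ennreal c + ennreal (4 powr M) * ennreal c)"
      using that by (intro mult_left_mono add_mono order_trans[OF 4]) auto
    also have "\<dots> = ennreal (2 powr M * (4 powr M * c + 4 powr M * c))"
      using c by (simp add: ennreal_mult[symmetric] ennreal_plus[symmetric] del: ennreal_plus)
    also have "2 powr M * (4 powr M * c + 4 powr M * c) = d"
      using powr_mult[of 2 4 M] by (simp add: c_def field_simps)
    finally show ?thesis .
  qed
  have le: "modular p UNIV w1 \<le> ennreal c" "modular p UNIV w2 \<le> ennreal c"
    "modular p UNIV h1 \<le> ennreal c" "modular p UNIV h2 \<le> ennreal c"
  proof -
    have "a \<le> e \<and> b \<le> e" if "a + b < e" for a b e :: ennreal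
    proof -
      have "a \<le> a + b" "b \<le> a + b"
        by simp_all
      then show ?thesis
        using that by (meson less_imp_le order_trans)
    qed
    from this[OF 1(7)] this[OF 2(7)]
    show "modular p UNIV w1 \<le> ennreal c" "modular p UNIV w2 \<le> ennreal c"
      "modular p UNIV h1 \<le> ennreal c" "modular p UNIV h2 \<le> ennreal c"
      by simp_all
  qed
  have mod: "modular p UNIV w \<le> ennreal d" "modular p UNIV h \<le> ennreal d"
  proof -
    show "modular p UNIV w \<le> ennreal d"
    proof (rule bound[OF _ m(1,3) le(1,2)])
      show "norm (w x) \<le> norm (4 *\<^sub>R norm (w1 x)) + norm (4 *\<^sub>R norm (w2 x))" for x
        using one_minus_tent_le[of "w1 x"] one_minus_tent_le[of "w2 x"] by (simp add: w_def \<theta>_def)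
    qed
    show "modular p UNIV h \<le> ennreal d"
    proof (rule bound[OF _ m(2,4) le(3,4)])
      show "norm (h x) \<le> norm (4 *\<^sub>R norm (h1 x)) + norm (4 *\<^sub>R norm (h2 x))" for x
        unfolding h_def using tent_bounds(3)
        by (intro norm_le_sum_add) (auto simp: \<theta>'_def intro!: mult_right_mono)
    qed
  qed
  show ?thesis
  proof (rule that[of w h "V1 \<union> V2"])
    show "w \<in> Lp_var p UNIV" "h \<in> Lp_var p UNIV"
      using mw mod by (auto simp: Lp_var_iff lebesgue_on_UNIV_eq intro: order.strict_trans1)
    show "weak_gradient UNIV w h"
      unfolding w_def h_def
      by (intro weak_gradient_lincomb weak_gradient_comp[OF _ _ \<theta>] 1 2 open_UNIV)
    show "AE x in lebesgue. x \<in> V1 \<union> V2 \<longrightarrow> 1 \<le> w x"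
      using 1(6) 2(6)
    proof eventually_elim
      case (elim x)
      have "1 \<le> w x" if "x \<in> V1"
        using elim that tent_eq_0(1)[of "w1 x"] tent_bounds(2)[of "w2 x"] by (simp add: w_def \<theta>_def)
      moreover have "1 \<le> w x" if "x \<in> V2"
        using elim that tent_eq_0(1)[of "w2 x"] tent_bounds(2)[of "w1 x"] by (simp add: w_def \<theta>_def)
      ultimately show ?case
        by blast
    qed
  qed (use 1 2 mod in auto)
qed

end

section \<open>Approximation by compactly supported functions\<close>

text \<open>These factors give bounded support when \<Omega> is unbounded. They tend to 1 pointwise
  without being 1 on balls, which suffices for dominated convergence.\<close>

definition cutoff :: "nat \<Rightarrow> real^'n \<Rightarrow> real" where
  "cutoff k x = bump ((1 / real (Suc k)) *\<^sub>R x)"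

lemma cutoff_test_function: "cutoff k \<in> test_functions UNIV"
  unfolding cutoff_def by (rule bump_scaled_test_function) simp

lemma cutoff_bounds: "0 \<le> cutoff k x" "cutoff k x \<le> 1"
  by (simp_all add: cutoff_def bump_nonneg bump_le_1)

lemma cutoff_eq_0: "x \<notin> cball 0 (real (Suc k)) \<Longrightarrow> cutoff k x = 0"
  unfolding cutoff_def by (intro bump_eq_0) (simp add: field_simps)

lemma grad_cutoff_eq_0:
  assumes "x \<notin> cball 0 (real (Suc k))"
  shows "grad (cutoff k) x = 0"
proof -
  have "partial_deriv i (cutoff k) x = 0" for i
    by (rule partial_deriv_eq_0[OF closed_cball _ assms]) (rule cutoff_eq_0)
  then show ?thesis
    by (simp add: vec_eq_iff)
qed

lemma cutoff_tendsto:
  fixes x :: "real^'n"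
  shows "(\<lambda>k. cutoff k x) \<longlonglongrightarrow> 1"
proof -
  have lim: "(\<lambda>k. inverse (real (Suc k)) *\<^sub>R x) \<longlonglongrightarrow> 0"
    using tendsto_scaleR[OF LIMSEQ_inverse_real_of_nat tendsto_const[of x]] by simp
  have "C_k 0 (bump :: real^'n \<Rightarrow> real)"
    by (rule C_k_bump)
  then have "isCont bump (0 :: real^'n)"
    by (simp add: continuous_on_eq_continuous_at)
  from isCont_tendsto_compose[OF this lim]
  have "(\<lambda>k. bump (inverse (real (Suc k)) *\<^sub>R x)) \<longlonglongrightarrow> bump (0 :: real^'n)" .
  then show ?thesis
    by (simp add: cutoff_def bump_zero inverse_eq_divide)
qed

text \<open>Dilating by k + 1 divides the gradient by k + 1, which makes the term with the gradient
  of the cutoff vanish in the limit.\<close>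

lemma grad_cutoff_bound:
  obtains D where "D > 0" "\<And>k x. norm (grad (cutoff k) (x :: real^'n)) \<le> D / real (Suc k)"
proof -
  have "C_k 1 (bump :: real^'n \<Rightarrow> real)"
    by (rule C_k_bump)
  then have b: "(bump :: real^'n \<Rightarrow> real) differentiable (at x)" for x
    by simp
  have "partial_deriv i bump x = 0" if "x \<notin> cball 0 1" for x :: "real^'n" and i
    by (rule partial_deriv_eq_0[OF closed_cball[of 0 1] _ that]) (auto intro: bump_eq_0)
  then have "grad bump x = 0" if "x \<notin> cball 0 1" for x :: "real^'n"
    using that by (simp add: vec_eq_iff)
  then obtain D where D: "D > 0" "\<And>x. norm (grad bump (x :: real^'n)) \<le> D"
    using compact_support_bounded[OF compact_cball continuous_grad[OF C_k_bump]] by metis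
  have "grad (cutoff k) x = (1 / real (Suc k)) *\<^sub>R grad bump ((1 / real (Suc k)) *\<^sub>R x)" for k and x :: "real^'n"
    using partial_deriv_comp_affine[OF b, where a = 0 and c = "1 / real (Suc k)"]
    by (simp add: vec_eq_iff cutoff_def[abs_def])
  then have "norm (grad (cutoff k) x) \<le> D / real (Suc k)" for k and x :: "real^'n"
    using D(2) by (simp add: divide_right_mono)
  with D(1) show ?thesis
    using that by blast
qed

text \<open>A single explicit weak gradient of the difference bounds the infimum that defines
  \<open>W1p_norm\<close>.\<close>

lemma W1p0_I:
  assumes "u \<in> W1p p \<Omega>"
    and "\<And>\<epsilon>. \<epsilon> > 0 \<Longrightarrow> \<exists>v h. v \<in> W1p p UNIV \<and> compact_support_in \<Omega> v \<and>
      weak_gradient \<Omega> (\<lambda>x. u x - v x) h \<and> luxemburg_norm p \<Omega> (\<lambda>x. u x - v x) + luxemburg_norm p \<Omega> h < \<epsilon>"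
  shows "u \<in> W1p0 p \<Omega>"
  unfolding W1p0_def
proof (intro CollectI conjI allI impI assms(1))
  fix \<epsilon> :: ennreal
  assume "\<epsilon> > 0"
  from assms(2)[OF this] obtain v h where *: "v \<in> W1p p UNIV" "compact_support_in \<Omega> v"
      "weak_gradient \<Omega> (\<lambda>x. u x - v x) h"
      "luxemburg_norm p \<Omega> (\<lambda>x. u x - v x) + luxemburg_norm p \<Omega> h < \<epsilon>"
    by blast
  have "W1p_norm p \<Omega> (\<lambda>x. u x - v x) \<le> luxemburg_norm p \<Omega> (\<lambda>x. u x - v x) + luxemburg_norm p \<Omega> h"
    unfolding W1p_norm_def using *(3) by (intro Inf_lower) auto
  then show "\<exists>v\<in>W1p p UNIV. compact_support_in \<Omega> v \<and> W1p_norm p \<Omega> (\<lambda>x. u x - v x) < \<epsilon>"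
    using * by (auto intro: order.strict_trans1)
qed

context bounded_exponent_vec
begin

lemma quasicontinuous_vanishing_W1p0:
  fixes u :: "real^'n \<Rightarrow> ereal" and v :: "real^'n \<Rightarrow> real"
  assumes "open \<Omega>" and qc: "quasicontinuous_on p UNIV u"
    and v: "v \<in> W1p p \<Omega>" and uv: "AE x in lebesgue_on \<Omega>. u x = ereal (v x)"
    and N: "capacity p N = 0" "\<And>x. x \<in> frontier \<Omega> - N \<Longrightarrow> u x = 0"
  shows "v \<in> W1p0 p \<Omega>"
proof -
  have \<Omega>: "\<Omega> \<in> sets lebesgue"
    using \<open>open \<Omega>\<close> by simp
  obtain g where v_Lp: "v \<in> Lp_var p \<Omega>" and g: "g \<in> Lp_var p \<Omega>" and wg: "weak_gradient \<Omega> v g"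
    using v by (auto simp: W1p_def)
  obtain \<psi> \<rho> :: "nat \<Rightarrow> real \<Rightarrow> real" where \<psi>: "\<And>k. bounded_C1 (\<psi> k) (\<rho> k)"
    "\<And>k t. \<bar>\<psi> k t\<bar> \<le> \<bar>t\<bar>" "\<And>k t. \<bar>\<psi> k t\<bar> \<le> real k + 2" "\<And>k t. \<bar>\<rho> k t\<bar> \<le> 1"
    "\<And>k t. \<bar>t\<bar> \<le> 1 / real (Suc k) \<Longrightarrow> \<psi> k t = 0" "\<And>k t. \<bar>t\<bar> \<le> 1 / real (Suc k) \<Longrightarrow> \<rho> k t = 0"
    "\<And>t. (\<lambda>k. \<psi> k t) \<longlonglongrightarrow> t" "\<And>t. t \<noteq> 0 \<Longrightarrow> (\<lambda>k. \<rho> k t) \<longlonglongrightarrow> 1"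
    using truncation_sequence by metis
  obtain D where D: "D > 0" "\<And>k x. norm (grad (cutoff k) (x :: real^'n)) \<le> D / real (Suc k)"
    using grad_cutoff_bound by blast
  txt \<open>\<open>c k\<close> bounds \<open>\<psi>\<^sub>k(v) \<chi>'(w\<^sub>k)\<close>, and \<open>d k\<close>, the bound for the modulars of \<open>w\<^sub>k\<close> and its gradient,
    compensates for it.\<close>
  define c where "c k = 4 * (real k + 2)" for k
  have c1: "1 \<le> c k" for k
    by (simp add: c_def)
  define d where "d k = (1 / 2) ^ k / c k powr M" for k
  have d0: "d k > 0" for k
    using c1[of k] by (simp add: d_def)
  have "\<forall>k. \<exists>U w h V. continuous_on (UNIV - U) u \<and>
      w \<in> Lp_var p UNIV \<and> h \<in> Lp_var p UNIV \<and> weak_gradient UNIV w h \<and> open V \<and> U \<subseteq> V \<and> N \<subseteq> V \<and>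
      (AE x in lebesgue. x \<in> V \<longrightarrow> 1 \<le> w x) \<and>
      modular p UNIV w \<le> ennreal (d k) \<and> modular p UNIV h \<le> ennreal (d k)"
  proof
    fix k
    \<comment> \<open>This capacity tolerance leaves a test function for the union of
      \<open>U\<close> and \<open>N\<close> with both modulars at most \<open>d k\<close>.\<close>
    have "ennreal (d k / (2 * 8 powr M)) > 0"
      using d0[of k] by simp
    then obtain U where U: "open U" "capacity p U < ennreal (d k / (2 * 8 powr M))"
        "continuous_on (UNIV - U) u"
      using qc unfolding quasicontinuous_on_def by blast
    obtain w h V where "w \<in> Lp_var p UNIV" "h \<in> Lp_var p UNIV" "weak_gradient UNIV w h" "open V" "U \<union> N \<subseteq> V"
      "AE x in lebesgue. x \<in> V \<longrightarrow> 1 \<le> w x" "modular p UNIV w \<le> ennreal (d k)" "modular p UNIV h \<le> ennreal (d k)"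
      by (rule capacity_zero_union_witness[OF U(2) N(1) d0])
    with U(3) show "\<exists>U w h V. continuous_on (UNIV - U) u \<and>
      w \<in> Lp_var p UNIV \<and> h \<in> Lp_var p UNIV \<and> weak_gradient UNIV w h \<and> open V \<and> U \<subseteq> V \<and> N \<subseteq> V \<and>
      (AE x in lebesgue. x \<in> V \<longrightarrow> 1 \<le> w x) \<and>
      modular p UNIV w \<le> ennreal (d k) \<and> modular p UNIV h \<le> ennreal (d k)"
      by blast
  qed
  then obtain U w h V where U: "\<And>k. continuous_on (UNIV - U k) u"
    and w: "\<And>k. w k \<in> Lp_var p UNIV" "\<And>k. h k \<in> Lp_var p UNIV" "\<And>k. weak_gradient UNIV (w k) (h k)"
    and V: "\<And>k. open (V k)" "\<And>k. U k \<subseteq> V k" "\<And>k. N \<subseteq> V k" "\<And>k. AE x in lebesgue. x \<in> V k \<longrightarrow> 1 \<le> w k x"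
    and small: "\<And>k. modular p UNIV (w k) \<le> ennreal (d k)" "\<And>k. modular p UNIV (h k) \<le> ennreal (d k)"
    unfolding choice_iff by blast
  note wg\<Omega> = weak_gradient_subset[OF w(3) \<open>open \<Omega>\<close> open_UNIV subset_UNIV]

  \<comment> \<open>The approximants and their weak gradients in \<Omega>\<close>
  define vk where "vk k x = cutoff k x * (\<psi> k (v x) * tent (w k x))" for k x
  define gk where "gk k x = cutoff k x *\<^sub>R ((\<rho> k (v x) * tent (w k x)) *\<^sub>R g x
      + (\<psi> k (v x) * tent_deriv (w k x)) *\<^sub>R h k x) + (\<psi> k (v x) * tent (w k x)) *\<^sub>R grad (cutoff k) x" for k x
  have wk: "weak_gradient \<Omega> (vk k) (gk k)" for k
    unfolding vk_def gk_def
    by (intro weak_gradient_mult_test weak_gradient_comp_mult \<open>open \<Omega>\<close> wg wg\<Omega> \<psi>(1) bounded_C1_tent cutoff_test_function)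

  have [measurable]: "v \<in> borel_measurable (lebesgue_on \<Omega>)" "g \<in> borel_measurable (lebesgue_on \<Omega>)"
    using v_Lp g by (auto simp: Lp_var_iff)
  have w\<Omega>: "w k \<in> Lp_var p \<Omega>" "h k \<in> Lp_var p \<Omega>" for k
    using Lp_var_restrict[OF \<Omega>] w by auto
  then have [measurable]: "w k \<in> borel_measurable (lebesgue_on \<Omega>)" "h k \<in> borel_measurable (lebesgue_on \<Omega>)" for k
    by (auto simp: Lp_var_iff)
  note [measurable] = bounded_C1_measurable[OF \<psi>(1)] bounded_C1_measurable[OF bounded_C1_tent]
  have [measurable]: "cutoff k \<in> borel_measurable (lebesgue_on \<Omega>)" "grad (cutoff k) \<in> borel_measurable (lebesgue_on \<Omega>)" for k
  proof -
    show "cutoff k \<in> borel_measurable (lebesgue_on \<Omega>)"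
      by (intro lebesgue_on_measurable_subset measurable_lebesgue_continuous
          test_functions_continuous[OF cutoff_test_function])
    show "grad (cutoff k) \<in> borel_measurable (lebesgue_on \<Omega>)"
      by (intro lebesgue_on_measurable_subset measurable_completion)
        (simp add: borel_measurable_continuous_onI continuous_grad[OF test_functions_C_k[OF cutoff_test_function]])
  qed
  have mk [measurable]: "vk k \<in> borel_measurable (lebesgue_on \<Omega>)" "gk k \<in> borel_measurable (lebesgue_on \<Omega>)" for k
    unfolding vk_def gk_def by measurable
  have [measurable]: "(indicator \<Omega> :: _ \<Rightarrow> real) \<in> borel_measurable (lebesgue_on \<Omega>)"
    by (intro lebesgue_on_measurable_subset borel_measurable_indicator \<Omega>)
  have [measurable]: "(\<lambda>x. indicator \<Omega> x * vk k x) \<in> borel_measurable (lebesgue_on \<Omega>)"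
    "(\<lambda>x. indicator \<Omega> x *\<^sub>R gk k x) \<in> borel_measurable (lebesgue_on \<Omega>)" for k
    by (intro borel_measurable_times borel_measurable_scaleR mk; measurable)+

  \<comment> \<open>Pointwise domination and the term carrying \<open>h\<close>\<close>
  have \<psi>tent: "\<bar>\<psi> k (v x) * tent (w k x)\<bar> \<le> \<bar>v x\<bar>" for k x
    using \<psi>(2)[of k "v x"] tent_bounds[of "w k x"] mult_mono[of "\<bar>\<psi> k (v x)\<bar>" "\<bar>v x\<bar>" "\<bar>tent (w k x)\<bar>" 1]
    by (simp add: abs_mult)
  have vk_le: "\<bar>vk k x\<bar> \<le> \<bar>v x\<bar>" for k x
    using \<psi>tent[of k x] cutoff_bounds[of k x] mult_mono[of "\<bar>cutoff k x\<bar>" 1 "\<bar>\<psi> k (v x) * tent (w k x)\<bar>" "\<bar>v x\<bar>"]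
    by (simp add: vk_def abs_mult)
  \<comment> \<open>\<open>Ak\<close> has a dominating function independent of k and is treated by
    dominated convergence. \<open>Bk\<close> contains the varying field \<open>h k\<close>; its
    modular is instead bounded by 2^-k.\<close>
  define Ak where "Ak k x = (cutoff k x * (\<rho> k (v x) * tent (w k x))) *\<^sub>R g x
      + (\<psi> k (v x) * tent (w k x)) *\<^sub>R grad (cutoff k) x" for k x
  define Bk where "Bk k x = (cutoff k x * (\<psi> k (v x) * tent_deriv (w k x))) *\<^sub>R h k x" for k x
  have gk_eq: "gk k x = Ak k x + Bk k x" for k x
    by (simp add: gk_def Ak_def Bk_def algebra_simps)
  have AB [measurable]: "Ak k \<in> borel_measurable (lebesgue_on \<Omega>)" "Bk k \<in> borel_measurable (lebesgue_on \<Omega>)" for k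
    unfolding Ak_def Bk_def by measurable
  \<comment> \<open>One \<open>norm (g x)\<close> is for the limit gradient and one for the first
    term of \<open>Ak\<close>; \<open>D * \<bar>v x\<bar>\<close> dominates its second term.\<close>
  define F where "F x = 2 * norm (g x) + D * \<bar>v x\<bar>" for x
  have F: "F \<in> Lp_var p \<Omega>"
  proof -
    have "(\<lambda>x. 2 * norm (g x)) \<in> Lp_var p \<Omega>"
      by (rule Lp_var_bound[OF g, where c = 2]) auto
    moreover have "(\<lambda>x. D * \<bar>v x\<bar>) \<in> Lp_var p \<Omega>"
      by (rule Lp_var_bound[OF v_Lp, where c = "max 1 D"]) (auto simp: abs_mult mult_right_mono D(1) less_imp_le)
    ultimately show ?thesis
      unfolding F_def by (rule Lp_var_add)
  qed
  then have [measurable]: "F \<in> borel_measurable (lebesgue_on \<Omega>)"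
    by (simp add: Lp_var_iff)
  have \<rho>1: "\<bar>cutoff k x * (\<rho> k (v x) * tent (w k x))\<bar> \<le> 1" for k x
    unfolding abs_mult using \<psi>(4)[of k "v x"] tent_bounds[of "w k x"] cutoff_bounds[of k x]
    by (intro mult_le_one) auto
  have D1: "norm (grad (cutoff k) x) \<le> D" for k and x :: "real^'n"
    by (rule order_trans[OF D(2)]) (use D(1) in \<open>simp add: field_simps\<close>)
  have A2: "norm ((\<psi> k (v x) * tent (w k x)) *\<^sub>R grad (cutoff k) x) \<le> \<bar>v x\<bar> * (D / real (Suc k))" for k x
    using mult_mono[OF \<psi>tent[of k x] D(2)[of k x]] by (simp add: abs_mult)
  have Ak_le: "norm (Ak k x) \<le> norm (g x) + D * \<bar>v x\<bar>" for k x
    unfolding Ak_def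
  proof (rule norm_le_sum_add)
    show "norm ((cutoff k x * (\<rho> k (v x) * tent (w k x))) *\<^sub>R g x) \<le> norm (g x)"
      using mult_right_mono[OF \<rho>1[of k x], of "norm (g x)"] by simp
    show "norm ((\<psi> k (v x) * tent (w k x)) *\<^sub>R grad (cutoff k) x) \<le> D * \<bar>v x\<bar>"
      using mult_mono[OF \<psi>tent[of k x] D1[of k x]] by (simp add: abs_mult mult.commute)
  qed
  have Bk_le: "norm (Bk k x) \<le> c k * norm (h k x)" for k x
  proof -
    have "\<bar>cutoff k x\<bar> * (\<bar>\<psi> k (v x)\<bar> * \<bar>tent_deriv (w k x)\<bar>) \<le> 1 * ((real k + 2) * 4)"
      using \<psi>(3)[of k "v x"] tent_bounds(3)[of "w k x"] cutoff_bounds[of k x] by (intro mult_mono) auto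
    from mult_right_mono[OF this norm_ge_zero[of "h k x"]] show ?thesis
      by (simp add: Bk_def abs_mult c_def mult_ac)
  qed
  have Bk_mod: "modular p \<Omega> (Bk k) \<le> ennreal ((1 / 2) ^ k)" for k
  proof -
    have "modular p \<Omega> (Bk k) \<le> ennreal (c k powr M) * modular p \<Omega> (h k)"
      using Bk_le by (intro modular_cmult_le AE_I2 c1) auto
    also have "\<dots> \<le> ennreal (c k powr M) * ennreal (d k)"
      by (intro mult_left_mono order_trans[OF modular_le_UNIV[OF \<Omega>] small(2)]) auto
    also have "\<dots> = ennreal ((1 / 2) ^ k)"
      using c1[of k] by (simp add: ennreal_mult[symmetric] d_def)
    finally show ?thesis .
  qed

  \<comment> \<open>Almost everywhere convergence of the capacity factors\<close>
  have w_lim: "AE x in lebesgue_on \<Omega>. (\<lambda>k. tent (w k x)) \<longlonglongrightarrow> 1"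
  proof -
    have "AE x in lebesgue_on \<Omega>. (\<lambda>k. ennreal (norm (w k x) powr real_of_ereal (p x))) \<longlonglongrightarrow> 0"
    proof (rule AE_tendsto_0_of_summable_nn_integral)
      fix k
      have "modular p \<Omega> (w k) \<le> ennreal (d k)"
        by (rule order_trans[OF modular_le_UNIV[OF \<Omega>] small(1)])
      also have "d k \<le> (1 / 2) ^ k"
        using ge_one_powr_ge_zero[OF c1[of k], of M] M_ge_1 by (simp add: d_def divide_le_eq)
      finally show "(\<integral>\<^sup>+x. ennreal (norm (w k x) powr real_of_ereal (p x)) \<partial>lebesgue_on \<Omega>) \<le> ennreal ((1 / 2) ^ k)"
        by (simp add: modular_def ennreal_leI)
    qed measurable
    then show ?thesis
    proof eventually_elim
      case (elim x)
      have "(\<lambda>k. norm (w k x) powr real_of_ereal (p x)) \<longlonglongrightarrow> 0"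
        using elim by (simp add: tendsto_ennreal_iff[of _ _ 0, simplified])
      \<comment> \<open>At fixed x the exponent is a positive constant, so its root may be taken
        inside the limit.\<close>
      then have "(\<lambda>k. (norm (w k x) powr real_of_ereal (p x)) powr (1 / real_of_ereal (p x))) \<longlonglongrightarrow> 0"
        by (rule tendsto_zero_powrI[OF _ tendsto_const]) (use p_pos in auto)
      moreover have "(a powr real_of_ereal (p x)) powr (1 / real_of_ereal (p x)) = a" if "a \<ge> 0" for a
        using p_pos[of x] that by (simp add: powr_powr)
      ultimately have "(\<lambda>k. norm (w k x)) \<longlonglongrightarrow> 0"
        by simp
      then have "(\<lambda>k. w k x) \<longlonglongrightarrow> 0"
        by (rule tendsto_norm_zero_cancel)
      then have "(\<lambda>k. tent (w k x)) \<longlonglongrightarrow> tent 0"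
        by (rule isCont_tendsto_compose[OF isCont_tent])
      then show ?case
        by (simp add: tent_def)
    qed
  qed

  \<comment> \<open>Convergence of the functions and of their gradients\<close>
  have lim_v: "(\<lambda>k. luxemburg_norm p \<Omega> (\<lambda>x. v x - indicator \<Omega> x * vk k x)) \<longlonglongrightarrow> 0"
  proof (rule luxemburg_norm_tendsto_0)
    show "(\<lambda>k. modular p \<Omega> (\<lambda>x. v x - indicator \<Omega> x * vk k x)) \<longlonglongrightarrow> 0"
    proof (rule modular_tendsto_0_dominated[where F = "\<lambda>x. 2 * v x"])
      show "AE x in lebesgue_on \<Omega>. (\<lambda>k. v x - indicator \<Omega> x * vk k x) \<longlonglongrightarrow> 0"
        using w_lim AE_space
      proof eventually_elim
        case (elim x)
        have "(\<lambda>k. v x - cutoff k x * (\<psi> k (v x) * tent (w k x))) \<longlonglongrightarrow> v x - 1 * (v x * 1)"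
          by (intro tendsto_intros cutoff_tendsto \<psi> elim)
        then show ?case
          using elim by (simp add: vk_def)
      qed
      show "AE x in lebesgue_on \<Omega>. norm (v x - indicator \<Omega> x * vk k x) \<le> norm (2 * v x)" for k
      proof (intro AE_I2)
        fix x
        show "norm (v x - indicator \<Omega> x * vk k x) \<le> norm (2 * v x)"
          using vk_le[of k x] by (auto simp: indicator_def)
      qed
      have "(\<lambda>x. 2 * v x) \<in> Lp_var p \<Omega>"
        by (rule Lp_var_bound[OF v_Lp, where c = 2]) auto
      then show "modular p \<Omega> (\<lambda>x. 2 * v x) < \<infinity>"
        by (simp add: Lp_var_iff)
    qed auto
  qed auto

  \<comment> \<open>This is the weak gradient of \<open>v\<close> that the approximants reach: where
    \<open>v\<close> vanishes, \<psi>_k and \<rho>_k are 0 at \<open>v x\<close>, so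
    \<open>Ak\<close> vanishes there for every k.\<close>
  define g0 where "g0 x = (if v x = 0 then 0 else g x)" for x
  have g0 [measurable]: "g0 \<in> borel_measurable (lebesgue_on \<Omega>)"
    unfolding g0_def by measurable
  have lim_A: "(\<lambda>k. modular p \<Omega> (\<lambda>x. g0 x - Ak k x)) \<longlonglongrightarrow> 0"
  proof (rule modular_tendsto_0_dominated[where F = F])
    show "AE x in lebesgue_on \<Omega>. (\<lambda>k. g0 x - Ak k x) \<longlonglongrightarrow> 0"
      using w_lim
    proof eventually_elim
      case (elim x)
      show ?case
      proof (cases "v x = 0")
        case True
        then show ?thesis
          using \<psi>(5,6)[of 0] by (simp add: g0_def Ak_def)
      next
        case False
        have "(\<lambda>k. D / real (Suc k)) \<longlonglongrightarrow> 0"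
          using tendsto_mult[OF tendsto_const[of D] LIMSEQ_inverse_real_of_nat] by (simp add: field_simps)
        then have limD: "(\<lambda>k. \<bar>v x\<bar> * (D / real (Suc k))) \<longlonglongrightarrow> 0"
          by (rule tendsto_mult_right_zero)
        have "(\<lambda>k. (\<psi> k (v x) * tent (w k x)) *\<^sub>R grad (cutoff k) x) \<longlonglongrightarrow> 0"
          by (rule Lim_null_comparison[OF always_eventually limD]) (intro allI A2)
        then have "(\<lambda>k. g x - ((cutoff k x * (\<rho> k (v x) * tent (w k x))) *\<^sub>R g x
            + (\<psi> k (v x) * tent (w k x)) *\<^sub>R grad (cutoff k) x)) \<longlonglongrightarrow> g x - ((1 * (1 * 1)) *\<^sub>R g x + 0)"
          by (intro tendsto_diff tendsto_add tendsto_scaleR tendsto_mult tendsto_const cutoff_tendsto \<psi>(8) elim False)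
        then show ?thesis
          using False by (simp add: g0_def Ak_def)
      qed
    qed
    show "AE x in lebesgue_on \<Omega>. norm (g0 x - Ak k x) \<le> norm (F x)" for k
    proof (intro AE_I2)
      fix x
      have "norm (g0 x) \<le> norm (g x)"
        by (simp add: g0_def)
      then have "norm (g0 x - Ak k x) \<le> F x"
        using norm_triangle_ineq4[of "g0 x" "Ak k x"] Ak_le[of k x] by (simp add: F_def)
      then show "norm (g0 x - Ak k x) \<le> norm (F x)"
        by simp
    qed
    show "modular p \<Omega> F < \<infinity>"
      using F by (simp add: Lp_var_iff)
  qed auto
  have lim_g: "(\<lambda>k. luxemburg_norm p \<Omega> (\<lambda>x. g0 x - indicator \<Omega> x *\<^sub>R gk k x)) \<longlonglongrightarrow> 0"
  proof (rule luxemburg_norm_tendsto_0)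
    have "(\<lambda>k. ennreal ((1 / 2) ^ k)) \<longlonglongrightarrow> ennreal 0"
      by (intro tendsto_ennrealI LIMSEQ_power_zero) simp
    then have "(\<lambda>k. ennreal (2 powr M) * (modular p \<Omega> (\<lambda>x. g0 x - Ak k x) + ennreal ((1 / 2) ^ k)))
        \<longlonglongrightarrow> ennreal (2 powr M) * (0 + ennreal 0)"
      by (intro ennreal_tendsto_cmult tendsto_add lim_A) auto
    moreover have "modular p \<Omega> (\<lambda>x. g0 x - indicator \<Omega> x *\<^sub>R gk k x)
        \<le> ennreal (2 powr M) * (modular p \<Omega> (\<lambda>x. g0 x - Ak k x) + ennreal ((1 / 2) ^ k))" for k
    proof -
      have "modular p \<Omega> (\<lambda>x. g0 x - indicator \<Omega> x *\<^sub>R gk k x)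
          \<le> ennreal (2 powr M) * (modular p \<Omega> (\<lambda>x. g0 x - Ak k x) + modular p \<Omega> (Bk k))"
      proof (rule modular_add_le)
        show "AE x in lebesgue_on \<Omega>. norm (g0 x - indicator \<Omega> x *\<^sub>R gk k x) \<le> norm (g0 x - Ak k x) + norm (Bk k x)"
        proof (intro AE_I2)
          fix x
          assume "x \<in> space (lebesgue_on \<Omega>)"
          then have "g0 x - indicator \<Omega> x *\<^sub>R gk k x = (g0 x - Ak k x) - Bk k x"
            by (simp add: gk_eq)
          then show "norm (g0 x - indicator \<Omega> x *\<^sub>R gk k x) \<le> norm (g0 x - Ak k x) + norm (Bk k x)"
            by (simp only: norm_triangle_ineq4)
        qed
      qed auto
      also have "\<dots> \<le> ennreal (2 powr M) * (modular p \<Omega> (\<lambda>x. g0 x - Ak k x) + ennreal ((1 / 2) ^ k))"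
        by (intro mult_left_mono add_left_mono Bk_mod) auto
      finally show ?thesis .
    qed
    ultimately show "(\<lambda>k. modular p \<Omega> (\<lambda>x. g0 x - indicator \<Omega> x *\<^sub>R gk k x)) \<longlonglongrightarrow> 0"
      using tendsto_sandwich[where f = "\<lambda>_. 0" and g = "\<lambda>k. modular p \<Omega> (\<lambda>x. g0 x - indicator \<Omega> x *\<^sub>R gk k x)"
        and h = "\<lambda>k. ennreal (2 powr M) * (modular p \<Omega> (\<lambda>x. g0 x - Ak k x) + ennreal ((1 / 2) ^ k))"
        and c = 0 and net = sequentially]
      by simp
  qed auto

  \<comment> \<open>Compact support inside \<Omega>\<close>
  have "\<forall>k. \<exists>K. compact K \<and> K \<subseteq> \<Omega> \<and> (AE x in lebesgue. x \<in> \<Omega> - K \<longrightarrow> vk k x = 0 \<and> gk k x = 0)"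
  proof
    fix k
    \<comment> \<open>On this interval \<psi>_k and \<rho>_k vanish. The preimage of
      \<open>I\<close> under \<open>u\<close> is known to be relatively open off \<open>U k\<close>,
      so it is represented there by an open set \<open>A\<close>.\<close>
    define I where "I = {- ereal (1 / real (Suc k))<..<ereal (1 / real (Suc k))}"
    have "open I"
      by (simp add: I_def)
    then obtain A where A: "open A" "A \<inter> (UNIV - U k) = u -` I \<inter> (UNIV - U k)"
      using U[of k] unfolding continuous_on_open_invariant by blast
    \<comment> \<open>A frontier point outside \<open>V k\<close> lies in neither \<open>N\<close>
      nor \<open>U k\<close>, so \<open>u\<close> is 0 there and the point belongs to
      \<open>A\<close>. Removing \<open>A\<close> and \<open>V k\<close> from the closure of
      \<Omega> therefore leaves a closed set that misses the frontier, and the ball makes it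
      compact.\<close>
    define K where "K = cball 0 (real (Suc k)) \<inter> (closure \<Omega> - (A \<union> V k))"
    have "compact K"
      unfolding K_def using A(1) V(1) by (intro compact_Int_closed closed_Diff) auto
    moreover have "K \<subseteq> \<Omega>"
    proof
      fix x
      assume x: "x \<in> K"
      show "x \<in> \<Omega>"
      proof (rule ccontr)
        assume "x \<notin> \<Omega>"
        then have "x \<in> frontier \<Omega>"
          using x \<open>open \<Omega>\<close> by (auto simp: K_def frontier_def interior_open)
        moreover have "x \<notin> N" "x \<notin> U k"
          using x V(2,3)[of k] by (auto simp: K_def)
        ultimately have "u x \<in> I"
          using N(2) by (simp add: I_def)
        then have "x \<in> A"
          using A(2) \<open>x \<notin> U k\<close> by blast
        then show False
          using x by (simp add: K_def)
      qed
    qed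
    moreover have "AE x in lebesgue. x \<in> \<Omega> \<longrightarrow> u x = ereal (v x)"
      using uv \<Omega> by (simp add: AE_restrict_space_iff)
    then have "AE x in lebesgue. x \<in> \<Omega> - K \<longrightarrow> vk k x = 0 \<and> gk k x = 0"
      using V(4)[of k]
    proof eventually_elim
      case (elim x)
      show ?case
      proof
        assume x: "x \<in> \<Omega> - K"
        \<comment> \<open>In each case one factor vanishes together with its derivative, so that
          \<open>vk\<close> and \<open>gk\<close> are both 0.\<close>
        then consider "x \<notin> cball 0 (real (Suc k))" | "x \<in> V k" | "x \<in> A" "x \<notin> V k"
          using closure_subset[of \<Omega>] by (auto simp: K_def)
        then show "vk k x = 0 \<and> gk k x = 0"
        proof cases
          case 1
          then show ?thesis
            using cutoff_eq_0[OF 1] grad_cutoff_eq_0[OF 1] by (simp add: vk_def gk_def)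
        next
          case 2
          then have "1 \<le> \<bar>w k x\<bar>"
            using elim by auto
          then show ?thesis
            by (simp add: vk_def gk_def tent_eq_0)
        next
          case 3
          then have "x \<notin> U k"
            using V(2) by blast
          then have "u x \<in> I"
            using A(2) 3(1) by blast
          then have "\<bar>v x\<bar> \<le> 1 / real (Suc k)"
            using elim(1) x by (auto simp: I_def)
          then show ?thesis
            by (simp add: vk_def gk_def \<psi>(5,6))
        qed
      qed
    qed
    ultimately show "\<exists>K. compact K \<and> K \<subseteq> \<Omega> \<and>
        (AE x in lebesgue. x \<in> \<Omega> - K \<longrightarrow> vk k x = 0 \<and> gk k x = 0)"
      by blast
  qed
  then obtain K where K: "\<And>k. compact (K k)" "\<And>k. K k \<subseteq> \<Omega>"
    "\<And>k. AE x in lebesgue. x \<in> \<Omega> - K k \<longrightarrow> vk k x = 0 \<and> gk k x = 0"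
    unfolding choice_iff by blast

  \<comment> \<open>Extension by zero and conclusion\<close>
  have wk0: "weak_gradient UNIV (\<lambda>x. indicator \<Omega> x * vk k x) (\<lambda>x. indicator \<Omega> x *\<^sub>R gk k x)" for k
    by (rule weak_gradient_extend_zero[OF \<open>open \<Omega>\<close> wk mk K])
  have vk_Lp: "vk k \<in> Lp_var p \<Omega>" for k
    by (rule Lp_var_bound[OF v_Lp mk(1), where c = 1]) (use vk_le in auto)
  have gk_Lp: "gk k \<in> Lp_var p \<Omega>" for k
  proof -
    have "Ak k \<in> Lp_var p \<Omega>"
    proof (rule Lp_var_bound[OF F AB(1), where c = 1], simp, intro AE_I2)
      fix x
      have "norm (Ak k x) \<le> F x"
        using Ak_le[of k x] norm_ge_zero[of "g x"] unfolding F_def by linarith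
      then show "norm (Ak k x) \<le> 1 * norm (F x)"
        by simp
    qed
    moreover have "Bk k \<in> Lp_var p \<Omega>"
      by (rule Lp_var_bound[OF w\<Omega>(2) AB(2) c1]) (use Bk_le in auto)
    ultimately have "(\<lambda>x. Ak k x + Bk k x) \<in> Lp_var p \<Omega>"
      by (rule Lp_var_add)
    then show ?thesis
      by (simp flip: gk_eq)
  qed
  show ?thesis
  proof (rule W1p0_I[OF v])
    fix \<epsilon> :: ennreal
    assume "\<epsilon> > 0"
    have "(\<lambda>k. luxemburg_norm p \<Omega> (\<lambda>x. v x - indicator \<Omega> x * vk k x)
        + luxemburg_norm p \<Omega> (\<lambda>x. g0 x - indicator \<Omega> x *\<^sub>R gk k x)) \<longlonglongrightarrow> 0 + 0"
      by (intro tendsto_add lim_v lim_g)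
    from order_tendstoD(2)[OF this, of \<epsilon>]
    have "eventually (\<lambda>k. luxemburg_norm p \<Omega> (\<lambda>x. v x - indicator \<Omega> x * vk k x)
        + luxemburg_norm p \<Omega> (\<lambda>x. g0 x - indicator \<Omega> x *\<^sub>R gk k x) < \<epsilon>) sequentially"
      using \<open>\<epsilon> > 0\<close> by simp
    then obtain k where k: "luxemburg_norm p \<Omega> (\<lambda>x. v x - indicator \<Omega> x * vk k x)
        + luxemburg_norm p \<Omega> (\<lambda>x. g0 x - indicator \<Omega> x *\<^sub>R gk k x) < \<epsilon>"
      by (auto simp: eventually_sequentially)
    have "weak_gradient \<Omega> v g0"
      unfolding g0_def by (rule weak_gradient_zero_level[OF \<open>open \<Omega>\<close> wg])
    from weak_gradient_lincomb[OF \<open>open \<Omega>\<close> this weak_gradient_subset[OF wk0 \<open>open \<Omega>\<close> open_UNIV subset_UNIV], of 1 "-1" k]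
    have wd: "weak_gradient \<Omega> (\<lambda>x. v x - indicator \<Omega> x * vk k x) (\<lambda>x. g0 x - indicator \<Omega> x *\<^sub>R gk k x)"
      by simp
    have "(\<lambda>x. indicator \<Omega> x * vk k x) \<in> W1p p UNIV"
      using Lp_var_extend_zero[OF \<Omega> vk_Lp] Lp_var_extend_zero[OF \<Omega> gk_Lp] wk0[of k]
      by (auto simp: W1p_def)
    moreover have "compact_support_in \<Omega> (\<lambda>x. indicator \<Omega> x * vk k x)"
      unfolding compact_support_in_def
      using K(3)[of k] by (intro exI[of _ "K k"] conjI K) (auto elim!: eventually_mono simp: indicator_def)
    ultimately show "\<exists>v' h. v' \<in> W1p p UNIV \<and> compact_support_in \<Omega> v' \<and> weak_gradient \<Omega> (\<lambda>x. v x - v' x) h \<and>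
        luxemburg_norm p \<Omega> (\<lambda>x. v x - v' x) + luxemburg_norm p \<Omega> h < \<epsilon>"
      using wd k by blast
  qed
qed

end

theorem lemma2p4:
  fixes p :: "real^'n \<Rightarrow> ereal" and \<Omega> :: "(real^'n) set" and u :: "real^'n \<Rightarrow> ereal"
  assumes "admissible_exponent p"
    and "open \<Omega>" and "\<Omega> \<noteq> {}"
    and "quasicontinuous_on p UNIV u"
    and "restriction_in \<Omega> u (W1p p \<Omega>)"
    and "quasieverywhere_on p (frontier \<Omega>) (\<lambda>x. u x = 0)"
  shows "restriction_in \<Omega> u (W1p0 p \<Omega>)"
proof -
  obtain M where "\<And>x. 1 \<le> real_of_ereal (p x)" "\<And>x. real_of_ereal (p x) \<le> M"
    "(\<lambda>x. real_of_ereal (p x)) \<in> borel_measurable lebesgue"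
    using admissible_exponent_bounds[OF assms(1)] by blast
  then interpret bounded_exponent_vec p M
    by unfold_locales
  obtain v where v: "v \<in> W1p p \<Omega>" "AE x in lebesgue_on \<Omega>. u x = ereal (v x)"
    using assms(5) by (auto simp: restriction_in_def)
  obtain N where "capacity p N = 0" "\<And>x. x \<in> frontier \<Omega> - N \<Longrightarrow> u x = 0"
    using assms(6) by (auto simp: quasieverywhere_on_def)
  from quasicontinuous_vanishing_W1p0[OF assms(2,4) v this] v(2) show ?thesis
    by (auto simp: restriction_in_def)
qed

end
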